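(* Let $\kappa$ be a regular uncountable cardinal, $\chi<\kappa$ an infinite regular cardinal such that $\kappa$ is $({<}\chi)$-closed, and $\varsigma<\kappa$ an ordinal. If $\mathrm P^\bullet(\kappa,\kappa,{}_\chi{\sqsubseteq^*},1,\{E^\kappa_{\ge\chi}\},\kappa)$ holds, then there exists a normal, prolific, $\varsigma$-splitting, $\chi$-complete streamlined $\kappa$-Souslin tree.
   Context: $\kappa$ is $({<}\chi)$-closed if $\lambda^{<\chi}<\kappa$ for all $\lambda<\kappa$. $E^\kappa_{\ge\chi}:=\{\alpha<\kappa\mid\mathrm{cf}(\alpha)\ge\chi\}$. $H_\kappa$: sets of hereditary cardinality $<\kappa$. A streamlined tree is a set $T\subseteq{}^{<\kappa}H_\kappa$ closed under restrictions ($t\restriction\beta\in T$ for $t\in T$, $\beta<\mathrm{dom}(t)$), ordered by $\subsetneq$; $T_\alpha:=T\cap{}^\alpha H_\kappa$. It is a streamlined $\kappa$-Souslin tree if $(T,\subsetneq)$ has height $\kappa$, all levels of size $<\kappa$, and no branch or antichain of size $\kappa$. $T$ is normal if for $\alpha<\beta$ with $T_\beta\neq\emptyset$, every $s\in T_\alpha$ has an extension in $T_\beta$; prolific if for all $\alpha<\kappa$ and $t\in T_\alpha$, $\{t^\frown\langle i\rangle\mid i<\max\{\omega,\alpha\}\}\subseteq T_{\alpha+1}$; $\varsigma$-splitting if every node has at least $\varsigma$ immediate successors; $\chi$-complete if the union of every $\subsetneq$-increasing sequence of elements of $T$ of length $<\chi$ is in $T$. Notation: $\mathrm{acc}(C):=\{\alpha\in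 C\mid\sup(C\cap\alpha)=\alpha>0\}$; $C(j)$ is the $j$-th element of $C$; $\mathrm{succ}_n(C):=\{C(j+1)\mid j<n,\ j+1<\mathrm{otp}(C)\}$; $\mathrm{acc}(\kappa)$: nonzero limit ordinals below $\kappa$. $\mathcal F(\kappa)$: functions $C$ whose domain $\partial C$ is a nonempty club subset of $\sup(\partial C)$ not containing its supremum, with values in $H_\kappa$; $\alpha_C:=\sup(\partial C)$. $C\sqsubseteq^*D$ iff $\exists\gamma<\alpha_C$ with $C\restriction(\partial C\setminus\gamma)=D\restriction(\partial D\cap[\gamma,\alpha_C))$; $C\,{}_\chi{\sqsubseteq^*}\,D$ iff ($C\sqsubseteq^*D$ or $\mathrm{cf}(\alpha_C)<\chi$). For $B\subseteq\kappa$, $\Omega\subseteq H_\kappa$, $p\in H_{\kappa^+}$, $C\in\mathcal F(\kappa)$: $B(\Omega,p,C)$ is the set of $\beta\in B\cap\partial C$ for which some $\mathcal M\prec H_{\kappa^+}$ has $p\in\mathcal M$, $\mathcal M\cap\kappa=\beta$, $\mathcal M\cap\Omega=C(\beta)$. $\mathrm P^\bullet(\kappa,\mu,\mathcal R,\theta,\mathcal S,\nu)$ asserts the existence of $\langle\mathcal C_\alpha\mid\alpha<\kappa\rangle$ and a partition $\langle B_\iota\mid\iota<\kappa\rangle$ of $\kappa$ such that for every $\alpha\in\mathrm{acc}(\kappa)$: $\mathcal C_\alpha\subseteq\{C\in\mathcal F(\kappa)\mid\alpha_C=\alpha\}$, $0<|\mathcal C_\alpha|<\mu$, and for all $C\in\mathcal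 C_\alpha$, $\bar\alpha\in\mathrm{acc}(\partial C)$ there is $D\in\mathcal C_{\bar\alpha}$ with $D\,\mathcal R\,C$; and for every $\langle(\Omega_i,p_i,\iota_i)\mid i<\theta\rangle$ of elements of $\mathcal P(H_\kappa)\times H_{\kappa^+}\times\kappa$, every $S\in\mathcal S$ and every $n<\omega$, there are stationarily many $\alpha\in S$ with $|\mathcal C_\alpha|<\nu$ such that for all $C\in\mathcal C_\alpha$, $i<\min\{\alpha,\theta\}$: $\sup\{\gamma\in\partial C\mid\mathrm{succ}_n(\partial C\setminus\gamma)\subseteq B_{\iota_i}(\Omega_i,p_i,C)\}=\alpha$. *)

theory Defs
  imports Main "HOL-Library.Countable_Set" "HOL-Library.Disjoint_Sets"
begin

unbundle cardinal_syntax

section \<open>A universe of sets over a type\<close>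

text \<open>
  Well-founded trees whose inner nodes carry families of subtrees indexed by the type \<open>'k\<close>, taken
  modulo bisimulation, are the well-founded sets that hereditarily have at most \<open>|'k|\<close> elements.
  For infinite \<open>'k\<close> of cardinality \<open>\<mu>\<close> this is \<open>H\<^bsub>\<mu>\<^sup>+\<^esub>\<close>, so it contains \<open>H\<^bsub>\<kappa>\<^sup>+\<^esub>\<close> for each
  of its own cardinals \<open>\<kappa>\<close>, and every cardinal of a HOL type occurs in such a universe.
\<close>

datatype 'k stree = Leaf | Node "'k \<Rightarrow> 'k stree"

primrec children :: "'k stree \<Rightarrow> 'k stree set" where
  "children Leaf = {}"
| "children (Node f) = range f"

primrec bisim :: "'k stree \<Rightarrow> 'k stree \<Rightarrow> bool" where
  "bisim Leaf = (\<lambda>t. children t = {})"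
| "bisim (Node f) = (\<lambda>t. (\<forall>i. \<exists>u\<in>children t. bisim (f i) u) \<and>
                         (\<forall>u\<in>children t. \<exists>i. bisim (f i) u))"

lemma bisimI:
  assumes "\<And>x. x \<in> children s \<Longrightarrow> \<exists>y\<in>children t. bisim x y"
    and "\<And>y. y \<in> children t \<Longrightarrow> \<exists>x\<in>children s. bisim x y"
  shows "bisim s t"
  using assms by (cases s) auto

lemma bisimD1: "bisim s t \<Longrightarrow> x \<in> children s \<Longrightarrow> \<exists>y\<in>children t. bisim x y"
  by (cases s) auto

lemma bisimD2: "bisim s t \<Longrightarrow> y \<in> children t \<Longrightarrow> \<exists>x\<in>children s. bisim x y"
  by (cases s) auto

lemma stree_induct [case_names children]:
  assumes "\<And>t. (\<And>u. u \<in> children t \<Longrightarrow> P u) \<Longrightarrow> P t"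
  shows "P t"
proof (induction t)
  case Leaf
  show ?case by (rule assms) simp
next
  case (Node f)
  then show ?case by (intro assms[of "Node f"]) auto
qed

lemma bisim_refl: "bisim t t"
proof (induction t rule: stree_induct)
  case (children t)
  show ?case by (rule bisimI) (use children in blast)+
qed

lemma bisim_sym: "bisim s t \<Longrightarrow> bisim t s"
proof (induction s arbitrary: t rule: stree_induct)
  case (children s)
  show ?case
  proof (rule bisimI)
    fix y assume "y \<in> children t"
    then show "\<exists>x\<in>children s. bisim y x"
      using bisimD2[OF children.prems] children.IH by blast
  next
    fix x assume x: "x \<in> children s"
    then show "\<exists>y\<in>children t. bisim y x"
      using bisimD1[OF children.prems x] children.IH[OF x] by blast
  qed
qed

lemma bisim_trans: "bisim s t \<Longrightarrow> bisim t u \<Longrightarrow> bisim s u"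
proof (induction s arbitrary: t u rule: stree_induct)
  case (children s)
  show ?case
  proof (rule bisimI)
    fix x assume x: "x \<in> children s"
    obtain y where y: "y \<in> children t" "bisim x y"
      using bisimD1[OF children.prems(1) x] by blast
    obtain z where z: "z \<in> children u" "bisim y z"
      using bisimD1[OF children.prems(2) y(1)] by blast
    show "\<exists>z\<in>children u. bisim x z" using children.IH[OF x y(2) z(2)] z(1) by blast
  next
    fix z assume z: "z \<in> children u"
    obtain y where y: "y \<in> children t" "bisim y z"
      using bisimD2[OF children.prems(2) z] by blast
    obtain x where x: "x \<in> children s" "bisim x y"
      using bisimD2[OF children.prems(1) y(1)] by blast
    show "\<exists>x\<in>children s. bisim x z" using children.IH[OF x(1,2) y(2)] x(1) by blast
  qed
qed

quotient_type 'k hset = "'k stree" / bisim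
proof (intro equivpI reflpI sympI transpI)
  show "bisim t t" for t :: "'k stree" by (rule bisim_refl)
  show "bisim t s" if "bisim s t" for s t :: "'k stree" using that by (rule bisim_sym)
  show "bisim s u" if "bisim s t" "bisim t u" for s t u :: "'k stree"
    using that by (rule bisim_trans)
qed

definition elts :: "'k hset \<Rightarrow> 'k hset set" where
  "elts x = abs_hset ` children (rep_hset x)"

lemma abs_hset_eq_iff: "abs_hset s = abs_hset t \<longleftrightarrow> bisim s t"
  by (metis Quotient3_hset Quotient3_rel bisim_refl)

lemma abs_rep_hset: "abs_hset (rep_hset x) = x"
  by (rule Quotient3_abs_rep[OF Quotient3_hset])

lemma elts_abs: "elts (abs_hset t) = abs_hset ` children t"
proof -
  have *: "bisim (rep_hset (abs_hset t)) t"
    using abs_rep_hset[of "abs_hset t"] by (simp only: abs_hset_eq_iff)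
  show ?thesis
    unfolding elts_def
  proof (intro equalityI subsetI)
    fix y assume "y \<in> abs_hset ` children (rep_hset (abs_hset t))"
    then obtain u where u: "u \<in> children (rep_hset (abs_hset t))" "y = abs_hset u" by blast
    with bisimD1[OF * u(1)] show "y \<in> abs_hset ` children t"
      by (metis abs_hset_eq_iff image_eqI)
  next
    fix y assume "y \<in> abs_hset ` children t"
    then obtain u where u: "u \<in> children t" "y = abs_hset u" by blast
    with bisimD2[OF * u(1)] show "y \<in> abs_hset ` children (rep_hset (abs_hset t))"
      by (metis abs_hset_eq_iff image_eqI)
  qed
qed

lemma hset_cases: obtains t where "x = abs_hset t"
  by (metis abs_rep_hset)

lemma elts_inject: "elts x = elts y \<longleftrightarrow> x = y"
proof
  assume eq: "elts x = elts y"
  obtain s t where st: "x = abs_hset s" "y = abs_hset t" by (metis hset_cases)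
  have *: "abs_hset ` children s = abs_hset ` children t" using eq by (simp add: st elts_abs)
  have "bisim s t"
  proof (rule bisimI)
    fix a assume "a \<in> children s"
    then have "abs_hset a \<in> abs_hset ` children t" using * by blast
    then show "\<exists>b\<in>children t. bisim a b" by (auto simp: abs_hset_eq_iff)
  next
    fix b assume "b \<in> children t"
    then have "abs_hset b \<in> abs_hset ` children s" using * by blast
    then show "\<exists>a\<in>children s. bisim a b" by (metis abs_hset_eq_iff image_iff)
  qed
  then show "x = y" by (simp add: st abs_hset_eq_iff)
qed simp

lemma wf_elts: "wf {(x, y). x \<in> elts y}"
proof (rule wfUNIVI)
  fix P :: "'k hset \<Rightarrow> bool" and x
  assume *: "\<forall>x. (\<forall>y. (y, x) \<in> {(x, y). x \<in> elts y} \<longrightarrow> P y) \<longrightarrow> P x"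
  have "P (abs_hset t)" for t
  proof (induction t rule: stree_induct)
    case (children t)
    then have "\<forall>y. y \<in> elts (abs_hset t) \<longrightarrow> P y" by (auto simp: elts_abs)
    then show ?case using * by blast
  qed
  then show "P x" by (metis hset_cases)
qed

lemma ex_elts_iff:
  fixes X :: "'k hset set"
  shows "(\<exists>x. elts x = X) \<longleftrightarrow> |X| \<le>o |UNIV :: 'k set|"
proof
  assume "\<exists>x. elts x = X"
  then obtain t where X: "X = abs_hset ` children t" by (metis hset_cases elts_abs)
  show "|X| \<le>o |UNIV :: 'k set|"
  proof (cases t)
    case Leaf
    then show ?thesis by (simp add: X card_of_empty)
  next
    case (Node f)
    then have "X = (\<lambda>i. abs_hset (f i)) ` UNIV" by (auto simp: X)
    then show ?thesis using card_of_image by metis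
  qed
next
  assume le: "|X| \<le>o |UNIV :: 'k set|"
  show "\<exists>x. elts x = X"
  proof (cases "X = {}")
    case True
    then have "elts (abs_hset Leaf) = X" by (simp add: elts_abs)
    then show ?thesis ..
  next
    case False
    then obtain g :: "'k \<Rightarrow> 'k hset" where g: "range g = X"
      using le card_of_ordLeq2[OF False, of "UNIV :: 'k set"] by blast
    have "elts (abs_hset (Node (\<lambda>i. rep_hset (g i)))) = X"
      using g by (auto simp: elts_abs image_iff abs_rep_hset)
    then show ?thesis ..
  qed
qed

definition vset :: "'k hset set \<Rightarrow> 'k hset" where
  "vset X = (THE x. elts x = X)"

lemma elts_vset:
  fixes X :: "'k hset set"
  assumes "|X| \<le>o |UNIV :: 'k set|"
  shows "elts (vset X) = X"
proof -
  have "\<exists>!x. elts x = X" using assms ex_elts_iff elts_inject by metis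
  then show ?thesis unfolding vset_def by (rule theI')
qed

section \<open>Ordinals and cardinals\<close>

text \<open>Ordinals are von Neumann ordinals: \<open>\<alpha> < \<beta>\<close> is \<open>\<alpha> \<in> elts \<beta>\<close>, \<open>\<alpha> \<le> \<beta>\<close> is \<open>elts \<alpha> \<subseteq> elts \<beta>\<close>.\<close>

definition vtrans :: "'k hset \<Rightarrow> bool" where
  "vtrans x \<longleftrightarrow> (\<forall>y\<in>elts x. elts y \<subseteq> elts x)"

definition Ord :: "'k hset \<Rightarrow> bool" where
  "Ord x \<longleftrightarrow> vtrans x \<and> (\<forall>y\<in>elts x. vtrans y)"

definition ozero :: "'k hset" where
  "ozero = vset {}"

definition osucc :: "'k hset \<Rightarrow> 'k hset" where
  "osucc x = vset (insert x (elts x))"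

definition omega :: "'k hset" where
  "omega = vset {n. Ord n \<and> finite (elts n)}"

definition osup :: "'k hset set \<Rightarrow> 'k hset" where
  "osup A = vset (\<Union>a\<in>A. elts a)"

definition otp :: "'k hset set \<Rightarrow> 'k hset" where
  "otp A = (THE \<delta>. Ord \<delta> \<and> (\<exists>f. bij_betw f (elts \<delta>) A \<and>
     (\<forall>a\<in>elts \<delta>. \<forall>b\<in>elts \<delta>. a \<in> elts b \<longleftrightarrow> f a \<in> elts (f b))))"

definition cofinal_length :: "'k hset \<Rightarrow> 'k hset \<Rightarrow> bool" where
  "cofinal_length \<alpha> \<delta> \<longleftrightarrow>
     (\<exists>f. f ` elts \<delta> \<subseteq> elts \<alpha> \<and> (\<forall>\<beta>\<in>elts \<alpha>. \<exists>\<gamma>\<in>elts \<delta>. elts \<beta> \<subseteq> elts (f \<gamma>)))"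

definition cf :: "'k hset \<Rightarrow> 'k hset" where
  "cf \<alpha> = (THE \<delta>. Ord \<delta> \<and> cofinal_length \<alpha> \<delta> \<and> (\<forall>\<epsilon>\<in>elts \<delta>. \<not> cofinal_length \<alpha> \<epsilon>))"

definition Cardinal :: "'k hset \<Rightarrow> bool" where
  "Cardinal \<kappa> \<longleftrightarrow> Ord \<kappa> \<and> (\<forall>\<alpha>\<in>elts \<kappa>. |elts \<alpha>| <o |elts \<kappa>| )"

definition regular_cardinal :: "'k hset \<Rightarrow> bool" where
  "regular_cardinal \<kappa> \<longleftrightarrow> Cardinal \<kappa> \<and> infinite (elts \<kappa>) \<and> cf \<kappa> = \<kappa>"

definition E_ge :: "'k hset \<Rightarrow> 'k hset \<Rightarrow> 'k hset set" where
  "E_ge \<kappa> \<chi> = {\<alpha>\<in>elts \<kappa>. elts \<chi> \<subseteq> elts (cf \<alpha>)}"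

definition acc :: "'k hset set \<Rightarrow> 'k hset set" where
  "acc A = {\<alpha>\<in>A. osup (A \<inter> elts \<alpha>) = \<alpha> \<and> \<alpha> \<noteq> ozero}"

definition club_in :: "'k hset \<Rightarrow> 'k hset set \<Rightarrow> bool" where
  "club_in \<delta> A \<longleftrightarrow> A \<subseteq> elts \<delta> \<and> osup A = \<delta> \<and>
     (\<forall>\<beta>\<in>elts \<delta>. \<beta> \<noteq> ozero \<and> osup (A \<inter> elts \<beta>) = \<beta> \<longrightarrow> \<beta> \<in> A)"

definition stationary_in :: "'k hset \<Rightarrow> 'k hset set \<Rightarrow> bool" where
  "stationary_in \<kappa> S \<longleftrightarrow> S \<subseteq> elts \<kappa> \<and> (\<forall>A. club_in \<kappa> A \<longrightarrow> S \<inter> A \<noteq> {})"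

definition nth_elem :: "'k hset set \<Rightarrow> 'k hset \<Rightarrow> 'k hset" where
  "nth_elem A j = (THE \<gamma>. \<gamma> \<in> A \<and> otp (A \<inter> elts \<gamma>) = j)"

definition succ_set :: "'k hset \<Rightarrow> 'k hset set \<Rightarrow> 'k hset set" where
  "succ_set n A = {nth_elem A (osucc j) | j. j \<in> elts n \<and> osucc j \<in> elts (otp A)}"

section \<open>Hereditary cardinality\<close>

definition tcl :: "'k hset \<Rightarrow> 'k hset set" where
  "tcl x = {y. (y, x) \<in> {(u, v). u \<in> elts v}\<^sup>+}"

definition Hered :: "'c rel \<Rightarrow> 'k hset set" where
  "Hered r = {x. |tcl x| <o r}"

abbreviation Hset :: "'k hset \<Rightarrow> 'k hset set" where
  "Hset \<kappa> \<equiv> Hered |elts \<kappa>|"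

text \<open>\<open>H\<^bsub>\<kappa>\<^sup>+\<^esub>\<close>; the ordinal \<open>\<kappa>\<^sup>+\<close> itself need not belong to the universe.\<close>

abbreviation Hset_plus :: "'k hset \<Rightarrow> 'k hset set" where
  "Hset_plus \<kappa> \<equiv> Hered (cardSuc |elts \<kappa>| )"

section \<open>Functions as sets of ordered pairs\<close>

definition opair :: "'k hset \<Rightarrow> 'k hset \<Rightarrow> 'k hset" where
  "opair a b = vset {vset {a}, vset {a, b}}"

definition is_fun :: "'k hset \<Rightarrow> bool" where
  "is_fun f \<longleftrightarrow> (\<forall>z\<in>elts f. \<exists>a b. z = opair a b) \<and>
     (\<forall>a b c. opair a b \<in> elts f \<longrightarrow> opair a c \<in> elts f \<longrightarrow> b = c)"

definition fdom :: "'k hset \<Rightarrow> 'k hset set" where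
  "fdom f = {a. \<exists>b. opair a b \<in> elts f}"

definition fran :: "'k hset \<Rightarrow> 'k hset set" where
  "fran f = {b. \<exists>a. opair a b \<in> elts f}"

definition fapp :: "'k hset \<Rightarrow> 'k hset \<Rightarrow> 'k hset" where
  "fapp f a = (THE b. opair a b \<in> elts f)"

definition frestrict :: "'k hset \<Rightarrow> 'k hset set \<Rightarrow> 'k hset" where
  "frestrict f A = vset {z\<in>elts f. \<exists>a\<in>A. \<exists>b. z = opair a b}"

definition funs :: "'k hset \<Rightarrow> 'k hset set \<Rightarrow> 'k hset set" where
  "funs \<alpha> Y = {f. is_fun f \<and> fdom f = elts \<alpha> \<and> fran f \<subseteq> Y}"

definition funs_lt :: "'k hset \<Rightarrow> 'k hset set \<Rightarrow> 'k hset set" where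
  "funs_lt \<chi> Y = (\<Union>\<alpha>\<in>elts \<chi>. funs \<alpha> Y)"

definition lt_closed :: "'k hset \<Rightarrow> 'k hset \<Rightarrow> bool" where
  "lt_closed \<chi> \<kappa> \<longleftrightarrow> (\<forall>l\<in>elts \<kappa>. |funs_lt \<chi> (elts l)| <o |elts \<kappa>| )"

section \<open>Elementary substructures for the language of set theory\<close>

datatype fm = Mem nat nat | Equal nat nat | Neg fm | Conj fm fm | Exists nat fm

primrec sat :: "'k hset set \<Rightarrow> (nat \<Rightarrow> 'k hset) \<Rightarrow> fm \<Rightarrow> bool" where
  "sat M e (Mem i j) \<longleftrightarrow> e i \<in> elts (e j)"
| "sat M e (Equal i j) \<longleftrightarrow> e i = e j"
| "sat M e (Neg \<phi>) \<longleftrightarrow> \<not> sat M e \<phi>"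
| "sat M e (Conj \<phi> \<psi>) \<longleftrightarrow> sat M e \<phi> \<and> sat M e \<psi>"
| "sat M e (Exists i \<phi>) \<longleftrightarrow> (\<exists>a\<in>M. sat M (e(i := a)) \<phi>)"

definition elem_sub :: "'k hset set \<Rightarrow> 'k hset set \<Rightarrow> bool" where
  "elem_sub M N \<longleftrightarrow> M \<noteq> {} \<and> M \<subseteq> N \<and>
     (\<forall>\<phi> e. range e \<subseteq> M \<longrightarrow> (sat M e \<phi> \<longleftrightarrow> sat N e \<phi>))"

section \<open>The proxy principle\<close>

definition alpha_of :: "'k hset \<Rightarrow> 'k hset" where
  "alpha_of C = osup (fdom C)"

text \<open>
  \<open>fdom C \<subseteq> elts \<kappa>\<close> is automatic when \<open>alpha_of C \<in> elts \<kappa>\<close>, the only case used below.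
\<close>

definition F_class :: "'k hset \<Rightarrow> 'k hset set" where
  "F_class \<kappa> = {C. is_fun C \<and> fdom C \<subseteq> elts \<kappa> \<and> fdom C \<noteq> {} \<and> club_in (alpha_of C) (fdom C) \<and>
     alpha_of C \<notin> fdom C \<and> fran C \<subseteq> Hset \<kappa>}"

text \<open>The relations \<open>C \<sqsubseteq>\<^sup>* D\<close> and \<open>C \<^sub>\<chi>\<sqsubseteq>\<^sup>* D\<close>.\<close>

definition sq_star :: "'k hset \<Rightarrow> 'k hset \<Rightarrow> bool" where
  "sq_star C D \<longleftrightarrow> (\<exists>\<gamma>\<in>elts (alpha_of C).
     frestrict C (fdom C - elts \<gamma>) = frestrict D (fdom D \<inter> (elts (alpha_of C) - elts \<gamma>)))"

definition chi_sq_star :: "'k hset \<Rightarrow> 'k hset \<Rightarrow> 'k hset \<Rightarrow> bool" where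
  "chi_sq_star \<chi> C D \<longleftrightarrow> sq_star C D \<or> cf (alpha_of C) \<in> elts \<chi>"

text \<open>The set \<open>B(\<Omega>, p, C)\<close>.\<close>

definition guess ::
    "'k hset \<Rightarrow> 'k hset set \<Rightarrow> 'k hset set \<Rightarrow> 'k hset \<Rightarrow> 'k hset \<Rightarrow> 'k hset set" where
  "guess \<kappa> B \<Omega> p C = {\<beta>\<in>B \<inter> fdom C. \<exists>M. elem_sub M (Hset_plus \<kappa>) \<and> p \<in> M \<and>
     M \<inter> elts \<kappa> = elts \<beta> \<and> M \<inter> \<Omega> = elts (fapp C \<beta>)}"

definition P_bullet ::
    "'k hset \<Rightarrow> 'k hset \<Rightarrow> ('k hset \<Rightarrow> 'k hset \<Rightarrow> bool) \<Rightarrow> 'k hset \<Rightarrow> 'k hset set set \<Rightarrow> 'k hset \<Rightarrow> bool"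
  where
  "P_bullet \<kappa> \<mu> R \<theta> \<S> \<nu> \<longleftrightarrow> (\<exists>CC B.
     disjoint_family_on B (elts \<kappa>) \<and> (\<Union>\<iota>\<in>elts \<kappa>. B \<iota>) = elts \<kappa> \<and>
     (\<forall>\<alpha>\<in>acc (elts \<kappa>).
        CC \<alpha> \<subseteq> {C\<in>F_class \<kappa>. alpha_of C = \<alpha>} \<and> CC \<alpha> \<noteq> {} \<and> |CC \<alpha>| <o |elts \<mu>| \<and>
        (\<forall>C\<in>CC \<alpha>. \<forall>\<beta>\<in>acc (fdom C). \<exists>D\<in>CC \<beta>. R D C)) \<and>
     (\<forall>\<Omega> p \<iota>. (\<forall>i\<in>elts \<theta>. \<Omega> i \<subseteq> Hset \<kappa> \<and> p i \<in> Hset_plus \<kappa> \<and> \<iota> i \<in> elts \<kappa>) \<longrightarrow>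
        (\<forall>S\<in>\<S>. \<forall>n\<in>elts omega.
           stationary_in \<kappa> {\<alpha>\<in>S. |CC \<alpha>| <o |elts \<nu>| \<and>
             (\<forall>C\<in>CC \<alpha>. \<forall>i\<in>elts \<alpha> \<inter> elts \<theta>.
                osup {\<gamma>\<in>fdom C. succ_set n (fdom C - elts \<gamma>) \<subseteq>
                                guess \<kappa> (B (\<iota> i)) (\<Omega> i) (p i) C} = \<alpha>)})))"

section \<open>Streamlined trees\<close>

definition tlt :: "'k hset \<Rightarrow> 'k hset \<Rightarrow> bool" where
  "tlt s t \<longleftrightarrow> elts s \<subset> elts t"

definition streamlined :: "'k hset \<Rightarrow> 'k hset set \<Rightarrow> bool" where
  "streamlined \<kappa> T \<longleftrightarrow> T \<subseteq> funs_lt \<kappa> (Hset \<kappa>) \<and>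
     (\<forall>t\<in>T. \<forall>\<beta>\<in>fdom t. frestrict t (elts \<beta>) \<in> T)"

definition level :: "'k hset \<Rightarrow> 'k hset set \<Rightarrow> 'k hset \<Rightarrow> 'k hset set" where
  "level \<kappa> T \<alpha> = T \<inter> funs \<alpha> (Hset \<kappa>)"

text \<open>
  In a streamlined tree the predecessors of \<open>t\<close> are its proper restrictions, so the level of \<open>t\<close>
  in the tree order is its domain.
\<close>

definition tree_height :: "'k hset \<Rightarrow> 'k hset set \<Rightarrow> 'k hset" where
  "tree_height \<kappa> T =
     (THE \<alpha>. Ord \<alpha> \<and> level \<kappa> T \<alpha> = {} \<and> (\<forall>\<beta>\<in>elts \<alpha>. level \<kappa> T \<beta> \<noteq> {}))"

definition tchain :: "'k hset set \<Rightarrow> 'k hset set \<Rightarrow> bool" where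
  "tchain T b \<longleftrightarrow> b \<subseteq> T \<and> (\<forall>s\<in>b. \<forall>t\<in>b. s = t \<or> tlt s t \<or> tlt t s)"

definition branch :: "'k hset set \<Rightarrow> 'k hset set \<Rightarrow> bool" where
  "branch T b \<longleftrightarrow> tchain T b \<and> (\<forall>c. tchain T c \<and> b \<subseteq> c \<longrightarrow> c = b)"

definition antichain :: "'k hset set \<Rightarrow> 'k hset set \<Rightarrow> bool" where
  "antichain T A \<longleftrightarrow> A \<subseteq> T \<and> (\<forall>s\<in>A. \<forall>t\<in>A. \<not> tlt s t)"

definition streamlined_souslin :: "'k hset \<Rightarrow> 'k hset set \<Rightarrow> bool" where
  "streamlined_souslin \<kappa> T \<longleftrightarrow> streamlined \<kappa> T \<and> tree_height \<kappa> T = \<kappa> \<and>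
     (\<forall>\<alpha>\<in>elts \<kappa>. |level \<kappa> T \<alpha>| <o |elts \<kappa>| ) \<and>
     (\<nexists>b. branch T b \<and> |b| =o |elts \<kappa>| ) \<and>
     (\<nexists>A. antichain T A \<and> |A| =o |elts \<kappa>| )"

definition normal_tree :: "'k hset \<Rightarrow> 'k hset set \<Rightarrow> bool" where
  "normal_tree \<kappa> T \<longleftrightarrow> (\<forall>\<beta>\<in>elts \<kappa>. \<forall>\<alpha>\<in>elts \<beta>. level \<kappa> T \<beta> \<noteq> {} \<longrightarrow>
     (\<forall>s\<in>level \<kappa> T \<alpha>. \<exists>t\<in>level \<kappa> T \<beta>. tlt s t))"

definition append1 :: "'k hset \<Rightarrow> 'k hset \<Rightarrow> 'k hset" where
  "append1 t i = vset (insert (opair (vset (fdom t)) i) (elts t))"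

definition prolific :: "'k hset \<Rightarrow> 'k hset set \<Rightarrow> bool" where
  "prolific \<kappa> T \<longleftrightarrow> (\<forall>\<alpha>\<in>elts \<kappa>. \<forall>t\<in>level \<kappa> T \<alpha>.
     {append1 t i | i. i \<in> elts omega \<union> elts \<alpha>} \<subseteq> level \<kappa> T (osucc \<alpha>))"

definition imm_succs :: "'k hset set \<Rightarrow> 'k hset \<Rightarrow> 'k hset set" where
  "imm_succs T s = {t\<in>T. tlt s t \<and> (\<nexists>u. u \<in> T \<and> tlt s u \<and> tlt u t)}"

definition splitting :: "'k hset \<Rightarrow> 'k hset set \<Rightarrow> bool" where
  "splitting \<sigma> T \<longleftrightarrow> (\<forall>s\<in>T. |elts \<sigma>| \<le>o |imm_succs T s| )"

definition complete_tree :: "'k hset \<Rightarrow> 'k hset set \<Rightarrow> bool" where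
  "complete_tree \<chi> T \<longleftrightarrow> (\<forall>\<delta>\<in>elts \<chi>. \<forall>f. f ` elts \<delta> \<subseteq> T \<and>
     (\<forall>j\<in>elts \<delta>. \<forall>i\<in>elts j. tlt (f i) (f j)) \<longrightarrow> vset (\<Union>i\<in>elts \<delta>. elts (f i)) \<in> T)"

end

theory Submission
  imports Defs
begin

text \<open>
  The levels of the tree are defined by recursion. Every node has its prescribed immediate
  successors, and at limits of cofinality below \<open>\<chi>\<close> all branches are continued,
  which gives completeness; closure of \<open>\<kappa>\<close> keeps these levels small. At a limit
  \<open>\<alpha>\<close> of cofinality at least \<open>\<chi>\<close> a branch is continued only
  if, along some \<open>C\<close> in \<open>\<C>\<^sub>\<alpha>\<close> and above some point of
  \<open>\<partial>C\<close>, it always passes to a fixed chosen extension that meets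
  \<open>C(\<beta>)\<close> whenever possible. Since this rule is local, a branch built along
  \<open>C\<close> obeys the rule of any \<open>C' \<sqsubseteq>\<^sup>* C\<close> at accumulation
  points, so every node extends to every higher level.

  Given an antichain \<open>A\<close>, let \<open>D\<close> be the dense set of nodes that extend an
  element of \<open>A\<close> or lie below none. A parameter \<open>p\<close> coding an enumeration
  of the tree together with extensions into \<open>D\<close> ensures that at each guessing point
  \<open>\<beta>\<close> the set \<open>C(\<beta>) = M \<inter> D\<close> is dense in the tree below
  level \<open>\<beta>\<close>. Hence at some level \<open>\<alpha>\<close> every node lies above an
  element of \<open>D\<close>, which confines \<open>A\<close> to the levels up to
  \<open>\<alpha>\<close>.
\<close>

text \<open>The rule binds only above some \<gamma> because the coherence relation compares ladders
  on tails: a demand on all of \<partial>C would not pass to the ladder at an accumulation point.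
  Below cofinality \<chi> even that coherence can fail, one more reason to impose no rule there.
  Each move is a fixed choice, so C, \<gamma> and the node at \<gamma> determine the rest of a
  branch. This uniqueness bounds the levels, and it makes independently chosen partial branches
  cohere, so that normality is a plain induction.

  The guess is used at the point \<beta> directly after some \<gamma>' of \<partial>C, the case n =
  1 of the principle. The move to \<beta> starts from the node at \<gamma>' < \<beta>. To be sealed,
  this node must have its index below \<beta>, and its extension into D must lie in M on a level
  below \<beta>, from where normality lifts it. So p bounds indices and levels besides giving
  extensions. It is one function on \<kappa> with pairs as values, so the logic reduces to
  evaluating a function and decoding a pair inside M.\<close>

lemma elts_ext: "elts x = elts y \<Longrightarrow> x = y"
  by (simp add: elts_inject)

lemma mem_irrefl: "x \<notin> elts x"
  using wf_elts by (metis (mono_tags) case_prodI mem_Collect_eq wf_not_refl)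

lemma mem_asym: "x \<in> elts y \<Longrightarrow> y \<notin> elts x"
  using wf_not_sym[OF wf_elts] by blast

lemmas mem_induct = wf_induct_rule[OF wf_elts, simplified, case_names less]

lemma small_elts: fixes x :: "'k hset" shows "|elts x| \<le>o |UNIV :: 'k set|"
  using ex_elts_iff by blast

lemma small_subset:
  fixes X :: "'k hset set"
  assumes "X \<subseteq> elts x" shows "|X| \<le>o |UNIV :: 'k set|"
  using card_of_mono1[OF assms] small_elts ordLeq_transitive by blast

lemma elts_vset_subset: "X \<subseteq> elts x \<Longrightarrow> elts (vset X) = X"
  by (rule elts_vset[OF small_subset])

lemma vset_elts [simp]: "vset (elts x) = x"
  by (rule elts_ext) (rule elts_vset[OF small_elts])

section \<open>Ordinals\<close>

lemma Ord_trans: "Ord x \<Longrightarrow> y \<in> elts x \<Longrightarrow> z \<in> elts y \<Longrightarrow> z \<in> elts x"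
  unfolding Ord_def vtrans_def by blast

lemma Ord_elts_subset: "Ord x \<Longrightarrow> y \<in> elts x \<Longrightarrow> elts y \<subseteq> elts x"
  unfolding Ord_def vtrans_def by blast

lemma Ord_in_Ord: "Ord x \<Longrightarrow> y \<in> elts x \<Longrightarrow> Ord y"
  unfolding Ord_def vtrans_def by blast

text \<open>Nested induction: the outer hypothesis compares members of \<open>a\<close> with
  \<open>b\<close>, the inner one \<open>a\<close> with members of \<open>b\<close>. Were
  \<open>a\<close> and \<open>b\<close> incomparable, each member of one would lie in the other, and
  extensionality would give equality.\<close>

lemma Ord_linear: "Ord a \<Longrightarrow> Ord b \<Longrightarrow> a \<in> elts b \<or> a = b \<or> b \<in> elts a"
proof (induction a arbitrary: b rule: mem_induct)
  case (less a)
  note IHa = less.IH and oa = less.prems(1)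
  from less.prems(2) show ?case
  proof (induction b rule: mem_induct)
    case (less b)
    show ?case
    proof (rule ccontr)
      assume n: "\<not> ?case"
      have "elts a = elts b"
      proof (intro equalityI subsetI)
        fix x assume x: "x \<in> elts a"
        then have "x \<in> elts b \<or> x = b \<or> b \<in> elts x"
          using IHa Ord_in_Ord[OF oa] less.prems by blast
        then show "x \<in> elts b" using n x Ord_trans[OF oa x] by blast
      next
        fix x assume x: "x \<in> elts b"
        then have "a \<in> elts x \<or> a = x \<or> x \<in> elts a"
          using less.IH Ord_in_Ord[OF less.prems] by blast
        then show "x \<in> elts a" using n x Ord_trans[OF less.prems x] by blast
      qed
      then show False using n elts_ext by blast
    qed
  qed
qed

lemma Ord_subset_iff:
  assumes "Ord a" "Ord b" shows "elts a \<subseteq> elts b \<longleftrightarrow> a \<in> elts b \<or> a = b"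
  using Ord_linear[OF assms] Ord_elts_subset[OF assms(2), of a] mem_irrefl by blast

lemma Ord_not_mem_iff:
  assumes "Ord a" "Ord b" shows "a \<notin> elts b \<longleftrightarrow> elts b \<subseteq> elts a"
  using Ord_linear[OF assms] Ord_subset_iff[OF assms(2,1)] mem_irrefl mem_asym by blast

lemma Ord_least:
  assumes "P a" "Ord a"
  obtains b where "Ord b" "P b" "\<And>c. c \<in> elts b \<Longrightarrow> \<not> P c"
proof -
  have "\<exists>b. Ord b \<and> P b \<and> (\<forall>c\<in>elts b. \<not> P c)"
    using assms
  proof (induction a rule: mem_induct)
    case (less a)
    then show ?case using Ord_in_Ord by blast
  qed
  then show ?thesis using that by blast
qed

lemma OrdI_subset:
  assumes "\<And>x. x \<in> elts a \<Longrightarrow> Ord x" "\<And>x y. x \<in> elts a \<Longrightarrow> y \<in> elts x \<Longrightarrow> y \<in> elts a"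
  shows "Ord a"
  using assms unfolding Ord_def vtrans_def by blast

lemma elts_ozero [simp]: "elts (ozero :: 'k hset) = {}"
  unfolding ozero_def by (rule elts_vset) (simp add: card_of_empty)

lemma Ord_ozero: "Ord ozero"
  by (rule OrdI_subset) simp_all

lemma ozero_mem: "Ord a \<Longrightarrow> a \<noteq> ozero \<Longrightarrow> ozero \<in> elts a"
  using Ord_linear[OF _ Ord_ozero] by fastforce

text \<open>Justifies the definite description in \<open>cf\<close>: the identity map makes \<alpha>
  a cofinal length of itself, so a least one exists, and linearity makes it unique.\<close>

lemma cf_least_cofinal:
  assumes "Ord \<alpha>"
  shows "Ord (cf \<alpha>) \<and> cofinal_length \<alpha> (cf \<alpha>) \<and> (\<forall>\<epsilon>\<in>elts (cf \<alpha>). \<not> cofinal_length \<alpha> \<epsilon>)"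
proof -
  have "cofinal_length \<alpha> \<alpha>"
    unfolding cofinal_length_def by (rule exI[of _ id]) auto
  then obtain \<delta> where d: "Ord \<delta>" "cofinal_length \<alpha> \<delta>" "\<And>\<epsilon>. \<epsilon> \<in> elts \<delta> \<Longrightarrow> \<not> cofinal_length \<alpha> \<epsilon>"
    using Ord_least[of "cofinal_length \<alpha>" \<alpha>] assms by blast
  show ?thesis
    unfolding cf_def
  proof (rule theI[of _ \<delta>])
    show "Ord \<delta> \<and> cofinal_length \<alpha> \<delta> \<and> (\<forall>\<epsilon>\<in>elts \<delta>. \<not> cofinal_length \<alpha> \<epsilon>)"
      using d by blast
    fix x assume "Ord x \<and> cofinal_length \<alpha> x \<and> (\<forall>\<epsilon>\<in>elts x. \<not> cofinal_length \<alpha> \<epsilon>)"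
    then show "x = \<delta>" using d Ord_linear[of x \<delta>] by blast
  qed
qed

lemma Ord_cf: "Ord \<alpha> \<Longrightarrow> Ord (cf \<alpha>)"
  using cf_least_cofinal by blast

lemma cofinal_length_cf: "Ord \<alpha> \<Longrightarrow> cofinal_length \<alpha> (cf \<alpha>)"
  using cf_least_cofinal by blast

lemma cf_le: "Ord \<alpha> \<Longrightarrow> Ord \<delta> \<Longrightarrow> cofinal_length \<alpha> \<delta> \<Longrightarrow> elts (cf \<alpha>) \<subseteq> elts \<delta>"
  using cf_least_cofinal Ord_not_mem_iff by blast

section \<open>Order types\<close>

definition order_iso :: "('k hset \<Rightarrow> 'k hset) \<Rightarrow> 'k hset set \<Rightarrow> 'k hset set \<Rightarrow> bool" where
  "order_iso f A B \<longleftrightarrow> bij_betw f A B \<and> (\<forall>a\<in>A. \<forall>b\<in>A. a \<in> elts b \<longleftrightarrow> f a \<in> elts (f b))"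

lemma order_iso_inv:
  assumes "order_iso f A B" shows "order_iso (inv_into A f) B A"
  unfolding order_iso_def
proof (intro conjI ballI)
  show "bij_betw (inv_into A f) B A" using assms bij_betw_inv_into order_iso_def by blast
  fix a b assume ab: "a \<in> B" "b \<in> B"
  have *: "f (inv_into A f x) = x" "inv_into A f x \<in> A" if "x \<in> B" for x
    using assms that unfolding order_iso_def
    by (auto simp: bij_betw_inv_into_right bij_betw_def f_inv_into_f inv_into_into)
  show "a \<in> elts b \<longleftrightarrow> inv_into A f a \<in> elts (inv_into A f b)"
    using assms ab * unfolding order_iso_def by metis
qed

lemma order_iso_comp:
  assumes "order_iso f A B" "order_iso g B C" shows "order_iso (g \<circ> f) A C"
  unfolding order_iso_def
proof (intro conjI ballI)
  show "bij_betw (g \<circ> f) A C" using assms bij_betw_trans unfolding order_iso_def by blast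
  fix a b assume ab: "a \<in> A" "b \<in> A"
  then have "f a \<in> B" "f b \<in> B" using assms(1) unfolding order_iso_def bij_betw_def by blast+
  then show "a \<in> elts b \<longleftrightarrow> (g \<circ> f) a \<in> elts ((g \<circ> f) b)"
    using assms ab unfolding order_iso_def by simp
qed

text \<open>Ordinals are rigid: by induction the isomorphism is the identity, since transitivity
  forces \<open>f x\<close> to consist of the images of the members of \<open>x\<close>. This makes
  \<open>otp\<close> well defined.\<close>

lemma order_iso_Ord_eq:
  assumes "order_iso f (elts a) (elts b)" "Ord a" "Ord b" shows "a = b"
proof -
  have iff: "u \<in> elts v \<longleftrightarrow> f u \<in> elts (f v)" if "u \<in> elts a" "v \<in> elts a" for u v
    using assms(1) that unfolding order_iso_def bij_betw_def by auto
  have img: "f ` elts a = elts b"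
    using assms(1) unfolding order_iso_def bij_betw_def by auto
  have "f x = x" if "x \<in> elts a" for x
    using that
  proof (induction x rule: mem_induct)
    case (less x)
    have fx: "f x \<in> elts b" using less.prems img by blast
    show ?case
    proof (rule elts_ext, intro equalityI subsetI)
      fix y assume y: "y \<in> elts (f x)"
      then have "y \<in> elts b" using Ord_trans[OF assms(3) fx] by blast
      then have "y \<in> f ` elts a" using img by simp
      then obtain z where z: "z \<in> elts a" "f z = y" by (elim imageE) simp
      have "z \<in> elts x" using iff[OF z(1) less.prems] z(2) y by simp
      with less.IH[OF this z(1)] z(2) show "y \<in> elts x" by simp
    next
      fix y assume y: "y \<in> elts x"
      then have ya: "y \<in> elts a" using Ord_trans[OF assms(2) less.prems] by blast
      then have "f y \<in> elts (f x)" using iff[OF ya less.prems] y by simp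
      then show "y \<in> elts (f x)" using less.IH[OF y ya] by simp
    qed
  qed
  then have "f ` elts a = elts a" by simp
  then show ?thesis using img elts_ext by metis
qed

lemma otp_eqI:
  fixes \<delta> :: "'k hset" and A :: "'k hset set"
  assumes "Ord \<delta>" "order_iso f (elts \<delta>) A" shows "otp A = \<delta>"
  unfolding otp_def
proof (rule the_equality)
  show "Ord \<delta> \<and> (\<exists>f. bij_betw f (elts \<delta>) A \<and> (\<forall>a\<in>elts \<delta>. \<forall>b\<in>elts \<delta>. a \<in> elts b \<longleftrightarrow> f a \<in> elts (f b)))"
    using assms unfolding order_iso_def by blast
  fix \<epsilon> :: "'k hset"
  assume "Ord \<epsilon> \<and> (\<exists>f. bij_betw f (elts \<epsilon>) A \<and> (\<forall>a\<in>elts \<epsilon>. \<forall>b\<in>elts \<epsilon>. a \<in> elts b \<longleftrightarrow> f a \<in> elts (f b)))"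
  then obtain g where "Ord \<epsilon>" "order_iso g (elts \<epsilon>) A" unfolding order_iso_def by blast
  then show "\<epsilon> = \<delta>"
    using order_iso_Ord_eq[OF order_iso_comp[OF _ order_iso_inv]] assms by blast
qed

lemma otp_exists:
  fixes x :: "'k hset" and A :: "'k hset set"
  assumes x: "Ord x" and A: "A \<subseteq> elts x"
  obtains f where "Ord (otp A)" "order_iso f (elts (otp A)) A"
proof -
  \<comment> \<open>\<open>F\<close> is the Mostowski collapse of \<open>A\<close>\<close>
  define F :: "'k hset \<Rightarrow> 'k hset" where "F = wfrec {(x :: 'k hset, y). x \<in> elts y} (\<lambda>f a. vset (f ` (A \<inter> elts a)))"
  have Feq: "F a = vset (F ` (A \<inter> elts a))" for a
  proof -
    have "F a = vset (cut F {(x, y). x \<in> elts y} a ` (A \<inter> elts a))"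
      unfolding F_def by (rule wfrec[OF wf_elts])
    also have "cut F {(x, y). x \<in> elts y} a ` (A \<inter> elts a) = F ` (A \<inter> elts a)"
      by (rule image_cong) (auto simp: cut_apply)
    finally show ?thesis .
  qed
  have small: "|F ` B| \<le>o |UNIV :: 'k set|" if "B \<subseteq> A" for B
    using card_of_image[of F B] small_subset[of B x] that A ordLeq_transitive by blast
  have F: "elts (F a) = F ` (A \<inter> elts a)" for a
    unfolding Feq[of a] by (rule elts_vset[OF small]) simp
  have OA: "Ord a" if "a \<in> A" for a using that A x Ord_in_Ord by blast
  have OF: "Ord (F a)" if "a \<in> A" for a
    using that
  proof (induction a rule: mem_induct)
    case (less a)
    show ?case
    proof (rule OrdI_subset)
      fix y assume "y \<in> elts (F a)"
      then obtain b where b: "b \<in> A" "b \<in> elts a" "y = F b" using F by auto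
      then show "Ord y" using less.IH by blast
      fix z assume "z \<in> elts y"
      then obtain c where "c \<in> A" "c \<in> elts b" "z = F c" using F b by auto
      then show "z \<in> elts (F a)" using F b Ord_trans[OF OA[OF less.prems]] by auto
    qed
  qed
  have mono: "F a \<in> elts (F b)" if "a \<in> A" "a \<in> elts b" for a b using that F by auto
  have inj: "a = b" if "a \<in> A" "b \<in> A" "F a = F b" for a b
    using Ord_linear[OF OA[OF that(1)] OA[OF that(2)]] mono that mem_irrefl by metis
  define d where "d = vset (F ` A)"
  have d: "elts d = F ` A" unfolding d_def by (rule elts_vset[OF small]) simp
  have Od: "Ord d"
  proof (rule OrdI_subset)
    fix y assume "y \<in> elts d"
    then obtain b where b: "b \<in> A" "y = F b" using d by auto
    then show "Ord y" using OF by blast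
    fix z assume "z \<in> elts y"
    then show "z \<in> elts d" using F b d by auto
  qed
  have "order_iso F A (elts d)"
    unfolding order_iso_def bij_betw_def
  proof (intro conjI ballI)
    show "inj_on F A" using inj by (auto intro: inj_onI)
    show "F ` A = elts d" using d by simp
    fix a b assume ab: "a \<in> A" "b \<in> A"
    show "a \<in> elts b \<longleftrightarrow> F a \<in> elts (F b)"
    proof
      assume "F a \<in> elts (F b)"
      then obtain c where "c \<in> A" "c \<in> elts b" "F a = F c" using F by auto
      then show "a \<in> elts b" using inj ab by blast
    qed (use mono ab in blast)
  qed
  then have *: "order_iso (inv_into A F) (elts d) A" by (rule order_iso_inv)
  then have "otp A = d" by (rule otp_eqI[OF Od])
  then show ?thesis using that * Od by blast
qed

lemma tcl_eq: "tcl x = elts x \<union> (\<Union>y\<in>elts x. tcl y)"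
proof (intro equalityI subsetI)
  fix z assume "z \<in> tcl x"
  then have "(z, x) \<in> {(u, v). u \<in> elts v}\<^sup>+" unfolding tcl_def by simp
  then show "z \<in> elts x \<union> (\<Union>y\<in>elts x. tcl y)"
    by (cases rule: tranclE) (auto simp: tcl_def)
next
  fix z assume "z \<in> elts x \<union> (\<Union>y\<in>elts x. tcl y)"
  then show "z \<in> tcl x"
  proof
    assume "z \<in> elts x"
    then show ?thesis unfolding tcl_def by (simp add: r_into_trancl)
  next
    assume "z \<in> (\<Union>y\<in>elts x. tcl y)"
    then obtain y where "y \<in> elts x" "(z, y) \<in> {(u, v). u \<in> elts v}\<^sup>+" unfolding tcl_def by blast
    then have "(z, x) \<in> {(u, v). u \<in> elts v}\<^sup>+" using trancl_into_trancl[of z y _ x] by auto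
    then show ?thesis unfolding tcl_def by simp
  qed
qed

section \<open>Cardinal arithmetic below a regular cardinal\<close>

locale regular_card =
  fixes \<kappa> :: "'k hset"
  assumes reg: "regular_cardinal \<kappa>"
begin

lemma Ord_kappa: "Ord \<kappa>"
  using reg unfolding regular_cardinal_def Cardinal_def by blast

lemma infinite_kappa: "infinite (elts \<kappa>)"
  using reg unfolding regular_cardinal_def by blast

lemma infinite_UNIV: "infinite (UNIV :: 'k set)"
  using card_of_ordLeq_infinite[OF small_elts infinite_kappa] .

lemma card_less_kappa: "\<alpha> \<in> elts \<kappa> \<Longrightarrow> |elts \<alpha>| <o |elts \<kappa>|"
  using reg unfolding regular_cardinal_def Cardinal_def by blast

lemma Ord_below: "\<alpha> \<in> elts \<kappa> \<Longrightarrow> Ord \<alpha>"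
  using Ord_kappa Ord_in_Ord by blast

lemma below_trans: "\<alpha> \<in> elts \<kappa> \<Longrightarrow> \<beta> \<in> elts \<alpha> \<Longrightarrow> \<beta> \<in> elts \<kappa>"
  using Ord_trans[OF Ord_kappa] by blast

lemma finite_small: "finite X \<Longrightarrow> |X| \<le>o |UNIV :: 'k set|"
  using finite_ordLess_infinite[OF card_of_Well_order card_of_Well_order] infinite_UNIV
  by (metis Field_card_of ordLess_imp_ordLeq)

lemma elts_vset_finite: "finite X \<Longrightarrow> elts (vset X :: 'k hset) = X"
  by (rule elts_vset[OF finite_small])

lemma small_Un:
  assumes "|X| \<le>o |UNIV :: 'k set|" "|Y| \<le>o |UNIV :: 'k set|"
  shows "|X \<union> Y| \<le>o |UNIV :: 'k set|"
  by (rule card_of_Un_ordLeq_infinite_Field[OF _ assms card_of_Card_order])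
    (simp add: infinite_UNIV Field_card_of)

lemma small_UN:
  assumes "|I| \<le>o |UNIV :: 'k set|" "\<And>i. i \<in> I \<Longrightarrow> |F i| \<le>o |UNIV :: 'k set|"
  shows "|\<Union>i\<in>I. F i| \<le>o |UNIV :: 'k set|"
  using assms infinite_UNIV by (simp add: card_of_UNION_ordLeq_infinite)

lemma elts_osucc: "elts (osucc x :: 'k hset) = insert x (elts x)"
proof -
  have "|{x} \<union> elts x| \<le>o |UNIV :: 'k set|" by (intro small_Un finite_small small_elts) simp
  then show ?thesis unfolding osucc_def by (simp add: elts_vset)
qed

lemma Ord_osucc: "Ord (x :: 'k hset) \<Longrightarrow> Ord (osucc x)"
  by (rule OrdI_subset) (auto simp: elts_osucc dest: Ord_in_Ord Ord_trans)

lemma osucc_inject: "osucc (x :: 'k hset) = osucc y \<longleftrightarrow> x = y"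
proof
  assume "osucc x = osucc y"
  then have "insert x (elts x) = insert y (elts y)" using elts_osucc by metis
  then have "x \<in> insert y (elts y)" "y \<in> insert x (elts x)" by (metis insertI1)+
  then show "x = y" using mem_asym by auto
qed simp

lemma elts_osup:
  fixes A :: "'k hset set"
  assumes "A \<subseteq> elts x" shows "elts (osup A) = (\<Union>a\<in>A. elts a)"
  unfolding osup_def by (rule elts_vset, rule small_UN[OF small_subset[OF assms]]) (rule small_elts)

text \<open>The bridge between two notions of size: ordinals are sets of the universe, while
  cardinals of HOL are well-order relations. This is the order of \<kappa> written as such a
  relation.\<close>

definition kappa_le :: "'k hset rel" where
  "kappa_le = {(a, b). a \<in> elts \<kappa> \<and> b \<in> elts \<kappa> \<and> elts a \<subseteq> elts b}"

lemma Field_kappa_le: "Field kappa_le = elts \<kappa>"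
  unfolding kappa_le_def Field_def by auto

lemma kappa_le_well_order: "well_order_on (elts \<kappa>) kappa_le"
  unfolding well_order_on_def linear_order_on_def partial_order_on_def preorder_on_def
proof (intro conjI)
  show "kappa_le \<subseteq> elts \<kappa> \<times> elts \<kappa>" unfolding kappa_le_def by auto
  show "refl_on (elts \<kappa>) kappa_le" unfolding refl_on_def kappa_le_def by auto
  show "trans kappa_le" unfolding trans_def kappa_le_def by auto
  show "antisym kappa_le" unfolding antisym_def kappa_le_def using elts_ext by auto
  show "total_on (elts \<kappa>) kappa_le"
    unfolding total_on_def
  proof (intro ballI impI)
    fix x y assume "x \<in> elts \<kappa>" "y \<in> elts \<kappa>"
    then show "(x, y) \<in> kappa_le \<or> (y, x) \<in> kappa_le"
      using Ord_linear[of x y] Ord_below Ord_elts_subset[of x y] Ord_elts_subset[of y x]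
      unfolding kappa_le_def by auto
  qed
  show "wf (kappa_le - Id)"
  proof (rule wf_subset[OF wf_elts])
    show "kappa_le - Id \<subseteq> {(x, y). x \<in> elts y}"
      unfolding kappa_le_def using Ord_subset_iff Ord_below by auto
  qed
qed

lemma kappa_le_Well_order: "Well_order kappa_le"
  using kappa_le_well_order Field_kappa_le by simp

text \<open>A shorter well-order is isomorphic to a proper initial segment of
  \<open>kappa_le\<close>, and the segment cut off at \<open>a\<close> consists of members of
  \<open>a\<close>.\<close>

lemma less_kappa_le:
  assumes "Well_order r" "r <o kappa_le"
  obtains a where "a \<in> elts \<kappa>" "|Field r| \<le>o |elts a|"
proof -
  obtain a where a: "a \<in> elts \<kappa>" "r =o Restr kappa_le (underS kappa_le a)"
    using assms ordLess_iff_ordIso_Restr[OF kappa_le_Well_order] Field_kappa_le by blast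
  have "Field (Restr kappa_le (underS kappa_le a)) \<subseteq> underS kappa_le a"
    unfolding Field_def by blast
  also have "\<dots> \<subseteq> elts a"
    unfolding underS_def kappa_le_def using Ord_subset_iff Ord_below by auto
  finally have "|Field (Restr kappa_le (underS kappa_le a))| \<le>o |elts a|" by (rule card_of_mono1)
  moreover have "|Field r| \<le>o |Field (Restr kappa_le (underS kappa_le a))|"
    using a(2) card_of_mono2 ordIso_imp_ordLeq by blast
  ultimately show ?thesis using that a(1) ordLeq_transitive by blast
qed

text \<open>A shorter well-order of \<kappa> would inject \<kappa> into one of its own members,
  against \<kappa> being a cardinal.\<close>

lemma kappa_le_card_order: "card_order_on (elts \<kappa>) kappa_le"
  unfolding card_order_on_def
proof (intro conjI allI impI kappa_le_well_order)
  fix r :: "'k hset rel" assume r: "well_order_on (elts \<kappa>) r"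
  then have F: "Field r = elts \<kappa>" using well_order_on_Field by metis
  have W: "Well_order r" using r F by simp
  show "kappa_le \<le>o r"
  proof (rule ccontr)
    assume "\<not> kappa_le \<le>o r"
    then have "r <o kappa_le" using not_ordLeq_iff_ordLess[OF W kappa_le_Well_order] by simp
    then obtain a where "a \<in> elts \<kappa>" "|elts \<kappa>| \<le>o |elts a|" using less_kappa_le[OF W] F by metis
    then show False using card_less_kappa not_ordLess_ordLeq by blast
  qed
qed

lemma kappa_le_ordIso: "kappa_le =o |elts \<kappa>|"
  by (rule card_of_unique[OF kappa_le_card_order])

lemma card_less_obtain:
  assumes "|X| <o |elts \<kappa>|"
  obtains \<delta> where "\<delta> \<in> elts \<kappa>" "|X| \<le>o |elts \<delta>|"
proof -
  have "|X| <o kappa_le" using assms kappa_le_ordIso ordIso_symmetric ordLess_ordIso_trans by blast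
  then show ?thesis using less_kappa_le[of "|X|"] that by (metis Field_card_of card_of_Well_order)
qed

lemma not_cofinal_kappa: "\<delta> \<in> elts \<kappa> \<Longrightarrow> \<not> cofinal_length \<kappa> \<delta>"
  using cf_least_cofinal[OF Ord_kappa] reg unfolding regular_cardinal_def by simp

text \<open>X is the image of some \<delta> < \<kappa>, and as cf \<kappa> = \<kappa> this map is
  not cofinal. A \<beta> that lies below no value lies above all of them by linearity.\<close>

lemma bounded_kappa:
  assumes "X \<subseteq> elts \<kappa>" "|X| <o |elts \<kappa>|"
  obtains \<beta> where "\<beta> \<in> elts \<kappa>" "X \<subseteq> elts \<beta>"
proof (cases "X = {}")
  case True
  obtain b where "b \<in> elts \<kappa>" using infinite_kappa by (metis ex_in_conv finite.emptyI)
  then show ?thesis using that True by blast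
next
  case False
  obtain \<delta> where d: "\<delta> \<in> elts \<kappa>" "|X| \<le>o |elts \<delta>|" using card_less_obtain assms(2) by blast
  then obtain f where f: "f ` elts \<delta> = X" using card_of_ordLeq2[OF False, of "elts \<delta>"] by auto
  have "f ` elts \<delta> \<subseteq> elts \<kappa>" using f assms(1) by simp
  then obtain \<beta> where b: "\<beta> \<in> elts \<kappa>" "\<And>\<gamma>. \<gamma> \<in> elts \<delta> \<Longrightarrow> \<not> elts \<beta> \<subseteq> elts (f \<gamma>)"
    using not_cofinal_kappa[OF d(1)] unfolding cofinal_length_def by meson
  have "X \<subseteq> elts \<beta>"
  proof
    fix x assume x: "x \<in> X"
    then obtain \<gamma> where g: "\<gamma> \<in> elts \<delta>" "x = f \<gamma>" using f by auto
    then show "x \<in> elts \<beta>"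
      using b(2)[OF g(1)] Ord_not_mem_iff[of x \<beta>] Ord_below b(1) x assms(1) by blast
  qed
  then show ?thesis using that b(1) by blast
qed

text \<open>Translates cf \<kappa> = \<kappa> into regularity of a cardinal order, which turns into
  closure under unions of fewer than \<kappa> sets of size below \<kappa>. All later estimates of
  levels rest on this.\<close>

lemma stable_kappa: "stable |elts \<kappa>|"
proof -
  have CO: "Card_order kappa_le" using kappa_le_card_order Field_kappa_le by simp
  have "regularCard kappa_le"
    unfolding regularCard_def
  proof (intro allI impI)
    fix K assume K: "K \<subseteq> Field kappa_le \<and> cofinal K kappa_le"
    then have sub: "K \<subseteq> elts \<kappa>" using Field_kappa_le by simp
    have "\<not> |K| <o |elts \<kappa>|"
    proof
      assume "|K| <o |elts \<kappa>|"
      then obtain \<beta> where b: "\<beta> \<in> elts \<kappa>" "K \<subseteq> elts \<beta>" using bounded_kappa sub by blast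
      then obtain b where "b \<in> K" "elts \<beta> \<subseteq> elts b"
        using K Field_kappa_le unfolding cofinal_def kappa_le_def by blast
      then show False using b mem_irrefl by blast
    qed
    moreover have "|K| \<le>o |elts \<kappa>|" using sub by (rule card_of_mono1)
    ultimately have "|K| =o |elts \<kappa>|" using ordLeq_iff_ordLess_or_ordIso by blast
    then show "|K| =o kappa_le" using kappa_le_ordIso ordIso_symmetric ordIso_transitive by blast
  qed
  then have "stable kappa_le" using regularCard_stable[OF CO] infinite_kappa Field_kappa_le by simp
  then show ?thesis using stable_ordIso1[OF _ ordIso_symmetric[OF kappa_le_ordIso]] by blast
qed

lemma card_UN_less:
  assumes "|I| <o |elts \<kappa>|" "\<And>i. i \<in> I \<Longrightarrow> |F i| <o |elts \<kappa>|"
  shows "|\<Union>i\<in>I. F i| <o |elts \<kappa>|"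
  by (rule stable_UNION[OF stable_kappa assms])

lemma card_Un_less:
  assumes "|X| <o |elts \<kappa>|" "|Y| <o |elts \<kappa>|" shows "|X \<union> Y| <o |elts \<kappa>|"
  using assms infinite_kappa card_of_Un_ordLess_infinite by blast

lemma card_finite_less: "finite X \<Longrightarrow> |X| <o |elts \<kappa>|"
  using finite_ordLess_infinite[OF card_of_Well_order card_of_Well_order] infinite_kappa
  by (metis Field_card_of)

lemma card_image_less: "|X| <o |elts \<kappa>| \<Longrightarrow> |f ` X| <o |elts \<kappa>|"
  using card_of_image ordLeq_ordLess_trans by blast

lemma card_subset_less: "|X| <o |elts \<kappa>| \<Longrightarrow> Y \<subseteq> X \<Longrightarrow> |Y| <o |elts \<kappa>|"
  using card_of_mono1 ordLeq_ordLess_trans by blast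

section \<open>Closure properties of the hereditary universes\<close>

lemma Hset_I:
  assumes "elts x \<subseteq> Hset \<kappa>" "|elts x| <o |elts \<kappa>|" shows "x \<in> Hset \<kappa>"
proof -
  have "|elts x \<union> (\<Union>y\<in>elts x. tcl y)| <o |elts \<kappa>|"
    using assms unfolding Hered_def by (intro card_Un_less card_UN_less) auto
  then show ?thesis unfolding Hered_def mem_Collect_eq tcl_eq[of x] .
qed

lemma Hset_plus_iff: "x \<in> Hset_plus \<kappa> \<longleftrightarrow> |tcl x| \<le>o |elts \<kappa>|"
  unfolding Hered_def by (simp add: cardSuc_ordLeq_ordLess[OF card_of_Card_order card_of_Card_order])

lemma Hset_plus_I:
  assumes "elts x \<subseteq> Hset_plus \<kappa>" "|elts x| \<le>o |elts \<kappa>|" shows "x \<in> Hset_plus \<kappa>"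
  unfolding Hset_plus_iff tcl_eq[of x]
proof (rule card_of_Un_ordLeq_infinite_Field)
  show "|\<Union>y\<in>elts x. tcl y| \<le>o |elts \<kappa>|"
    by (rule card_of_UNION_ordLeq_infinite[OF infinite_kappa assms(2)]) (use assms Hset_plus_iff in auto)
qed (use assms infinite_kappa in \<open>auto simp: card_of_card_order_on Field_card_of\<close>)

lemma Hset_subset_plus: "Hset \<kappa> \<subseteq> Hset_plus \<kappa>"
  using Hset_plus_iff ordLess_imp_ordLeq unfolding Hered_def by auto

lemma Hset_plus_trans:
  assumes "x \<in> Hset_plus \<kappa>" "y \<in> elts x" shows "y \<in> Hset_plus \<kappa>"
proof -
  have "tcl y \<subseteq> tcl x" using tcl_eq[of x] assms(2) by blast
  then show ?thesis using assms(1) Hset_plus_iff card_of_mono1 ordLeq_transitive by blast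
qed

lemma Ord_Hset: "\<alpha> \<in> elts \<kappa> \<Longrightarrow> \<alpha> \<in> Hset \<kappa>"
proof (induction \<alpha> rule: mem_induct)
  case (less \<alpha>)
  have "elts \<alpha> \<subseteq> Hset \<kappa>" using less.IH below_trans[OF less.prems] by blast
  then show ?case by (rule Hset_I) (rule card_less_kappa[OF less.prems])
qed

section \<open>Ordered pairs and functions\<close>

lemma elts_opair: "elts (opair (a :: 'k hset) b) = {vset {a}, vset {a, b}}"
  unfolding opair_def by (simp add: elts_vset_finite)

lemma elts_vset1 [simp]: "elts (vset {a :: 'k hset}) = {a}"
  by (simp add: elts_vset_finite)

lemma elts_vset2 [simp]: "elts (vset {a :: 'k hset, b}) = {a, b}"
  by (simp add: elts_vset_finite)

lemma vset_inject: "finite X \<Longrightarrow> finite Y \<Longrightarrow> vset X = (vset Y :: 'k hset) \<longleftrightarrow> X = Y"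
  using elts_vset_finite by metis

lemma opair_inject [simp]: "opair (a :: 'k hset) b = opair c d \<longleftrightarrow> a = c \<and> b = d"
proof
  assume "opair a b = opair c d"
  then have "{vset {a}, vset {a, b}} = {vset {c}, vset {c, d}}" using elts_opair by metis
  then show "a = c \<and> b = d"
    by (auto simp: doubleton_eq_iff vset_inject)
qed simp

lemma opair_Hset: "a \<in> Hset \<kappa> \<Longrightarrow> b \<in> Hset \<kappa> \<Longrightarrow> opair a b \<in> Hset \<kappa>"
proof -
  assume ab: "a \<in> Hset \<kappa>" "b \<in> Hset \<kappa>"
  have "vset {a} \<in> Hset \<kappa>" by (rule Hset_I) (use ab in \<open>simp_all add: card_finite_less\<close>)
  moreover have "vset {a, b} \<in> Hset \<kappa>"
    by (rule Hset_I) (use ab in \<open>simp_all add: card_finite_less\<close>)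
  ultimately show ?thesis by (intro Hset_I) (simp_all add: elts_opair card_finite_less)
qed

lemma elts_frestrict: "elts (frestrict f A :: 'k hset) = {z \<in> elts f. \<exists>a\<in>A. \<exists>b. z = opair a b}"
  unfolding frestrict_def by (rule elts_vset_subset[of _ f]) auto

lemma fapp_eq: "is_fun f \<Longrightarrow> opair a b \<in> elts f \<Longrightarrow> fapp f a = b"
  unfolding fapp_def by (rule the_equality) (simp_all add: is_fun_def)

lemma fapp_mem: "is_fun f \<Longrightarrow> a \<in> fdom f \<Longrightarrow> opair a (fapp f a) \<in> elts f"
  using fapp_eq unfolding fdom_def mem_Collect_eq by metis

lemma fun_elts_eq: "is_fun f \<Longrightarrow> elts f = (\<lambda>a. opair a (fapp f a)) ` fdom f"
proof (intro equalityI subsetI)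
  fix z assume f: "is_fun f" and z: "z \<in> elts f"
  then obtain a b where "z = opair a b" unfolding is_fun_def by blast
  then show "z \<in> (\<lambda>a. opair a (fapp f a)) ` fdom f"
    using f z fapp_eq unfolding fdom_def by auto
qed (use fapp_mem in auto)

lemma fun_ext:
  assumes "is_fun f" "is_fun g" "fdom f = fdom g" "\<And>a. a \<in> fdom f \<Longrightarrow> fapp f a = fapp g a"
  shows "f = g"
proof (rule elts_ext)
  show "elts f = elts g"
    unfolding fun_elts_eq[OF assms(1)] fun_elts_eq[OF assms(2)] using assms(3,4) by auto
qed

lemma funs_Hset:
  assumes "f \<in> funs \<alpha> (Hset \<kappa>)" "\<alpha> \<in> elts \<kappa>" shows "f \<in> Hset \<kappa>"
proof (rule Hset_I)
  have f: "is_fun f" "fdom f = elts \<alpha>" "fran f \<subseteq> Hset \<kappa>" using assms(1) unfolding funs_def by auto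
  have eq: "elts f = (\<lambda>a. opair a (fapp f a)) ` elts \<alpha>" using fun_elts_eq[OF f(1)] f(2) by simp
  show "|elts f| <o |elts \<kappa>|" unfolding eq by (intro card_image_less card_less_kappa assms)
  show "elts f \<subseteq> Hset \<kappa>"
  proof
    fix z assume z: "z \<in> elts f"
    then obtain a where a: "a \<in> elts \<alpha>" "z = opair a (fapp f a)" using eq by blast
    then have "fapp f a \<in> Hset \<kappa>" using f(3) z unfolding fran_def by blast
    then show "z \<in> Hset \<kappa>" using a opair_Hset Ord_Hset below_trans assms(2) by blast
  qed
qed

abbreviation rs :: "'k hset \<Rightarrow> 'k hset \<Rightarrow> 'k hset" where
  "rs t \<beta> \<equiv> frestrict t (elts \<beta>)"

lemma funsD:
  assumes "t \<in> funs \<alpha> Y" shows "is_fun t" "fdom t = elts \<alpha>" "fran t \<subseteq> Y"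
  using assms unfolding funs_def by auto

lemma funs_unique: "t \<in> funs \<alpha> Y \<Longrightarrow> t \<in> funs \<beta> Z \<Longrightarrow> \<alpha> = \<beta>"
  unfolding funs_def using elts_ext by auto

lemma rs_rs: "elts \<gamma> \<subseteq> elts \<beta> \<Longrightarrow> rs (rs t \<beta>) \<gamma> = rs t \<gamma>"
  by (rule elts_ext) (auto simp: elts_frestrict)

lemma rs_self: "t \<in> funs \<alpha> Y \<Longrightarrow> rs t \<alpha> = t"
proof (rule elts_ext)
  assume "t \<in> funs \<alpha> Y"
  note t = funsD[OF this]
  show "elts (rs t \<alpha>) = elts t"
    using fun_elts_eq[OF t(1)] t(2) by (auto simp: elts_frestrict)
qed

lemma rs_subset: "elts (rs t \<beta>) \<subseteq> elts t"
  by (auto simp: elts_frestrict)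

text \<open>Inclusion is how the tree order is given, restriction is how the levels are defined;
  this passes from the first to the second.\<close>

lemma subset_rs:
  fixes s t :: "'k hset"
  assumes "s \<in> funs \<beta> Y" "t \<in> funs \<alpha> Z" "elts s \<subseteq> elts t"
  shows "s = rs t \<beta>" "elts \<beta> \<subseteq> elts \<alpha>"
proof -
  note s = funsD[OF assms(1)] and t = funsD[OF assms(2)]
  show le: "elts \<beta> \<subseteq> elts \<alpha>"
    using s(2) t(2) assms(3) unfolding fdom_def by blast
  show "s = rs t \<beta>"
  proof (rule elts_ext, intro equalityI subsetI)
    fix z assume z: "z \<in> elts s"
    then obtain a where "a \<in> elts \<beta>" "z = opair a (fapp s a)"
      using fun_elts_eq[OF s(1)] s(2) by auto
    then show "z \<in> elts (rs t \<beta>)" using z assms(3) by (auto simp: elts_frestrict)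
  next
    fix z assume "z \<in> elts (rs t \<beta>)"
    then obtain a b where ab: "z \<in> elts t" "a \<in> elts \<beta>" "z = opair a b" by (auto simp: elts_frestrict)
    then have m: "opair a (fapp s a) \<in> elts s" using fapp_mem[OF s(1)] s(2) by simp
    then have "fapp s a = b" using ab assms(3) t(1) unfolding is_fun_def by blast
    then show "z \<in> elts s" using m ab by simp
  qed
qed

lemma rs_UN: "elts \<delta> = (\<Union>\<beta>\<in>X. elts \<beta>) \<Longrightarrow> elts (rs t \<delta>) = (\<Union>\<beta>\<in>X. elts (rs t \<beta>))"
  by (auto simp: elts_frestrict)

text \<open>The source of all nodes at limit levels. Two pairs of the union lie in a common member
  of the chain, which makes the union single-valued.\<close>

lemma union_funs:
  fixes s :: "'i \<Rightarrow> 'k hset"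
  assumes small: "|X| \<le>o |UNIV :: 'k set|"
    and s: "\<And>i. i \<in> X \<Longrightarrow> s i \<in> funs (d i) Y"
    and chain: "\<And>i j. i \<in> X \<Longrightarrow> j \<in> X \<Longrightarrow> elts (s i) \<subseteq> elts (s j) \<or> elts (s j) \<subseteq> elts (s i)"
    and d: "elts \<delta> = (\<Union>i\<in>X. elts (d i))"
  shows "elts (vset (\<Union>i\<in>X. elts (s i))) = (\<Union>i\<in>X. elts (s i))"
    "vset (\<Union>i\<in>X. elts (s i)) \<in> funs \<delta> Y"
    "i \<in> X \<Longrightarrow> rs (vset (\<Union>i\<in>X. elts (s i))) (d i) = s i"
proof -
  let ?u = "vset (\<Union>i\<in>X. elts (s i))"
  show e: "elts ?u = (\<Union>i\<in>X. elts (s i))"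
    by (rule elts_vset, rule small_UN[OF small]) (rule small_elts)
  have "is_fun ?u"
    unfolding is_fun_def
  proof (intro conjI ballI allI impI)
    fix z assume "z \<in> elts ?u"
    then show "\<exists>a b. z = opair a b" using e s funsD(1) unfolding is_fun_def by blast
  next
    fix a b c assume "opair a b \<in> elts ?u" "opair a c \<in> elts ?u"
    then obtain i j where ij: "i \<in> X" "opair a b \<in> elts (s i)" "j \<in> X" "opair a c \<in> elts (s j)"
      using e by blast
    then have "\<exists>k\<in>X. opair a b \<in> elts (s k) \<and> opair a c \<in> elts (s k)" using chain by blast
    then show "b = c" using s funsD(1) unfolding is_fun_def by blast
  qed
  moreover have "fdom ?u = (\<Union>i\<in>X. fdom (s i))" unfolding fdom_def e by blast
  then have "fdom ?u = elts \<delta>" using d s funsD(2) by fastforce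
  moreover have "fran ?u = (\<Union>i\<in>X. fran (s i))" unfolding fran_def e by blast
  then have "fran ?u \<subseteq> Y" using s funsD(3) by fastforce
  ultimately show u: "?u \<in> funs \<delta> Y" unfolding funs_def by blast
  show "rs ?u (d i) = s i" if "i \<in> X"
    by (rule subset_rs(1)[OF s[OF that] u, symmetric]) (use e that in auto)
qed

lemma append1_props:
  fixes t :: "'k hset"
  assumes t: "t \<in> funs \<alpha> Y" and i: "i \<in> Y"
  shows elts_append1: "elts (append1 t i) = insert (opair \<alpha> i) (elts t)"
    and append1_funs: "append1 t i \<in> funs (osucc \<alpha>) Y"
    and rs_append1: "rs (append1 t i) \<alpha> = t"
    and fapp_append1: "fapp (append1 t i) \<alpha> = i"
proof -
  note tf = funsD[OF t]
  have "|{opair \<alpha> i} \<union> elts t| \<le>o |UNIV :: 'k set|"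
    by (intro small_Un finite_small small_elts) simp
  then show e: "elts (append1 t i) = insert (opair \<alpha> i) (elts t)"
    unfolding append1_def using tf(2) by (simp add: elts_vset)
  have n: "opair \<alpha> b \<notin> elts t" for b
    using tf(2) mem_irrefl unfolding fdom_def by blast
  have f: "is_fun (append1 t i)"
    using tf(1) n unfolding is_fun_def e by auto
  moreover have "fdom (append1 t i) = elts (osucc \<alpha>)"
    using tf(2) unfolding fdom_def e elts_osucc by auto
  moreover have "fran (append1 t i) \<subseteq> Y"
    using tf(3) i unfolding fran_def e by auto
  ultimately show a: "append1 t i \<in> funs (osucc \<alpha>) Y" unfolding funs_def by blast
  show "rs (append1 t i) \<alpha> = t"
    by (rule subset_rs(1)[OF t a, symmetric]) (use e in auto)
  show "fapp (append1 t i) \<alpha> = i" by (rule fapp_eq[OF f]) (simp add: e)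
qed

lemma funs_osucc_ext:
  assumes "s \<in> funs (osucc \<alpha>) Y" "t \<in> funs (osucc \<alpha>) Z" "rs s \<alpha> = rs t \<alpha>" "fapp s \<alpha> = fapp t \<alpha>"
  shows "s = (t :: 'k hset)"
proof (rule fun_ext)
  note s = funsD[OF assms(1)] and t = funsD[OF assms(2)]
  show "is_fun s" "is_fun t" "fdom s = fdom t" using s t by auto
  fix a assume a: "a \<in> fdom s"
  show "fapp s a = fapp t a"
  proof (cases "a = \<alpha>")
    case False
    then have "a \<in> elts \<alpha>" using a s(2) elts_osucc by simp
    moreover have "opair a (fapp s a) \<in> elts s" using fapp_mem s(1) a by blast
    ultimately have "opair a (fapp s a) \<in> elts (rs s \<alpha>)" by (auto simp: elts_frestrict)
    then show ?thesis using assms(3) rs_subset fapp_eq[OF t(1)] by (metis subsetD)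
  qed (use assms(4) in simp)
qed

text \<open>Turns a function of the logic into a set of the universe. This is needed for the
  guessing parameter, which has to lie in \<open>Hset_plus \<kappa>\<close>, and for coding branches
  by members of \<open>funs_lt\<close>.\<close>

definition hfun :: "'k hset \<Rightarrow> ('k hset \<Rightarrow> 'k hset) \<Rightarrow> 'k hset" where
  "hfun \<delta> h = vset ((\<lambda>i. opair i (h i)) ` elts \<delta>)"

lemma elts_hfun: "elts (hfun \<delta> h) = (\<lambda>i. opair i (h i)) ` elts \<delta>"
  unfolding hfun_def
  by (rule elts_vset) (use card_of_image small_elts ordLeq_transitive in blast)

lemma hfun_is_fun: "is_fun (hfun \<delta> h)"
  unfolding is_fun_def elts_hfun by auto

lemma hfun_funs: "(\<And>i. i \<in> elts \<delta> \<Longrightarrow> h i \<in> Y) \<Longrightarrow> hfun \<delta> h \<in> funs \<delta> Y"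
  unfolding funs_def fdom_def fran_def using hfun_is_fun elts_hfun by auto

lemma fapp_hfun: "i \<in> elts \<delta> \<Longrightarrow> fapp (hfun \<delta> h) i = h i"
  by (rule fapp_eq[OF hfun_is_fun]) (simp add: elts_hfun)

section \<open>Order type one and the ordinal omega\<close>

lemma elts_one: "elts (osucc ozero :: 'k hset) = {ozero}"
  by (simp add: elts_osucc)

lemma Ord_one: "Ord (osucc ozero :: 'k hset)"
  by (rule Ord_osucc[OF Ord_ozero])

lemma otp_eq_one_iff:
  assumes "A \<subseteq> elts \<kappa>"
  shows "otp A = osucc ozero \<longleftrightarrow> (\<exists>a. A = {a})"
proof
  assume o: "otp A = osucc ozero"
  obtain f where "order_iso f (elts (otp A)) A" using otp_exists[OF Ord_kappa assms] by blast
  then have "A = f ` {ozero}" using o elts_one unfolding order_iso_def bij_betw_def by simp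
  then show "\<exists>a. A = {a}" by simp
next
  assume "\<exists>a. A = {a}"
  then obtain a where A: "A = {a}" by blast
  have "order_iso (\<lambda>_. a) (elts (osucc ozero)) A"
    unfolding order_iso_def elts_one A by (simp add: mem_irrefl bij_betw_def)
  then show "otp A = osucc ozero" by (rule otp_eqI[OF Ord_one])
qed

text \<open>For n = 1 the only index is 0 + 1, so the set picks out the second element of A. That
  element is recognised by having the least element of A as its single predecessor in A.\<close>

lemma succ_set_one:
  assumes A: "A \<subseteq> elts \<kappa>" and \<gamma>: "\<gamma> \<in> A" "A \<inter> elts \<gamma> = {}" and \<beta>: "\<beta> \<in> A" "A \<inter> elts \<beta> = {\<gamma>}"
  shows "\<beta> \<in> succ_set (osucc ozero) A"
proof -
  have sub: "A \<inter> elts x \<subseteq> elts \<kappa>" for x using A by blast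
  have nth: "nth_elem A (osucc ozero) = \<beta>"
    unfolding nth_elem_def
  proof (rule the_equality)
    show "\<beta> \<in> A \<and> otp (A \<inter> elts \<beta>) = osucc ozero" using otp_eq_one_iff[OF sub[of \<beta>]] \<beta> by simp
    fix x assume "x \<in> A \<and> otp (A \<inter> elts x) = osucc ozero"
    then obtain a where x: "x \<in> A" "A \<inter> elts x = {a}" using otp_eq_one_iff[OF sub[of x]] by auto
    have "x \<notin> elts \<beta>"
    proof
      assume "x \<in> elts \<beta>"
      then have "x \<in> A \<inter> elts \<beta>" using x(1) by simp
      then have "x = \<gamma>" using \<beta>(2) by simp
      then show False using \<gamma>(2) x(2) by simp
    qed
    moreover have "\<beta> \<notin> elts x"
    proof
      assume b: "\<beta> \<in> elts x"
      have "\<gamma> \<in> A \<inter> elts \<beta>" using \<beta>(2) by simp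
      then have g: "\<gamma> \<in> elts \<beta>" by simp
      then have "\<gamma> \<in> elts x" using Ord_trans[OF Ord_below b] x(1) A by blast
      then have "\<gamma> \<in> {a}" "\<beta> \<in> {a}" using x(2) \<gamma>(1) \<beta>(1) b by auto
      then show False using g mem_irrefl by auto
    qed
    ultimately show "x = \<beta>" using Ord_linear[of x \<beta>] Ord_below x(1) \<beta>(1) A by blast
  qed
  obtain f where f: "Ord (otp A)" "order_iso f (elts (otp A)) A" using otp_exists[OF Ord_kappa A] by blast
  have "osucc ozero \<in> elts (otp A)"
  proof (rule ccontr)
    assume "\<not> ?thesis"
    then have "elts (otp A) \<subseteq> {ozero}" using Ord_not_mem_iff[OF Ord_one f(1)] elts_one by simp
    then have "f ` elts (otp A) \<subseteq> {f ozero}" by auto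
    then have "A \<subseteq> {f ozero}" using f(2) unfolding order_iso_def bij_betw_def by simp
    then have "\<gamma> = \<beta>" using \<gamma>(1) \<beta>(1) by auto
    then show False using \<gamma>(2) \<beta>(2) by simp
  qed
  then have "nth_elem A (osucc ozero) \<in> succ_set (osucc ozero) A"
    unfolding succ_set_def using elts_one by auto
  then show ?thesis using nth by simp
qed

lemma finite_Ord_below: "Ord n \<Longrightarrow> finite (elts n) \<Longrightarrow> n \<in> elts \<kappa>"
  using Ord_not_mem_iff[OF _ Ord_kappa, of n] infinite_kappa finite_subset by blast

text \<open>\<open>vset\<close> has the intended members only for small sets; here the infinite
  \<kappa> contains all finite ordinals and supplies the bound.\<close>

lemma elts_omega: "elts (omega :: 'k hset) = {n. Ord n \<and> finite (elts n)}"
  unfolding omega_def by (rule elts_vset_subset[of _ \<kappa>]) (use finite_Ord_below in auto)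

lemma one_omega: "osucc ozero \<in> elts (omega :: 'k hset)"
  unfolding elts_omega by (simp add: Ord_one elts_one)

lemma countable_omega: "countable (elts (omega :: 'k hset))"
proof (rule countableI')
  show "inj_on (\<lambda>n. card (elts n)) (elts (omega :: 'k hset))"
  proof (rule inj_onI)
    fix m n :: "'k hset"
    assume m: "m \<in> elts omega" and n: "n \<in> elts omega" and c: "card (elts m) = card (elts n)"
    have fin: "Ord m" "finite (elts m)" "Ord n" "finite (elts n)" using m n elts_omega by auto
    then have "elts m \<subseteq> elts n \<or> elts n \<subseteq> elts m"
      using Ord_linear[of m n] Ord_elts_subset by blast
    then have "elts m = elts n"
      using card_subset_eq[OF fin(2), of "elts n"] card_subset_eq[OF fin(4), of "elts m"] c by auto
    then show "m = n" by (rule elts_ext)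
  qed
qed

lemma card_countable_less:
  assumes "uncountable (elts \<kappa>)" "countable X" shows "|X| <o |elts \<kappa>|"
proof (rule ccontr)
  assume "\<not> |X| <o |elts \<kappa>|"
  then have "|elts \<kappa>| \<le>o |X|" 
    using ordLess_or_ordLeq[OF card_of_Well_order[of X] card_of_Well_order[of "elts \<kappa>"]] by blast
  then obtain f where "inj_on f (elts \<kappa>)" "f ` elts \<kappa> \<subseteq> X" using card_of_ordLeq[of "elts \<kappa>" X] by auto
  then have "countable (elts \<kappa>)" using assms(2) countable_image_inj_on countable_subset by metis
  then show False using assms(1) by simp
qed

section \<open>Elementary substructures\<close>

text \<open>The Tarski-Vaught form of elementarity, through which all closure properties of M are
  obtained.\<close>

lemma elem_sub_witness:
  assumes "elem_sub M N" "range e \<subseteq> M" "a \<in> N" "sat N (e(i := a)) \<phi>"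
  obtains b where "b \<in> M" "sat N (e(i := b)) \<phi>"
proof -
  have el: "range e' \<subseteq> M \<Longrightarrow> sat M e' \<psi> \<longleftrightarrow> sat N e' \<psi>" for e' \<psi>
    using assms(1) unfolding elem_sub_def by blast
  have "sat N e (Exists i \<phi>)" using assms(3,4) by auto
  then have "sat M e (Exists i \<phi>)" using el[OF assms(2)] by blast
  then obtain b where b: "b \<in> M" "sat M (e(i := b)) \<phi>" by auto
  have "range (e(i := b)) \<subseteq> M" using assms(2) b(1) by auto
  then show ?thesis using that b el by blast
qed

text \<open>One formula yields some member \<open>c\<close> of \<open>z\<close> inside M, without
  telling which. With \<open>c\<close> as a new parameter the other member becomes definable as the
  one that differs from \<open>c\<close>.\<close>

lemma elem_sub_doubleton:
  assumes M: "elem_sub M N" and tr: "\<forall>x\<in>N. elts x \<subseteq> N"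
    and z: "z \<in> M" "elts z = {a, b}"
  shows "a \<in> M \<and> b \<in> M"
proof -
  have "z \<in> N" using M z(1) unfolding elem_sub_def by blast
  then have ab: "a \<in> N" "b \<in> N" using tr z(2) by blast+
  obtain c where c: "c \<in> M" "sat N ((\<lambda>_. z)(0 := c)) (Mem 0 1)"
    using elem_sub_witness[OF M, of "\<lambda>_. z" a 0 "Mem 0 1"] z ab by auto
  then have cz: "c \<in> {a, b}" using z(2) by simp
  define d where "d = (if c = a then b else a)"
  have dz: "d \<in> elts z" "d \<in> N" using z(2) ab unfolding d_def by auto
  have "d \<in> M"
  proof (cases "d = c")
    case False
    let ?e = "(\<lambda>_. z)(2 := c)" and ?\<phi> = "Conj (Mem 0 1) (Neg (Equal 0 2))"
    have "range ?e \<subseteq> M" using z(1) c(1) by auto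
    moreover have "sat N (?e(0 := d)) ?\<phi>" using False dz by simp
    ultimately obtain x where "x \<in> M" "sat N (?e(0 := x)) ?\<phi>"
      using elem_sub_witness[OF M _ dz(2)] by blast
    then have "x \<in> M" "x \<in> {a, b}" "x \<noteq> c" using z(2) by simp_all
    then show ?thesis using cz unfolding d_def by auto
  qed (use c in simp)
  then show ?thesis using c(1) cz unfolding d_def by (auto split: if_splits)
qed

lemma elem_sub_opair:
  assumes M: "elem_sub M N" and tr: "\<forall>x\<in>N. elts x \<subseteq> N"
    and z: "opair a b \<in> (M :: 'k hset set)"
  shows "a \<in> M" "b \<in> M"
proof -
  have "vset {a, b} \<in> M" using elem_sub_doubleton[OF M tr z elts_opair] by blast
  then show "a \<in> M" "b \<in> M" using elem_sub_doubleton[OF M tr _ elts_vset2] by blast+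
qed

lemma elem_sub_fapp:
  assumes M: "elem_sub M N" and tr: "\<forall>x\<in>N. elts x \<subseteq> N"
    and p: "p \<in> M" "is_fun p" and x: "x \<in> M" "opair x y \<in> elts (p :: 'k hset)"
  shows "y \<in> M"
proof -
  let ?e = "(\<lambda>_. p)(2 := x)"
  \<comment> \<open>variable 0 is an element of \<open>p\<close> that contains \<open>{x}\<close>\<close>
  let ?\<phi> = "Conj (Mem 0 1) (Exists 3 (Conj (Mem 3 0) (Conj (Mem 2 3) (Neg (Exists 4 (Conj (Mem 4 3) (Neg (Equal 4 2))))))))"
  have N: "p \<in> N" using M p(1) unfolding elem_sub_def by blast
  then have zN: "opair x y \<in> N" using tr x(2) by blast
  then have wN: "vset {x} \<in> N" using tr by (auto simp: elts_opair)
  have "range ?e \<subseteq> M" using p(1) x(1) by auto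
  moreover have "sat N (?e(0 := opair x y)) ?\<phi>"
    using x(2) wN by (auto simp: elts_opair intro!: bexI[of _ "vset {x}"])
  ultimately obtain z where z: "z \<in> M" "sat N (?e(0 := z)) ?\<phi>"
    using elem_sub_witness[OF M _ zN] by blast
  then obtain w where w: "z \<in> elts p" "w \<in> N" "w \<in> elts z" "\<And>v. v \<in> N \<Longrightarrow> v \<in> elts w \<Longrightarrow> v = x"
    by auto
  obtain a b where ab: "z = opair a b" using w(1) p(2) unfolding is_fun_def by blast
  \<comment> \<open>The formula does not say which of the two members of the pair \<open>w\<close>
    is, but both contain the first coordinate. Hence the witness starts with \<open>x\<close>, and
    single-valuedness of \<open>p\<close> makes it the pair with \<open>y\<close>.\<close>
  then have "a \<in> elts w" using w(3) by (auto simp: elts_opair)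
  then have "a = x" using w(2,4) tr by blast
  then have "b = y" using w(1) ab x(2) p(2) unfolding is_fun_def by blast
  then show ?thesis using elem_sub_opair(2)[OF M tr] z(1) ab by blast
qed

end

section \<open>Limit ordinals and the choice of an extension\<close>

definition limit_ord :: "'k hset \<Rightarrow> bool" where
  "limit_ord \<alpha> \<longleftrightarrow> \<alpha> \<noteq> ozero \<and> (\<Union>a\<in>elts \<alpha>. elts a) = elts \<alpha>"

text \<open>The choice depends on nothing but the level K, the node u and the guess c. Thus two
  ladders that agree at a point and have the same supremum before it prescribe the same node
  there.\<close>

definition extension :: "'k hset set \<Rightarrow> 'k hset \<Rightarrow> 'k hset \<Rightarrow> 'k hset" where
  "extension K u c =
     (if \<exists>y\<in>K. elts u \<subseteq> elts y \<and> (\<exists>a\<in>elts c. elts a \<subseteq> elts y)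
      then SOME y. y \<in> K \<and> elts u \<subseteq> elts y \<and> (\<exists>a\<in>elts c. elts a \<subseteq> elts y)
      else SOME y. y \<in> K \<and> elts u \<subseteq> elts y)"

lemma extension_sealed:
  assumes "\<exists>y\<in>K. elts u \<subseteq> elts y \<and> (\<exists>a\<in>elts c. elts a \<subseteq> elts y)"
  shows "\<exists>a\<in>elts c. elts a \<subseteq> elts (extension K u c)"
    "extension K u c \<in> K" "elts u \<subseteq> elts (extension K u c)"
proof -
  have "\<exists>y. y \<in> K \<and> elts u \<subseteq> elts y \<and> (\<exists>a\<in>elts c. elts a \<subseteq> elts y)" using assms by blast
  then have "extension K u c \<in> K \<and> elts u \<subseteq> elts (extension K u c) \<and>
      (\<exists>a\<in>elts c. elts a \<subseteq> elts (extension K u c))"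
    unfolding extension_def if_P[OF assms] by (rule someI_ex)
  then show "\<exists>a\<in>elts c. elts a \<subseteq> elts (extension K u c)" "extension K u c \<in> K"
    "elts u \<subseteq> elts (extension K u c)" by blast+
qed

lemma extension_extends:
  assumes "\<exists>y\<in>K. elts u \<subseteq> elts y"
  shows "extension K u c \<in> K" "elts u \<subseteq> elts (extension K u c)"
proof -
  have "extension K u c \<in> K \<and> elts u \<subseteq> elts (extension K u c)"
  proof (cases "\<exists>y\<in>K. elts u \<subseteq> elts y \<and> (\<exists>a\<in>elts c. elts a \<subseteq> elts y)")
    case True
    then show ?thesis using extension_sealed(2,3)[OF True] by simp
  next
    case False
    have "\<exists>y. y \<in> K \<and> elts u \<subseteq> elts y" using assms by blast
    then show ?thesis unfolding extension_def if_not_P[OF False] by (rule someI_ex)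
  qed
  then show "extension K u c \<in> K" "elts u \<subseteq> elts (extension K u c)" by blast+
qed

locale souslin_setup = regular_card \<kappa> for \<kappa> :: "'k hset" +
  fixes \<chi> \<sigma> :: "'k hset" and CC :: "'k hset \<Rightarrow> 'k hset set"
  assumes uncountable_kappa: "uncountable (elts \<kappa>)"
    and chi_regular: "regular_cardinal \<chi>" and chi_less: "\<chi> \<in> elts \<kappa>" and chi_closed: "lt_closed \<chi> \<kappa>"
    and sigma_less: "\<sigma> \<in> elts \<kappa>"
    and CC: "\<And>\<alpha>. \<alpha> \<in> acc (elts \<kappa>) \<Longrightarrow>
        CC \<alpha> \<subseteq> {C\<in>F_class \<kappa>. alpha_of C = \<alpha>} \<and> CC \<alpha> \<noteq> {} \<and> |CC \<alpha>| <o |elts \<kappa>| \<and>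
        (\<forall>C\<in>CC \<alpha>. \<forall>\<beta>\<in>acc (fdom C). \<exists>D\<in>CC \<beta>. chi_sq_star \<chi> D C)"
begin

lemma lim_iff_acc:
  assumes "\<alpha> \<in> elts \<kappa>" shows "\<alpha> \<in> acc (elts \<kappa>) \<longleftrightarrow> limit_ord \<alpha>"
proof -
  have "elts \<kappa> \<inter> elts \<alpha> = elts \<alpha>" using below_trans[OF assms] by blast
  moreover have "osup (elts \<alpha>) = \<alpha> \<longleftrightarrow> (\<Union>a\<in>elts \<alpha>. elts a) = elts \<alpha>"
    using elts_osup[of "elts \<alpha>" \<alpha>] elts_ext[of "osup (elts \<alpha>)" \<alpha>] by auto
  ultimately show ?thesis using assms unfolding acc_def limit_ord_def by auto
qed

lemma lim_not_osucc: "limit_ord \<alpha> \<Longrightarrow> Ord \<alpha> \<Longrightarrow> \<alpha> \<noteq> osucc (\<beta> :: 'k hset)"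
proof
  assume l: "limit_ord \<alpha>" and o: "Ord \<alpha>" and e: "\<alpha> = osucc \<beta>"
  have "\<beta> \<in> (\<Union>a\<in>elts \<alpha>. elts a)" using l e elts_osucc[of \<beta>] unfolding limit_ord_def by simp
  then obtain a where "a \<in> elts \<alpha>" "\<beta> \<in> elts a" by blast
  then show False using e elts_osucc[of \<beta>] mem_irrefl mem_asym by auto
qed

lemma Ord_cases:
  assumes "Ord \<alpha>"
  obtains "\<alpha> = (ozero :: 'k hset)" | \<beta> where "\<beta> \<in> elts \<alpha>" "\<alpha> = osucc \<beta>" | "limit_ord \<alpha>"
proof (cases "\<alpha> = ozero \<or> limit_ord \<alpha>")
  case False
  moreover have "(\<Union>a\<in>elts \<alpha>. elts a) \<subseteq> elts \<alpha>" using Ord_elts_subset[OF assms] by blast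
  ultimately obtain \<beta> where b: "\<beta> \<in> elts \<alpha>" "\<And>a. a \<in> elts \<alpha> \<Longrightarrow> \<beta> \<notin> elts a"
    unfolding limit_ord_def by blast
  have "elts \<alpha> = elts (osucc \<beta>)"
    unfolding elts_osucc
  proof (intro equalityI subsetI)
    fix x assume "x \<in> elts \<alpha>"
    then show "x \<in> insert \<beta> (elts \<beta>)"
      using b Ord_linear[of x \<beta>] Ord_in_Ord[OF assms] by blast
  next
    fix x assume "x \<in> insert \<beta> (elts \<beta>)"
    then show "x \<in> elts \<alpha>" using b(1) Ord_trans[OF assms b(1)] by blast
  qed
  then show ?thesis using that(2) b(1) elts_ext by blast
qed (use that in blast)

lemma lim_succ_mem: "limit_ord \<alpha> \<Longrightarrow> \<beta> \<in> elts \<alpha> \<Longrightarrow> \<exists>a\<in>elts \<alpha>. \<beta> \<in> elts a"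
  unfolding limit_ord_def by blast

lemma osucc_below: "\<alpha> \<in> elts \<kappa> \<Longrightarrow> osucc \<alpha> \<in> elts \<kappa>"
proof (rule ccontr)
  assume a: "\<alpha> \<in> elts \<kappa>" and "osucc \<alpha> \<notin> elts \<kappa>"
  then have "elts \<kappa> \<subseteq> insert \<alpha> (elts \<alpha>)"
    using Ord_not_mem_iff[OF Ord_osucc[OF Ord_below] Ord_kappa] elts_osucc by metis
  then have "|elts \<kappa>| \<le>o |{\<alpha>} \<union> elts \<alpha>|" by (intro card_of_mono1) simp
  moreover have "|{\<alpha>} \<union> elts \<alpha>| <o |elts \<kappa>|"
    by (intro card_Un_less card_finite_less card_less_kappa a) simp
  ultimately show False using not_ordLess_ordLeq by blast
qed

lemma lim_kappa: "limit_ord \<kappa>"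
proof -
  have "(\<Union>a\<in>elts \<kappa>. elts a) = elts \<kappa>"
  proof (intro equalityI subsetI)
    fix x assume "x \<in> elts \<kappa>"
    then show "x \<in> (\<Union>a\<in>elts \<kappa>. elts a)" using osucc_below elts_osucc by blast
  qed (use below_trans in blast)
  moreover have "\<kappa> \<noteq> ozero" using infinite_kappa by auto
  ultimately show ?thesis unfolding limit_ord_def by blast
qed

lemma ozero_below: "ozero \<in> elts \<kappa>"
  using ozero_mem[OF Ord_kappa] lim_kappa unfolding limit_ord_def by blast

section \<open>Ladders\<close>

context
  fixes \<alpha> C
  assumes \<alpha>: "\<alpha> \<in> elts \<kappa>" "limit_ord \<alpha>" and C: "C \<in> CC \<alpha>"
begin

lemma ladder_F: "C \<in> F_class \<kappa>" "alpha_of C = \<alpha>"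
  using CC lim_iff_acc \<alpha> C by blast+

lemma ladder_fun: "is_fun C"
  using ladder_F unfolding F_class_def by blast

lemma ladder_club: "club_in \<alpha> (fdom C)"
  using ladder_F unfolding F_class_def by blast

lemma ladder_subset: "fdom C \<subseteq> elts \<alpha>"
  using ladder_club unfolding club_in_def by blast

lemma ladder_below: "\<beta> \<in> fdom C \<Longrightarrow> \<beta> \<in> elts \<kappa>"
  using ladder_subset below_trans[OF \<alpha>(1)] by blast

lemma ladder_Ord: "\<beta> \<in> fdom C \<Longrightarrow> Ord \<beta>"
  using ladder_below Ord_below by blast

lemma ladder_sup: "(\<Union>\<beta>\<in>fdom C. elts \<beta>) = elts \<alpha>"
  using ladder_club elts_osup[OF ladder_subset] unfolding club_in_def by metis

lemma ladder_unbounded: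
  assumes "\<delta> \<in> elts \<alpha>" obtains \<beta> where "\<beta> \<in> fdom C" "\<delta> \<in> elts \<beta>"
  using assms ladder_sup by blast

lemma ladder_osup: "elts (osup (fdom C \<inter> elts \<beta>)) = (\<Union>x\<in>fdom C \<inter> elts \<beta>. elts x)"
  by (rule elts_osup[of _ \<alpha>]) (use ladder_subset in blast)

lemma ladder_osup_subset: "Ord \<beta> \<Longrightarrow> elts (osup (fdom C \<inter> elts \<beta>)) \<subseteq> elts \<beta>"
  unfolding ladder_osup using Ord_elts_subset by blast

lemma ladder_osup_Ord: "Ord (osup (fdom C \<inter> elts \<beta>))"
proof (rule OrdI_subset)
  fix x assume "x \<in> elts (osup (fdom C \<inter> elts \<beta>))"
  then obtain a where a: "a \<in> fdom C" "a \<in> elts \<beta>" "x \<in> elts a" unfolding ladder_osup by blast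
  then show "Ord x" using ladder_Ord Ord_in_Ord by blast
  fix y assume "y \<in> elts x"
  then have "y \<in> elts a" using a ladder_Ord Ord_trans by blast
  then show "y \<in> elts (osup (fdom C \<inter> elts \<beta>))" unfolding ladder_osup using a by blast
qed

text \<open>Closedness of \<partial>C: a supremum that falls short of \<beta> must be attained, and
  is then the last point of \<partial>C below \<beta>; otherwise it would be a limit of \<partial>C
  that \<partial>C misses.\<close>

lemma ladder_osup_cases:
  assumes \<beta>: "\<beta> \<in> elts \<alpha> \<or> \<beta> = \<alpha>" and ne: "fdom C \<inter> elts \<beta> \<noteq> {}"
  shows "osup (fdom C \<inter> elts \<beta>) = \<beta> \<or> osup (fdom C \<inter> elts \<beta>) \<in> fdom C \<inter> elts \<beta>"
proof -
  let ?X = "fdom C \<inter> elts \<beta>" let ?d = "osup ?X"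
  have ob: "Ord \<beta>" using \<beta> \<alpha>(1) below_trans Ord_below by blast
  have od: "Ord ?d" by (rule ladder_osup_Ord)
  show ?thesis
  proof (rule ccontr)
    assume n: "\<not> ?thesis"
    then have db: "?d \<in> elts \<beta>" using Ord_subset_iff[OF od ob] ladder_osup_subset[OF ob] by blast
    then have da: "?d \<in> elts \<alpha>" using \<beta> Ord_trans[OF Ord_below[OF \<alpha>(1)]] by blast
    have "x \<in> elts ?d" if x: "x \<in> ?X" for x
    proof -
      have "elts x \<subseteq> elts ?d" unfolding ladder_osup using x by blast
      moreover have "Ord x" using x ladder_Ord by blast
      moreover have "x \<noteq> ?d" using x n by metis
      ultimately show ?thesis using Ord_subset_iff[OF _ od] by blast
    qed
    then have sub: "?X \<subseteq> fdom C \<inter> elts ?d" by blast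
    have "fdom C \<inter> elts ?d \<subseteq> ?X" using Ord_trans[OF ob db] by blast
    then have eq: "fdom C \<inter> elts ?d = ?X" using sub by blast
    have "?d \<noteq> ozero" using sub ne by auto
    then have "?d \<in> fdom C" using ladder_club da eq unfolding club_in_def by metis
    then show False using n db by blast
  qed
qed

end

section \<open>The levels of the tree\<close>

text \<open>Successor values range over \<omega> and \<beta>, as prolificness demands, and over
  \<sigma> for splitting. Intersecting \<open>fdom C\<close> with \<open>elts \<alpha>\<close> keeps
  every recursive call below \<alpha> whatever C is, so termination rests on membership
  alone.\<close>

function L :: "'k hset \<Rightarrow> 'k hset set" where
  "L \<alpha> = {t \<in> funs \<alpha> (Hset \<kappa>). (\<forall>\<beta>\<in>elts \<alpha>. rs t \<beta> \<in> L \<beta>) \<and>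
     (\<forall>\<beta>. \<alpha> = osucc \<beta> \<longrightarrow> fapp t \<beta> \<in> elts omega \<union> elts \<beta> \<union> elts \<sigma>) \<and>
     (limit_ord \<alpha> \<and> cf \<alpha> \<notin> elts \<chi> \<longrightarrow> (\<exists>C\<in>CC \<alpha>. \<exists>\<gamma>\<in>fdom C. \<forall>\<beta>\<in>fdom C \<inter> elts \<alpha>. \<gamma> \<in> elts \<beta> \<longrightarrow>
        rs t \<beta> = extension (L \<beta>) (rs t (osup (fdom C \<inter> elts \<beta>))) (fapp C \<beta>)))}"
  by pat_completeness auto
termination
  by (relation "{(x, y). x \<in> elts y}") (use wf_elts in auto)

declare L.simps [simp del]

text \<open>When \<beta> is the supremum of the earlier points of \<partial>C, the condition holds
  for every t with \<open>rs t \<beta> \<in> L \<beta>\<close>, because a node has no proper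
  extension on its own level. It restricts t only at the other points.\<close>

definition step :: "'k hset \<Rightarrow> 'k hset \<Rightarrow> 'k hset \<Rightarrow> bool" where
  "step C t \<beta> \<longleftrightarrow> rs t \<beta> = extension (L \<beta>) (rs t (osup (fdom C \<inter> elts \<beta>))) (fapp C \<beta>)"

lemma L_funs: "t \<in> L \<alpha> \<Longrightarrow> t \<in> funs \<alpha> (Hset \<kappa>)"
  unfolding L.simps[of \<alpha>] by simp

lemma L_rs: "t \<in> L \<alpha> \<Longrightarrow> \<beta> \<in> elts \<alpha> \<Longrightarrow> rs t \<beta> \<in> L \<beta>"
  unfolding L.simps[of \<alpha>] by simp

lemma L_self: "t \<in> L \<alpha> \<Longrightarrow> rs t \<alpha> = t"
  using L_funs rs_self by blast

lemma L_osucc: "t \<in> L (osucc \<beta>) \<Longrightarrow> fapp t \<beta> \<in> elts omega \<union> elts \<beta> \<union> elts \<sigma>"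
  unfolding L.simps[of "osucc \<beta>"] by simp

lemma L_lim:
  assumes "t \<in> L \<alpha>" "limit_ord \<alpha>" "cf \<alpha> \<notin> elts \<chi>" "\<alpha> \<in> elts \<kappa>"
  obtains C \<gamma> where "C \<in> CC \<alpha>" "\<gamma> \<in> fdom C" "\<And>\<beta>. \<beta> \<in> fdom C \<Longrightarrow> \<gamma> \<in> elts \<beta> \<Longrightarrow> step C t \<beta>"
proof -
  have "\<exists>C\<in>CC \<alpha>. \<exists>\<gamma>\<in>fdom C. \<forall>\<beta>\<in>fdom C \<inter> elts \<alpha>. \<gamma> \<in> elts \<beta> \<longrightarrow> step C t \<beta>"
    using assms(1-3) unfolding L.simps[of \<alpha>] step_def by blast
  then obtain C \<gamma> where C: "C \<in> CC \<alpha>" "\<gamma> \<in> fdom C"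
    "\<And>\<beta>. \<beta> \<in> fdom C \<inter> elts \<alpha> \<Longrightarrow> \<gamma> \<in> elts \<beta> \<Longrightarrow> step C t \<beta>" by blast
  then show ?thesis using that ladder_subset[OF assms(4,2) C(1)] by blast
qed

lemma L_limI:
  assumes "t \<in> funs \<alpha> (Hset \<kappa>)" "\<And>\<beta>. \<beta> \<in> elts \<alpha> \<Longrightarrow> rs t \<beta> \<in> L \<beta>" "limit_ord \<alpha>" "Ord \<alpha>"
    and "cf \<alpha> \<notin> elts \<chi> \<Longrightarrow> \<exists>C\<in>CC \<alpha>. \<exists>\<gamma>\<in>fdom C. \<forall>\<beta>\<in>fdom C. \<gamma> \<in> elts \<beta> \<longrightarrow> step C t \<beta>"
  shows "t \<in> L \<alpha>"
proof -
  have "\<forall>\<beta>. \<alpha> \<noteq> osucc \<beta>" using lim_not_osucc assms by blast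
  moreover have "\<exists>C\<in>CC \<alpha>. \<exists>\<gamma>\<in>fdom C. \<forall>\<beta>\<in>fdom C \<inter> elts \<alpha>. \<gamma> \<in> elts \<beta> \<longrightarrow> step C t \<beta>"
    if "cf \<alpha> \<notin> elts \<chi>"
    using assms(5)[OF that] by blast
  ultimately show ?thesis
    using assms(1,2) unfolding L.simps[of \<alpha>] step_def by blast
qed

lemma L_osuccI:
  assumes "t \<in> L \<alpha>" "i \<in> elts omega \<union> elts \<alpha> \<union> elts \<sigma>" "\<alpha> \<in> elts \<kappa>"
  shows "append1 t i \<in> L (osucc \<alpha>)"
proof -
  have i: "i \<in> Hset \<kappa>"
    using assms(2) Ord_Hset below_trans[OF assms(3)] below_trans[OF sigma_less] finite_Ord_below
    unfolding elts_omega by blast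
  note a = append1_props[OF L_funs[OF assms(1)] i]
  have "rs (append1 t i) \<beta> \<in> L \<beta>" if "\<beta> \<in> elts (osucc \<alpha>)" for \<beta>
  proof (cases "\<beta> = \<alpha>")
    case True
    then show ?thesis using a(3) assms(1) by simp
  next
    case False
    then have b: "\<beta> \<in> elts \<alpha>" using that elts_osucc by simp
    then have "rs (rs (append1 t i) \<alpha>) \<beta> = rs (append1 t i) \<beta>"
      using Ord_below[OF assms(3)] Ord_elts_subset rs_rs by blast
    then show ?thesis using a(3) L_rs[OF assms(1) b] by simp
  qed
  moreover have "\<not> limit_ord (osucc \<alpha>)" using lim_not_osucc Ord_osucc Ord_below assms(3) by blast
  moreover have "fapp (append1 t i) \<beta> \<in> elts omega \<union> elts \<beta> \<union> elts \<sigma>" if "osucc \<alpha> = osucc \<beta>" for \<beta>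
    using that osucc_inject a(4) assms(2) by simp
  ultimately show ?thesis using a(2) unfolding L.simps[of "osucc \<alpha>"] by blast
qed

lemma L_zero: "L ozero = {ozero}"
proof (intro equalityI subsetI)
  fix t assume "t \<in> L ozero"
  then have "is_fun t" "fdom t = {}" using L_funs funsD by fastforce+
  then have "elts t = {}" using fun_elts_eq[of t] by simp
  then show "t \<in> {ozero}" using elts_ext[of t ozero] by simp
next
  fix t :: "'k hset" assume "t \<in> {ozero}"
  moreover have "ozero \<in> funs ozero (Hset \<kappa>)" unfolding funs_def is_fun_def fdom_def fran_def by simp
  moreover have "ozero \<noteq> osucc (\<beta> :: 'k hset)" for \<beta> using elts_osucc[of \<beta>] by (metis elts_ozero insert_not_empty)
  moreover have "\<not> limit_ord (ozero :: 'k hset)" unfolding limit_ord_def by simp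
  ultimately show "t \<in> L ozero" unfolding L.simps[of ozero] by simp
qed

section \<open>Branches along a ladder: uniqueness and coherence\<close>

lemma step_rs:
  assumes "\<alpha> \<in> elts \<kappa>" "limit_ord \<alpha>" "C \<in> CC \<alpha>" "\<beta> \<in> fdom C" "elts \<beta> \<subseteq> elts \<delta>"
  shows "step C (rs t \<delta>) \<beta> \<longleftrightarrow> step C t \<beta>"
proof -
  have "elts (osup (fdom C \<inter> elts \<beta>)) \<subseteq> elts \<beta>"
    using ladder_osup_subset[OF assms(1-3)] ladder_Ord[OF assms(1-4)] by blast
  then show ?thesis unfolding step_def using rs_rs assms(5) by (metis order_trans)
qed

text \<open>Each step computes the node at \<beta> from the node at the supremum of the earlier
  points, which is the union of the nodes already compared. The bound \<epsilon> makes this usable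
  for partial branches.\<close>

lemma steps_unique:
  assumes \<alpha>: "\<alpha> \<in> elts \<kappa>" "limit_ord \<alpha>" "C \<in> CC \<alpha>"
    and \<gamma>: "\<gamma> \<in> fdom C" and eq: "rs s \<gamma> = rs t \<gamma>"
    and st: "\<And>\<beta>. \<beta> \<in> fdom C \<Longrightarrow> \<gamma> \<in> elts \<beta> \<Longrightarrow> elts \<beta> \<subseteq> elts \<epsilon> \<Longrightarrow> step C s \<beta> \<and> step C t \<beta>"
  shows "\<beta> \<in> fdom C \<Longrightarrow> elts \<beta> \<subseteq> elts \<epsilon> \<Longrightarrow> rs s \<beta> = rs t \<beta>"
proof (induction \<beta> rule: mem_induct)
  case (less \<beta>)
  note ob = ladder_Ord[OF \<alpha> less.prems(1)] and og = ladder_Ord[OF \<alpha> \<gamma>]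
  show ?case
  proof (cases "\<gamma> \<in> elts \<beta>")
    case False
    then have "elts \<beta> \<subseteq> elts \<gamma>" using Ord_not_mem_iff[OF og ob] by blast
    then show ?thesis using eq rs_rs by metis
  next
    case True
    let ?d = "osup (fdom C \<inter> elts \<beta>)"
    have "rs s x = rs t x" if "x \<in> fdom C \<inter> elts \<beta>" for x
      using less.IH[of x] that less.prems(2) Ord_elts_subset[OF ob] by blast
    then have "rs s ?d = rs t ?d"
      using rs_UN[OF ladder_osup[OF \<alpha>], of s \<beta>] rs_UN[OF ladder_osup[OF \<alpha>], of t \<beta>]
      by (intro elts_ext) simp
    then show ?thesis using st[OF less.prems(1) True less.prems(2)] unfolding step_def by simp
  qed
qed

lemma sq_star_tail:
  assumes \<delta>: "frestrict D (fdom D - elts \<delta>) = frestrict C (fdom C \<inter> (elts \<epsilon> - elts \<delta>))"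
    and D: "is_fun D" "fdom D \<subseteq> elts \<epsilon>" and C: "is_fun (C :: 'k hset)" and \<beta>: "\<beta> \<in> elts \<epsilon>" "\<beta> \<notin> elts \<delta>"
  shows "\<beta> \<in> fdom D \<longleftrightarrow> \<beta> \<in> fdom C" "\<beta> \<in> fdom D \<Longrightarrow> fapp D \<beta> = fapp C \<beta>"
proof -
  have *: "opair \<beta> b \<in> elts D \<longleftrightarrow> opair \<beta> b \<in> elts C" for b
  proof -
    have "opair \<beta> b \<in> elts D \<longleftrightarrow> opair \<beta> b \<in> elts (frestrict D (fdom D - elts \<delta>))"
      using \<beta> by (auto simp: elts_frestrict fdom_def)
    also have "\<dots> \<longleftrightarrow> opair \<beta> b \<in> elts C"
      unfolding \<delta> using \<beta> by (auto simp: elts_frestrict fdom_def)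
    finally show ?thesis .
  qed
  then show "\<beta> \<in> fdom D \<longleftrightarrow> \<beta> \<in> fdom C" unfolding fdom_def by simp
  show "fapp D \<beta> = fapp C \<beta>" unfolding fapp_def * ..
qed

text \<open>The locality of the rule. At \<alpha> the ladder C is its own witness. At an
  accumulation point of cofinality at least \<chi> the coherence gives a ladder D that agrees with C
  on a tail, so steps along C are steps along D; at smaller cofinality there is nothing to
  obey.\<close>

lemma L_limit_of_ladder:
  assumes \<alpha>: "\<alpha> \<in> elts \<kappa>" "limit_ord \<alpha>" "C \<in> CC \<alpha>"
    and \<epsilon>: "\<epsilon> \<in> acc (fdom C) \<or> \<epsilon> = \<alpha>" and \<gamma>: "\<gamma> \<in> fdom C" "\<gamma> \<in> elts \<epsilon>"
    and u: "u \<in> funs \<epsilon> (Hset \<kappa>)" "\<And>\<beta>. \<beta> \<in> elts \<epsilon> \<Longrightarrow> rs u \<beta> \<in> L \<beta>"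
    and st: "\<And>\<beta>. \<beta> \<in> fdom C \<Longrightarrow> \<beta> \<in> elts \<epsilon> \<Longrightarrow> \<gamma> \<in> elts \<beta> \<Longrightarrow> step C u \<beta>"
  shows "u \<in> L \<epsilon>"
proof (cases "\<epsilon> = \<alpha>")
  case True
  show ?thesis
    by (rule L_limI[OF u]) (use True \<alpha> Ord_below \<gamma>(1) st ladder_subset[OF \<alpha>] in blast)+
next
  case False
  then have acc: "\<epsilon> \<in> fdom C" "osup (fdom C \<inter> elts \<epsilon>) = \<epsilon>" "\<epsilon> \<noteq> ozero" and acc': "\<epsilon> \<in> acc (fdom C)"
    using \<epsilon> unfolding acc_def by auto
  have ek: "\<epsilon> \<in> elts \<kappa>" and oe: "Ord \<epsilon>" using ladder_below[OF \<alpha> acc(1)] Ord_below by auto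
  have "(\<Union>x\<in>elts \<epsilon>. elts x) = elts \<epsilon>"
  proof (intro equalityI subsetI)
    fix x assume "x \<in> elts \<epsilon>"
    then have "x \<in> (\<Union>y\<in>fdom C \<inter> elts \<epsilon>. elts y)" using ladder_osup[OF \<alpha>, of \<epsilon>] acc(2) by simp
    then show "x \<in> (\<Union>x\<in>elts \<epsilon>. elts x)" by blast
  qed (use Ord_elts_subset[OF oe] in blast)
  then have le: "limit_ord \<epsilon>" unfolding limit_ord_def using acc(3) by blast
  show ?thesis
  proof (rule L_limI[OF u le oe])
    assume cf: "cf \<epsilon> \<notin> elts \<chi>"
    obtain D where D: "D \<in> CC \<epsilon>" "chi_sq_star \<chi> D C"
      using CC \<alpha> lim_iff_acc acc' by meson
    note Dl = ek le D(1)
    obtain \<delta> where d: "\<delta> \<in> elts \<epsilon>"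
      "frestrict D (fdom D - elts \<delta>) = frestrict C (fdom C \<inter> (elts \<epsilon> - elts \<delta>))"
      using D(2) cf ladder_F(2)[OF Dl] unfolding chi_sq_star_def sq_star_def by auto
    note tail = sq_star_tail[OF d(2) ladder_fun[OF Dl] ladder_subset[OF Dl] ladder_fun[OF \<alpha>]]
    have od: "Ord \<delta>" and og: "Ord \<gamma>" using d(1) \<gamma>(2) Ord_in_Ord[OF oe] by auto
    obtain \<gamma>1 where g1: "\<gamma>1 \<in> fdom D" "\<gamma> \<in> elts \<gamma>1" using ladder_unbounded[OF Dl \<gamma>(2)] by blast
    obtain \<gamma>2 where g2: "\<gamma>2 \<in> fdom D" "\<delta> \<in> elts \<gamma>2" using ladder_unbounded[OF Dl d(1)] by blast
    obtain g where g: "g \<in> fdom D" "\<gamma> \<in> elts g" "\<delta> \<in> elts g"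
    proof (cases "\<gamma>1 \<in> elts \<gamma>2")
      case True
      then show ?thesis using that[OF g2(1) _ g2(2)] Ord_trans[OF ladder_Ord[OF Dl g2(1)] True g1(2)] by blast
    next
      case False
      then have "elts \<gamma>2 \<subseteq> elts \<gamma>1"
        using Ord_not_mem_iff[OF ladder_Ord[OF Dl g1(1)] ladder_Ord[OF Dl g2(1)]] by blast
      then show ?thesis using that[OF g1] g2(2) by blast
    qed
    have gO: "Ord g" "g \<in> elts \<epsilon>" using ladder_Ord[OF Dl] ladder_subset[OF Dl] g(1) by auto
    have above: "x \<notin> elts \<delta>" if "g \<in> elts x \<or> x = g" "Ord x" for x
      using that g(3) Ord_trans[OF that(2), of g \<delta>] mem_asym by blast
    \<comment> \<open>A point common to C and D is needed as a threshold: the ladders may differ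
      below \<open>g\<close>, but all their points there are dominated by \<open>g\<close> itself,
      so the suprema taken below any later \<beta> coincide.\<close>
    have gC: "g \<in> fdom C" using tail(1)[OF gO(2) above] gO(1) g(1) by blast
    have "step D u \<beta>" if b: "\<beta> \<in> fdom D" "g \<in> elts \<beta>" for \<beta>
    proof -
      have bO: "Ord \<beta>" "\<beta> \<in> elts \<epsilon>" using ladder_Ord[OF Dl] ladder_subset[OF Dl] b(1) by auto
      have nb: "\<beta> \<notin> elts \<delta>" using above b(2) bO(1) by blast
      have bC: "\<beta> \<in> fdom C" "fapp D \<beta> = fapp C \<beta>" using tail[OF bO(2) nb] b(1) by auto
      have sw: "x \<in> elts g \<or> (x \<in> fdom D \<longleftrightarrow> x \<in> fdom C)" if "x \<in> elts \<beta>" for x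
      proof -
        have "Ord x" "x \<in> elts \<epsilon>" using that bO Ord_in_Ord Ord_trans[OF oe] by blast+
        then show ?thesis using Ord_linear[OF _ gO(1)] above[of x] tail(1)[of x] by blast
      qed
      have "(\<Union>x\<in>fdom C \<inter> elts \<beta>. elts x) = (\<Union>x\<in>fdom D \<inter> elts \<beta>. elts x)"
      proof -
        have "\<exists>y\<in>fdom D \<inter> elts \<beta>. elts x \<subseteq> elts y" if "x \<in> fdom C \<inter> elts \<beta>" for x
          using sw[of x] that g(1) b(2) Ord_elts_subset[OF gO(1)] by blast
        moreover have "\<exists>y\<in>fdom C \<inter> elts \<beta>. elts x \<subseteq> elts y" if "x \<in> fdom D \<inter> elts \<beta>" for x
          using sw[of x] that gC b(2) Ord_elts_subset[OF gO(1)] by blast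
        ultimately show ?thesis by blast
      qed
      then have "osup (fdom C \<inter> elts \<beta>) = osup (fdom D \<inter> elts \<beta>)"
        unfolding osup_def by simp
      moreover have "step C u \<beta>"
        using st[OF bC(1) bO(2)] Ord_trans[OF bO(1) b(2) g(2)] by blast
      ultimately show ?thesis unfolding step_def using bC(2) by simp
    qed
    then show "\<exists>C\<in>CC \<epsilon>. \<exists>\<gamma>\<in>fdom C. \<forall>\<beta>\<in>fdom C. \<gamma> \<in> elts \<beta> \<longrightarrow> step C u \<beta>"
      using D(1) g(1) by blast
  qed
qed

text \<open>The induction runs over the points of \<partial>C and finally \<alpha>, and its claim
  records obedience at all points passed after \<gamma>. Normality below \<alpha> is what allows a
  move to the next point; coherence is what allows passing a limit.\<close>

lemma ladder_branch:
  assumes \<alpha>: "\<alpha> \<in> elts \<kappa>" "limit_ord \<alpha>" "C \<in> CC \<alpha>"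
    and norm: "\<And>\<beta> \<delta> x. \<beta> \<in> elts \<alpha> \<Longrightarrow> \<delta> \<in> elts \<beta> \<Longrightarrow> x \<in> L \<delta> \<Longrightarrow> \<exists>y\<in>L \<beta>. elts x \<subseteq> elts y"
    and \<gamma>: "\<gamma> \<in> fdom C" and x: "x \<in> L \<gamma>"
  shows "\<exists>t\<in>L \<alpha>. rs t \<gamma> = x"
proof -
  have og: "Ord \<gamma>" by (rule ladder_Ord[OF \<alpha> \<gamma>])
  have "\<exists>t\<in>L \<epsilon>. rs t \<gamma> = x \<and> (\<forall>\<beta>\<in>fdom C. \<gamma> \<in> elts \<beta> \<longrightarrow> elts \<beta> \<subseteq> elts \<epsilon> \<longrightarrow> step C t \<beta>)"
    if "\<epsilon> \<in> fdom C \<or> \<epsilon> = \<alpha>" "elts \<gamma> \<subseteq> elts \<epsilon>" for \<epsilon>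
    using that
  proof (induction \<epsilon> rule: mem_induct)
    case (less \<epsilon>)
    have oe: "Ord \<epsilon>" using less.prems(1) ladder_Ord[OF \<alpha>] Ord_below[OF \<alpha>(1)] by blast
    have ea: "\<epsilon> \<in> elts \<alpha> \<or> \<epsilon> = \<alpha>" using less.prems(1) ladder_subset[OF \<alpha>] by blast
    show ?case
    proof (cases "\<gamma> = \<epsilon>")
      \<comment> \<open>At the starting point nothing has to be obeyed, since the rule concerns
        points strictly above \<gamma>; this is why an arbitrary node can be the start.\<close>
      case True
      have "\<not> elts \<beta> \<subseteq> elts \<epsilon>" if "\<gamma> \<in> elts \<beta>" for \<beta> using that True mem_irrefl by blast
      then show ?thesis using x L_self[OF x] True by blast
    next
      case False
      then have ge: "\<gamma> \<in> elts \<epsilon>" using Ord_subset_iff[OF og oe] less.prems(2) by blast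
      define X where "X = {\<beta> \<in> fdom C \<inter> elts \<epsilon>. elts \<gamma> \<subseteq> elts \<beta>}"
      let ?d = "osup (fdom C \<inter> elts \<epsilon>)"
      have gX: "\<gamma> \<in> X" unfolding X_def using \<gamma> ge by blast
      have XO: "Ord \<beta>" "\<beta> \<in> fdom C" "\<beta> \<in> elts \<epsilon>" "elts \<gamma> \<subseteq> elts \<beta>" if "\<beta> \<in> X" for \<beta>
        using that ladder_Ord[OF \<alpha>] unfolding X_def by auto
      have "\<forall>\<beta>\<in>X. \<exists>t. t \<in> L \<beta> \<and> rs t \<gamma> = x \<and>
          (\<forall>\<beta>'\<in>fdom C. \<gamma> \<in> elts \<beta>' \<longrightarrow> elts \<beta>' \<subseteq> elts \<beta> \<longrightarrow> step C t \<beta>')"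
        using less.IH XO by blast
      from bchoice[OF this] obtain s where s0: "\<forall>\<beta>\<in>X. s \<beta> \<in> L \<beta> \<and> rs (s \<beta>) \<gamma> = x \<and>
          (\<forall>\<beta>'\<in>fdom C. \<gamma> \<in> elts \<beta>' \<longrightarrow> elts \<beta>' \<subseteq> elts \<beta> \<longrightarrow> step C (s \<beta>) \<beta>')" by (elim exE)
      have s: "\<And>\<beta>. \<beta> \<in> X \<Longrightarrow> s \<beta> \<in> L \<beta>" "\<And>\<beta>. \<beta> \<in> X \<Longrightarrow> rs (s \<beta>) \<gamma> = x"
        and sst: "\<And>\<beta> \<beta>'. \<beta> \<in> X \<Longrightarrow> \<beta>' \<in> fdom C \<Longrightarrow> \<gamma> \<in> elts \<beta>' \<Longrightarrow> elts \<beta>' \<subseteq> elts \<beta> \<Longrightarrow> step C (s \<beta>) \<beta>'"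
        using s0 by simp_all
      \<comment> \<open>The nodes \<open>s \<beta>\<close> were chosen independently. They agree
        nevertheless, because obeying C from the same start leaves no freedom.\<close>
      have coh: "s b = rs (s c) b" if bc: "b \<in> X" "c \<in> X" "elts b \<subseteq> elts c" for b c
      proof -
        have "rs (s c) b = rs (s b) b"
        proof (rule steps_unique[OF \<alpha> \<gamma>, where \<epsilon> = b])
          show "rs (s c) \<gamma> = rs (s b) \<gamma>" using s(2) bc by simp
          show "step C (s c) \<beta> \<and> step C (s b) \<beta>"
            if "\<beta> \<in> fdom C" "\<gamma> \<in> elts \<beta>" "elts \<beta> \<subseteq> elts b" for \<beta>
            using sst that bc by (meson order_trans)
          show "b \<in> fdom C" "elts b \<subseteq> elts b" using XO(2) bc by auto
        qed
        then show ?thesis using L_self[OF s(1)[OF bc(1)]] by simp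
      qed
      have chain: "elts (s b) \<subseteq> elts (s c) \<or> elts (s c) \<subseteq> elts (s b)" if bc: "b \<in> X" "c \<in> X" for b c
      proof -
        have "elts b \<subseteq> elts c \<or> elts c \<subseteq> elts b"
          using Ord_linear[OF XO(1)[OF bc(1)] XO(1)[OF bc(2)]] Ord_elts_subset XO(1) bc by blast
        then show ?thesis using coh[OF bc] coh[OF bc(2,1)] rs_subset by metis
      qed
      have small: "|X| \<le>o |UNIV :: 'k set|" by (rule small_subset[of _ \<epsilon>]) (auto simp: X_def)
      have dX: "elts ?d = (\<Union>\<beta>\<in>X. elts \<beta>)"
      proof -
        have "\<exists>b\<in>X. elts \<beta> \<subseteq> elts b" if "\<beta> \<in> fdom C \<inter> elts \<epsilon>" for \<beta>
        proof (cases "elts \<gamma> \<subseteq> elts \<beta>")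
          case True
          then show ?thesis using that unfolding X_def by blast
        next
          case False
          then have "\<beta> \<in> elts \<gamma>" using Ord_not_mem_iff[OF _ og] ladder_Ord[OF \<alpha>] that by blast
          then show ?thesis using gX Ord_elts_subset[OF og] by blast
        qed
        then show ?thesis unfolding ladder_osup[OF \<alpha>] using X_def by blast
      qed
      define U where "U = vset (\<Union>\<beta>\<in>X. elts (s \<beta>))"
      have U: "U \<in> funs ?d (Hset \<kappa>)"
        unfolding U_def by (rule union_funs(2)[OF small L_funs[OF s(1)] chain dX])
      have Us: "rs U \<beta> = s \<beta>" if "\<beta> \<in> X" for \<beta>
        unfolding U_def by (rule union_funs(3)[OF small L_funs[OF s(1)] chain dX that])
      have Ux: "rs U \<gamma> = x" using Us[OF gX] s(2)[OF gX] L_self[OF s(1)[OF gX]] by simp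
      have Ust: "step C U \<beta>" if "\<beta> \<in> X" "\<gamma> \<in> elts \<beta>" for \<beta>
      proof -
        have "step C (rs U \<beta>) \<beta>" using Us sst that XO(2) by simp
        then show ?thesis using step_rs[OF \<alpha> XO(2)[OF that(1)]] by blast
      qed
      have inX: "\<beta> \<in> X" if "\<beta> \<in> fdom C" "\<gamma> \<in> elts \<beta>" "\<beta> \<in> elts \<epsilon>" for \<beta>
        using that ladder_Ord[OF \<alpha>] Ord_elts_subset unfolding X_def by blast
      have ne: "fdom C \<inter> elts \<epsilon> \<noteq> {}" using \<gamma> ge by blast
      have cases: "\<beta> \<in> X \<or> \<beta> = \<epsilon>" if "\<beta> \<in> fdom C" "\<gamma> \<in> elts \<beta>" "elts \<beta> \<subseteq> elts \<epsilon>" for \<beta>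
        using that inX Ord_subset_iff[OF ladder_Ord[OF \<alpha>] oe] by blast
      show ?thesis
      proof (cases "?d = \<epsilon>")
        case True
        have U': "U \<in> funs \<epsilon> (Hset \<kappa>)" using U True by simp
        have UL: "U \<in> L \<epsilon>"
        proof (rule L_limit_of_ladder[OF \<alpha> _ \<gamma> ge U'])
          show "\<epsilon> \<in> acc (fdom C) \<or> \<epsilon> = \<alpha>"
            using less.prems(1) True ge unfolding acc_def by auto
          fix \<beta> assume "\<beta> \<in> elts \<epsilon>"
          then have "\<beta> \<in> (\<Union>b\<in>X. elts b)" using True dX by simp
          then obtain b where b: "b \<in> X" "\<beta> \<in> elts b" by blast
          then have "rs (s b) \<beta> = rs U \<beta>"
            using Us[OF b(1)] rs_rs[of \<beta> b U] Ord_elts_subset[OF XO(1)] by simp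
          then show "rs U \<beta> \<in> L \<beta>" using L_rs[OF s(1)[OF b(1)] b(2)] by simp
        qed (use Ust inX in blast)
        \<comment> \<open>The extension contains U and has the same domain, so it is U for every
          guess c; the rule at \<epsilon> holds for free.\<close>
        have "extension (L \<epsilon>) U c = U" for c
        proof -
          have e: "extension (L \<epsilon>) U c \<in> L \<epsilon>" "elts U \<subseteq> elts (extension (L \<epsilon>) U c)"
            using extension_extends[of "L \<epsilon>" U c] UL by blast+
          then show ?thesis using subset_rs(1)[OF U' L_funs[OF e(1)]] L_self by simp
        qed
        then have "step C U \<epsilon>" unfolding step_def using True L_self[OF UL] by simp
        then show ?thesis using UL Ux Ust cases by blast
      next
        case False
        then have d: "?d \<in> fdom C" "?d \<in> elts \<epsilon>" using ladder_osup_cases[OF \<alpha> ea ne] by auto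
        have "elts \<gamma> \<subseteq> elts ?d" using dX gX by blast
        then have dX': "?d \<in> X" unfolding X_def using d by blast
        have UL: "U \<in> L ?d" using Us[OF dX'] s(1)[OF dX'] rs_self[OF U] by simp
        \<comment> \<open>\<partial>C is unbounded in \<alpha>, so only a point of \<partial>C with
          a predecessor in \<partial>C remains, and there the rule itself dictates the next
          node.\<close>
        have "\<epsilon> \<noteq> \<alpha>"
        proof
          assume e: "\<epsilon> = \<alpha>"
          then have "fdom C \<inter> elts \<epsilon> = fdom C" using ladder_subset[OF \<alpha>] by blast
          then have "elts ?d = elts \<alpha>" using ladder_osup[OF \<alpha>, of \<epsilon>] ladder_sup[OF \<alpha>] by simp
          then show False using d(2) e mem_irrefl by blast
        qed
        then have eC: "\<epsilon> \<in> fdom C" "\<epsilon> \<in> elts \<alpha>" using less.prems(1) ea by auto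
        define t where "t = extension (L \<epsilon>) U (fapp C \<epsilon>)"
        have t: "t \<in> L \<epsilon>" "elts U \<subseteq> elts t"
          unfolding t_def using extension_extends norm[OF eC(2) d(2) UL] by blast+
        have Ut: "U = rs t ?d" by (rule subset_rs(1)[OF U L_funs[OF t(1)] t(2)])
        have "rs t \<gamma> = x" using Ux Ut rs_rs[of \<gamma> ?d t] \<open>elts \<gamma> \<subseteq> elts ?d\<close> by simp
        moreover have "step C t \<epsilon>"
          unfolding step_def L_self[OF t(1)] Ut[symmetric] by (rule t_def)
        moreover have "step C t \<beta>" if "\<beta> \<in> X" "\<gamma> \<in> elts \<beta>" for \<beta>
        proof -
          have "elts \<beta> \<subseteq> elts ?d" using dX that(1) by blast
          then show ?thesis using step_rs[OF \<alpha> XO(2)[OF that(1)], of ?d t] Ust[OF that] Ut by simp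
        qed
        ultimately show ?thesis using t(1) cases by blast
      qed
    qed
  qed
  then show ?thesis using Ord_elts_subset[OF Ord_below[OF \<alpha>(1)]] ladder_subset[OF \<alpha>] \<gamma> by blast
qed

section \<open>Normality and size of the levels\<close>

lemma L_normal: "\<alpha> \<in> elts \<kappa> \<Longrightarrow> \<beta> \<in> elts \<alpha> \<Longrightarrow> x \<in> L \<beta> \<Longrightarrow> \<exists>y\<in>L \<alpha>. elts x \<subseteq> elts y"
proof (induction \<alpha> arbitrary: \<beta> x rule: mem_induct)
  case (less \<alpha>)
  note oa = Ord_below[OF less.prems(1)]
  have IH: "\<exists>y\<in>L \<delta>. elts z \<subseteq> elts y" if "\<delta> \<in> elts \<alpha>" "\<epsilon> \<in> elts \<delta>" "z \<in> L \<epsilon>" for \<delta> \<epsilon> z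
    using less.IH[OF that(1) _ that(2,3)] below_trans[OF less.prems(1) that(1)] by blast
  from oa show ?case
  proof (cases rule: Ord_cases)
    case 1
    then show ?thesis using less.prems(2) by simp
  next
    case (2 \<delta>)
    have dk: "\<delta> \<in> elts \<kappa>" using below_trans less.prems(1) 2(1) by blast
    have "\<exists>y\<in>L \<delta>. elts x \<subseteq> elts y"
    proof (cases "\<beta> = \<delta>")
      case False
      then have "\<beta> \<in> elts \<delta>" using less.prems(2) 2(2) elts_osucc by simp
      then show ?thesis using IH 2(1) less.prems(3) by blast
    qed (use less.prems(3) in blast)
    then obtain y where y: "y \<in> L \<delta>" "elts x \<subseteq> elts y" by blast
    have z: "ozero \<in> elts (omega :: 'k hset)" unfolding elts_omega by (simp add: Ord_ozero)
    then have a: "append1 y ozero \<in> L \<alpha>" using L_osuccI[OF y(1) _ dk] 2(2) by blast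
    have "elts y \<subseteq> elts (append1 y ozero)"
      using elts_append1[OF L_funs[OF y(1)] Ord_Hset[OF ozero_below]] by blast
    then show ?thesis using a y(2) by blast
  next
    case 3
    \<comment> \<open>Any ladder serves: the node first climbs to some point \<gamma> of it by the
      induction hypothesis, and the branch from there obeys the rule of C.\<close>
    obtain C where C: "C \<in> CC \<alpha>" using CC lim_iff_acc 3 less.prems(1) by blast
    note l = less.prems(1) 3 C
    obtain \<gamma> where g: "\<gamma> \<in> fdom C" "\<beta> \<in> elts \<gamma>" using ladder_unbounded[OF l less.prems(2)] by blast
    have "\<gamma> \<in> elts \<alpha>" using ladder_subset[OF l] g(1) by blast
    then obtain y where y: "y \<in> L \<gamma>" "elts x \<subseteq> elts y" using IH g(2) less.prems(3) by blast
    have "\<exists>t\<in>L \<alpha>. rs t \<gamma> = y" by (rule ladder_branch[OF l _ g(1) y(1)]) (rule IH)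
    then obtain t where "t \<in> L \<alpha>" "rs t \<gamma> = y" by blast
    then show ?thesis using y(2) rs_subset by blast
  qed
qed

lemma L_nonempty: "\<alpha> \<in> elts \<kappa> \<Longrightarrow> L \<alpha> \<noteq> {}"
  using L_normal[of \<alpha> ozero ozero] L_zero ozero_mem[OF Ord_below] by blast

text \<open>A node is determined by its restrictions along a cofinal sequence of length cf \<alpha>
  < \<chi>. Indexing all lower nodes by an ordinal l < \<kappa> turns this into a function from cf
  \<alpha> to l, and closure of \<kappa> bounds the number of such functions.\<close>

lemma L_card_cofinal:
  assumes \<alpha>: "\<alpha> \<in> elts \<kappa>" "limit_ord \<alpha>" and cf: "cf \<alpha> \<in> elts \<chi>" and W: "|\<Union>\<beta>\<in>elts \<alpha>. L \<beta>| <o |elts \<kappa>|"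
  shows "|L \<alpha>| <o |elts \<kappa>|"
proof -
  note oa = Ord_below[OF \<alpha>(1)]
  obtain l where l: "l \<in> elts \<kappa>" "|\<Union>\<beta>\<in>elts \<alpha>. L \<beta>| \<le>o |elts l|" using card_less_obtain[OF W] by blast
  then obtain g where g: "inj_on g (\<Union>\<beta>\<in>elts \<alpha>. L \<beta>)" "g ` (\<Union>\<beta>\<in>elts \<alpha>. L \<beta>) \<subseteq> elts l"
    using card_of_ordLeq[of "\<Union>\<beta>\<in>elts \<alpha>. L \<beta>" "elts l"] by auto
  obtain f where f: "f ` elts (cf \<alpha>) \<subseteq> elts \<alpha>" "\<forall>\<beta>\<in>elts \<alpha>. \<exists>i\<in>elts (cf \<alpha>). elts \<beta> \<subseteq> elts (f i)"
    using cofinal_length_cf[OF oa] unfolding cofinal_length_def by (elim exE conjE)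
  have cover: "elts \<alpha> = (\<Union>b\<in>f ` elts (cf \<alpha>). elts b)"
  proof (intro equalityI subsetI)
    fix x assume "x \<in> elts \<alpha>"
    then obtain a where a: "a \<in> elts \<alpha>" "x \<in> elts a" using lim_succ_mem[OF \<alpha>(2)] by blast
    then show "x \<in> (\<Union>b\<in>f ` elts (cf \<alpha>). elts b)" using f(2) by blast
  qed (use f(1) Ord_elts_subset[OF oa] in blast)
  define F where "F t = hfun (cf \<alpha>) (\<lambda>i. g (rs t (f i)))" for t
  have W: "rs t (f i) \<in> (\<Union>\<beta>\<in>elts \<alpha>. L \<beta>)" if "t \<in> L \<alpha>" "i \<in> elts (cf \<alpha>)" for t i
    using L_rs[OF that(1)] f(1) that(2) by blast
  have "F ` L \<alpha> \<subseteq> funs_lt \<chi> (elts l)"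
  proof
    fix z assume "z \<in> F ` L \<alpha>"
    then obtain t where t: "t \<in> L \<alpha>" "z = F t" by blast
    have "F t \<in> funs (cf \<alpha>) (elts l)"
      unfolding F_def by (rule hfun_funs) (use W[OF t(1)] g(2) in blast)
    then show "z \<in> funs_lt \<chi> (elts l)" unfolding funs_lt_def using cf t(2) by blast
  qed
  moreover have "inj_on F (L \<alpha>)"
  proof (rule inj_onI)
    fix s t assume s: "s \<in> L \<alpha>" and t: "t \<in> L \<alpha>" and eq: "F s = F t"
    have "rs s b = rs t b" if b: "b \<in> f ` elts (cf \<alpha>)" for b
    proof -
      obtain i where i: "i \<in> elts (cf \<alpha>)" "b = f i" using b by blast
      have "g (rs s (f i)) = g (rs t (f i))" using eq fapp_hfun[OF i(1)] unfolding F_def by metis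
      then show ?thesis using inj_onD[OF g(1) _ W[OF s i(1)] W[OF t i(1)]] i(2) by simp
    qed
    then have "elts (rs s \<alpha>) = elts (rs t \<alpha>)" using rs_UN[OF cover] by simp
    then show "s = t" using L_self[OF s] L_self[OF t] elts_ext by metis
  qed
  ultimately have "|L \<alpha>| \<le>o |funs_lt \<chi> (elts l)|" using card_of_ordLeq[of "L \<alpha>"] by blast
  moreover have "|funs_lt \<chi> (elts l)| <o |elts \<kappa>|" using chi_closed l(1) unfolding lt_closed_def by blast
  ultimately show ?thesis using ordLeq_ordLess_trans by blast
qed

lemma L_card: "\<alpha> \<in> elts \<kappa> \<Longrightarrow> |L \<alpha>| <o |elts \<kappa>|"
proof (induction \<alpha> rule: mem_induct)
  case (less \<alpha>)
  note oa = Ord_below[OF less.prems]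
  have IH: "|L \<beta>| <o |elts \<kappa>|" if "\<beta> \<in> elts \<alpha>" for \<beta>
    using less.IH that below_trans less.prems by blast
  from oa show ?case
  proof (cases rule: Ord_cases)
    case 1
    then show ?thesis by (simp add: L_zero card_finite_less)
  next
    case (2 \<delta>)
    let ?I = "elts omega \<union> elts \<delta> \<union> elts \<sigma>"
    have dk: "\<delta> \<in> elts \<kappa>" using below_trans less.prems 2(1) by blast
    \<comment> \<open>Nodes have infinitely many immediate successors, so this is where \<kappa> has
      to be uncountable.\<close>
    have "|elts (omega :: 'k hset)| <o |elts \<kappa>|"
      by (rule card_countable_less[OF uncountable_kappa countable_omega])
    then have I: "|?I| <o |elts \<kappa>|" using card_less_kappa[OF dk] card_less_kappa[OF sigma_less]
      by (intro card_Un_less)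
    have "L \<alpha> \<subseteq> (\<Union>s\<in>L \<delta>. append1 s ` ?I)"
    proof
      fix t assume t: "t \<in> L \<alpha>"
      have r: "rs t \<delta> \<in> L \<delta>" using L_rs t 2(1) by blast
      have i: "fapp t \<delta> \<in> ?I" using L_osucc t 2(2) by blast
      note a = L_osuccI[OF r i dk]
      have iH: "fapp t \<delta> \<in> Hset \<kappa>"
        using i Ord_Hset below_trans[OF dk] below_trans[OF sigma_less] finite_Ord_below
        unfolding elts_omega by blast
      have "t = append1 (rs t \<delta>) (fapp t \<delta>)"
        using funs_osucc_ext[OF _ L_funs[OF a], of t] L_funs[OF t] 2(2)
          append1_props(3,4)[OF L_funs[OF r] iH] by simp
      then show "t \<in> (\<Union>s\<in>L \<delta>. append1 s ` ?I)" using r i by blast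
    qed
    moreover have "|\<Union>s\<in>L \<delta>. append1 s ` ?I| <o |elts \<kappa>|"
      by (intro card_UN_less card_image_less I IH 2(1))
    ultimately show ?thesis using card_subset_less by blast
  next
    case 3
    have W: "|\<Union>\<beta>\<in>elts \<alpha>. L \<beta>| <o |elts \<kappa>|" by (intro card_UN_less IH card_less_kappa less.prems)
    show ?thesis
    proof (cases "cf \<alpha> \<in> elts \<chi>")
      case True
      then show ?thesis using L_card_cofinal less.prems 3 W by blast
    next
      case False
      \<comment> \<open>At large cofinality a node is found from a ladder, a starting point \<gamma>
        and its restriction to \<gamma>. By uniqueness each set S has at most one element, so the
        level is covered by fewer than \<kappa> finite sets.\<close>
      define S where "S C \<gamma> x = {t \<in> L \<alpha>. rs t \<gamma> = x \<and> (\<forall>\<beta>\<in>fdom C. \<gamma> \<in> elts \<beta> \<longrightarrow> step C t \<beta>)}" for C \<gamma> x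
      have "finite (S C \<gamma> x)" if C: "C \<in> CC \<alpha>" and g: "\<gamma> \<in> fdom C" for C \<gamma> x
      proof -
        note l = less.prems 3 C
        have "s = t" if "s \<in> S C \<gamma> x" "t \<in> S C \<gamma> x" for s t
        proof -
          have st: "s \<in> L \<alpha>" "t \<in> L \<alpha>" using that unfolding S_def by auto
          have "rs s \<beta> = rs t \<beta>" if "\<beta> \<in> fdom C" for \<beta>
          proof (rule steps_unique[OF l g, where \<epsilon> = \<beta>])
            show "rs s \<gamma> = rs t \<gamma>" using \<open>s \<in> S C \<gamma> x\<close> \<open>t \<in> S C \<gamma> x\<close> unfolding S_def by simp
            show "step C s b \<and> step C t b" if "b \<in> fdom C" "\<gamma> \<in> elts b" for b
              using \<open>s \<in> S C \<gamma> x\<close> \<open>t \<in> S C \<gamma> x\<close> that unfolding S_def by blast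
          qed (use that in auto)
          then have "elts (rs s \<alpha>) = elts (rs t \<alpha>)" using rs_UN[OF ladder_sup[OF l, symmetric]] by simp
          then show ?thesis using L_self[OF st(1)] L_self[OF st(2)] elts_ext by metis
        qed
        then have "S C \<gamma> x = {} \<or> (\<exists>s. S C \<gamma> x = {s})" by blast
        then show ?thesis by auto
      qed
      then have "|\<Union>C\<in>CC \<alpha>. \<Union>\<gamma>\<in>fdom C. \<Union>x\<in>L \<gamma>. S C \<gamma> x| <o |elts \<kappa>|"
      proof (intro card_UN_less)
        show "|CC \<alpha>| <o |elts \<kappa>|" using CC lim_iff_acc less.prems 3 by blast
        fix C assume C: "C \<in> CC \<alpha>"
        note l = less.prems 3 C
        show "|fdom C| <o |elts \<kappa>|"
          by (rule card_subset_less[OF card_less_kappa[OF less.prems] ladder_subset[OF l]])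
        fix \<gamma> assume "\<gamma> \<in> fdom C"
        then show "|L \<gamma>| <o |elts \<kappa>|" using IH ladder_subset[OF l] by blast
      qed (rule card_finite_less)
      moreover have "L \<alpha> \<subseteq> (\<Union>C\<in>CC \<alpha>. \<Union>\<gamma>\<in>fdom C. \<Union>x\<in>L \<gamma>. S C \<gamma> x)"
      proof
        fix t assume t: "t \<in> L \<alpha>"
        obtain C \<gamma> where C: "C \<in> CC \<alpha>" "\<gamma> \<in> fdom C" "\<And>\<beta>. \<beta> \<in> fdom C \<Longrightarrow> \<gamma> \<in> elts \<beta> \<Longrightarrow> step C t \<beta>"
          using L_lim[OF t 3 False less.prems] by blast
        have "rs t \<gamma> \<in> L \<gamma>" using L_rs[OF t] ladder_subset[OF less.prems 3 C(1)] C(2) by blast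
        moreover have "t \<in> S C \<gamma> (rs t \<gamma>)" unfolding S_def using t C(3) by blast
        ultimately show "t \<in> (\<Union>C\<in>CC \<alpha>. \<Union>\<gamma>\<in>fdom C. \<Union>x\<in>L \<gamma>. S C \<gamma> x)" using C(1,2) by blast
      qed
      ultimately show ?thesis using card_subset_less by blast
    qed
  qed
qed

section \<open>The tree and its structural properties\<close>

definition T :: "'k hset set" where
  "T = (\<Union>\<alpha>\<in>elts \<kappa>. L \<alpha>)"

lemma TE: assumes "t \<in> T" obtains \<alpha> where "\<alpha> \<in> elts \<kappa>" "t \<in> L \<alpha>"
  using assms unfolding T_def by blast

lemma level_T: "\<alpha> \<in> elts \<kappa> \<Longrightarrow> level \<kappa> T \<alpha> = L \<alpha>"
proof (intro equalityI subsetI)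
  fix t assume "t \<in> level \<kappa> T \<alpha>"
  then obtain \<beta> where "t \<in> L \<beta>" "t \<in> funs \<alpha> (Hset \<kappa>)" unfolding level_def by (auto elim: TE)
  then show "t \<in> L \<alpha>" using funs_unique L_funs by metis
next
  fix t assume "\<alpha> \<in> elts \<kappa>" "t \<in> L \<alpha>"
  then show "t \<in> level \<kappa> T \<alpha>" unfolding level_def T_def using L_funs by blast
qed

lemma T_streamlined: "streamlined \<kappa> T"
  unfolding streamlined_def
proof (intro conjI ballI subsetI)
  fix t assume "t \<in> T"
  then obtain \<alpha> where \<alpha>: "\<alpha> \<in> elts \<kappa>" "t \<in> L \<alpha>" by (rule TE)
  then show "t \<in> funs_lt \<kappa> (Hset \<kappa>)" unfolding funs_lt_def using L_funs by blast
  fix \<beta> assume "\<beta> \<in> fdom t"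
  then have b: "\<beta> \<in> elts \<alpha>" using funsD(2)[OF L_funs[OF \<alpha>(2)]] by simp
  show "rs t \<beta> \<in> T" using L_rs[OF \<alpha>(2) b] below_trans[OF \<alpha>(1) b] unfolding T_def by blast
qed

lemma T_height: "tree_height \<kappa> T = \<kappa>"
  unfolding tree_height_def
proof (rule the_equality)
  have "level \<kappa> T \<kappa> = {}"
  proof (rule ccontr)
    assume "level \<kappa> T \<kappa> \<noteq> {}"
    then obtain t where t: "t \<in> T" "t \<in> funs \<kappa> (Hset \<kappa>)" unfolding level_def by blast
    from t(1) obtain \<alpha> where \<alpha>: "\<alpha> \<in> elts \<kappa>" "t \<in> L \<alpha>" by (rule TE)
    then have "\<alpha> = \<kappa>" using funs_unique[OF L_funs[OF \<alpha>(2)] t(2)] by simp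
    then show False using \<alpha>(1) mem_irrefl by blast
  qed
  then show k: "Ord \<kappa> \<and> level \<kappa> T \<kappa> = {} \<and> (\<forall>\<beta>\<in>elts \<kappa>. level \<kappa> T \<beta> \<noteq> {})"
    using Ord_kappa level_T L_nonempty by simp
  fix \<alpha> assume "Ord \<alpha> \<and> level \<kappa> T \<alpha> = {} \<and> (\<forall>\<beta>\<in>elts \<alpha>. level \<kappa> T \<beta> \<noteq> {})"
  then show "\<alpha> = \<kappa>" using k Ord_linear[of \<alpha> \<kappa>] by blast
qed

lemma tlt_iff:
  assumes "s \<in> L \<alpha>" "t \<in> L \<beta>" "Ord \<alpha>" "Ord \<beta>"
  shows "tlt s t \<longleftrightarrow> \<alpha> \<in> elts \<beta> \<and> s = rs t \<alpha>"
proof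
  assume lt: "tlt s t"
  then have sub: "elts s \<subseteq> elts t" unfolding tlt_def by blast
  note sr = subset_rs[OF L_funs[OF assms(1)] L_funs[OF assms(2)] sub]
  have "\<alpha> \<noteq> \<beta>"
  proof
    assume "\<alpha> = \<beta>"
    then have "s = t" using sr(1) L_self[OF assms(2)] by simp
    then show False using lt unfolding tlt_def by blast
  qed
  then show "\<alpha> \<in> elts \<beta> \<and> s = rs t \<alpha>" using sr Ord_subset_iff[OF assms(3,4)] by blast
next
  assume r: "\<alpha> \<in> elts \<beta> \<and> s = rs t \<alpha>"
  have "s \<noteq> t" using funs_unique[OF L_funs[OF assms(1)], of \<beta>] L_funs[OF assms(2)] r mem_irrefl by metis
  then show "tlt s t" unfolding tlt_def using r rs_subset elts_ext by (metis psubsetI)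
qed

lemma T_normal: "normal_tree \<kappa> T"
  unfolding normal_tree_def
proof (intro ballI impI)
  fix \<beta> \<alpha> s assume b: "\<beta> \<in> elts \<kappa>" and a: "\<alpha> \<in> elts \<beta>" and s: "s \<in> level \<kappa> T \<alpha>"
  have ak: "\<alpha> \<in> elts \<kappa>" using a b below_trans by blast
  have sL: "s \<in> L \<alpha>" using s level_T ak by simp
  obtain t where t: "t \<in> L \<beta>" "elts s \<subseteq> elts t" using L_normal[OF b a sL] by blast
  have "tlt s t"
    using tlt_iff[OF sL t(1)] Ord_below ak b a subset_rs(1)[OF L_funs[OF sL] L_funs[OF t(1)] t(2)] by blast
  then show "\<exists>t\<in>level \<kappa> T \<beta>. tlt s t" using t(1) level_T[OF b] by blast
qed

lemma T_prolific: "prolific \<kappa> T"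
  unfolding prolific_def
proof (intro ballI subsetI)
  fix \<alpha> t x assume a: "\<alpha> \<in> elts \<kappa>" and t: "t \<in> level \<kappa> T \<alpha>"
    and "x \<in> {append1 t i |i. i \<in> elts omega \<union> elts \<alpha>}"
  then obtain i where i: "x = append1 t i" "i \<in> elts omega \<union> elts \<alpha>" by blast
  then have "x \<in> L (osucc \<alpha>)" using L_osuccI[OF _ _ a] t level_T[OF a] by blast
  then show "x \<in> level \<kappa> T (osucc \<alpha>)" using level_T[OF osucc_below[OF a]] by simp
qed

lemma T_splitting: "splitting \<sigma> T"
  unfolding splitting_def
proof
  fix s assume "s \<in> T"
  then obtain \<alpha> where \<alpha>: "\<alpha> \<in> elts \<kappa>" "s \<in> L \<alpha>" by (rule TE)
  note oa = Ord_below[OF \<alpha>(1)]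
  have H: "i \<in> Hset \<kappa>" if "i \<in> elts \<sigma>" for i using that Ord_Hset below_trans sigma_less by blast
  have "append1 s ` elts \<sigma> \<subseteq> imm_succs T s"
  proof
    fix t assume "t \<in> append1 s ` elts \<sigma>"
    then obtain i where i: "i \<in> elts \<sigma>" "t = append1 s i" by blast
    have t: "t \<in> L (osucc \<alpha>)" using L_osuccI[OF \<alpha>(2) _ \<alpha>(1), of i] i by blast
    have tT: "t \<in> T" using t osucc_below[OF \<alpha>(1)] unfolding T_def by blast
    have lt: "tlt s t"
      using tlt_iff[OF \<alpha>(2) t oa Ord_osucc[OF oa]] elts_osucc[of \<alpha>] i(2)
        rs_append1[OF L_funs[OF \<alpha>(2)] H[OF i(1)]] by simp
    have "\<not> (tlt s u \<and> tlt u t)" if u: "u \<in> T" for u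
    proof
      assume lts: "tlt s u \<and> tlt u t"
      from u obtain \<beta> where b: "\<beta> \<in> elts \<kappa>" "u \<in> L \<beta>" by (rule TE)
      have "\<alpha> \<in> elts \<beta>" using tlt_iff[OF \<alpha>(2) b(2) oa Ord_below[OF b(1)]] lts by blast
      moreover have "\<beta> \<in> elts (osucc \<alpha>)"
        using tlt_iff[OF b(2) t Ord_below[OF b(1)] Ord_osucc[OF oa]] lts by blast
      ultimately show False using elts_osucc[of \<alpha>] mem_irrefl mem_asym by auto
    qed
    then show "t \<in> imm_succs T s" unfolding imm_succs_def using tT lt by blast
  qed
  moreover have "inj_on (append1 s) (elts \<sigma>)"
    by (rule inj_onI) (metis H fapp_append1[OF L_funs[OF \<alpha>(2)]])
  ultimately show "|elts \<sigma>| \<le>o |imm_succs T s|" using card_of_ordLeq[of "elts \<sigma>"] by blast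
qed

lemma Ord_chi: "Ord \<chi>"
  using Ord_below chi_less by blast

text \<open>In the limit case the levels of the members map \<delta> cofinally into their supremum
  \<epsilon>, so cf \<epsilon> \<le> \<delta> < \<chi>. At such \<epsilon> the definition of the
  levels continues every branch.\<close>

lemma T_complete: "complete_tree \<chi> T"
  unfolding complete_tree_def
proof (intro ballI allI impI)
  fix \<delta> f assume d: "\<delta> \<in> elts \<chi>" and "f ` elts \<delta> \<subseteq> T \<and> (\<forall>j\<in>elts \<delta>. \<forall>i\<in>elts j. tlt (f i) (f j))"
  then have f: "\<And>i. i \<in> elts \<delta> \<Longrightarrow> f i \<in> T" and inc: "\<And>i j. j \<in> elts \<delta> \<Longrightarrow> i \<in> elts j \<Longrightarrow> tlt (f i) (f j)"
    by auto
  have od: "Ord \<delta>" using Ord_in_Ord[OF Ord_chi d] .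
  let ?u = "vset (\<Union>i\<in>elts \<delta>. elts (f i))"
  from od show "?u \<in> T"
  proof (cases rule: Ord_cases)
    case 1
    \<comment> \<open>The union of the empty sequence is the empty function, which is the root of
      the tree.\<close>
    then have "?u = ozero" by (simp add: ozero_def[symmetric])
    then show ?thesis using L_zero ozero_below unfolding T_def by blast
  next
    case (2 j)
    have "elts (f i) \<subseteq> elts (f j)" if "i \<in> elts \<delta>" for i
      using that inc[OF 2(1), of i] 2(2) elts_osucc[of j] unfolding tlt_def by auto
    then have "(\<Union>i\<in>elts \<delta>. elts (f i)) = elts (f j)" using 2(1) by blast
    then show ?thesis using f[OF 2(1)] by simp
  next
    case 3
    have "\<forall>i\<in>elts \<delta>. \<exists>\<alpha>. \<alpha> \<in> elts \<kappa> \<and> f i \<in> L \<alpha>" using f TE by metis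
    from bchoice[OF this] obtain e where e0: "\<forall>i\<in>elts \<delta>. e i \<in> elts \<kappa> \<and> f i \<in> L (e i)" by (elim exE)
    then have e: "\<And>i. i \<in> elts \<delta> \<Longrightarrow> e i \<in> elts \<kappa>" "\<And>i. i \<in> elts \<delta> \<Longrightarrow> f i \<in> L (e i)" by auto
    have eO: "Ord (e i)" if "i \<in> elts \<delta>" for i using e(1) that Ord_below by blast
    have einc: "e i \<in> elts (e j)" if "j \<in> elts \<delta>" "i \<in> elts j" for i j
      using tlt_iff[of "f i" "e i" "f j" "e j"] inc that e eO Ord_trans[OF od] by blast
    have nxt: "\<exists>j\<in>elts \<delta>. e i \<in> elts (e j)" if "i \<in> elts \<delta>" for i
      using lim_succ_mem[OF 3 that] einc by blast
    have "|e ` elts \<delta>| <o |elts \<kappa>|"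
      by (intro card_image_less card_less_kappa below_trans[OF chi_less d])
    then obtain b where b: "b \<in> elts \<kappa>" "e ` elts \<delta> \<subseteq> elts b"
      using bounded_kappa[of "e ` elts \<delta>"] e(1) by blast
    define \<epsilon> where "\<epsilon> = osup (e ` elts \<delta>)"
    have eps: "elts \<epsilon> = (\<Union>i\<in>elts \<delta>. elts (e i))"
      unfolding \<epsilon>_def using elts_osup[OF b(2)] by simp
    have oe: "Ord \<epsilon>"
    proof (rule OrdI_subset)
      fix x assume "x \<in> elts \<epsilon>"
      then obtain i where i: "i \<in> elts \<delta>" "x \<in> elts (e i)" using eps by blast
      then show "Ord x" using eO Ord_in_Ord by blast
      fix y assume "y \<in> elts x"
      then show "y \<in> elts \<epsilon>" using eps i Ord_trans[OF eO] by blast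
    qed
    have "elts \<epsilon> \<subseteq> elts b" using eps b Ord_elts_subset[OF Ord_below] by blast
    then have ek: "\<epsilon> \<in> elts \<kappa>"
      using Ord_subset_iff[OF oe Ord_below[OF b(1)]] b(1) below_trans by blast
    have mem: "e i \<in> elts \<epsilon>" if "i \<in> elts \<delta>" for i using nxt[OF that] eps by blast
    have le: "limit_ord \<epsilon>"
    proof -
      have "(\<Union>x\<in>elts \<epsilon>. elts x) = elts \<epsilon>"
      proof (intro equalityI subsetI)
        fix x assume "x \<in> elts \<epsilon>"
        then show "x \<in> (\<Union>x\<in>elts \<epsilon>. elts x)" using eps mem by blast
      qed (use Ord_elts_subset[OF oe] in blast)
      moreover have "\<epsilon> \<noteq> ozero" using mem ozero_mem[OF od] 3 unfolding limit_ord_def by fastforce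
      ultimately show ?thesis unfolding limit_ord_def by blast
    qed
    have "cofinal_length \<epsilon> \<delta>"
      unfolding cofinal_length_def
    proof (intro exI[of _ e] conjI ballI)
      show "e ` elts \<delta> \<subseteq> elts \<epsilon>" using mem by blast
      fix \<beta> assume "\<beta> \<in> elts \<epsilon>"
      then obtain i where "i \<in> elts \<delta>" "\<beta> \<in> elts (e i)" using eps by blast
      then show "\<exists>\<gamma>\<in>elts \<delta>. elts \<beta> \<subseteq> elts (e \<gamma>)" using Ord_elts_subset[OF eO] by blast
    qed
    then have "elts (cf \<epsilon>) \<subseteq> elts \<delta>" using cf_le[OF oe od] by blast
    then have cf: "cf \<epsilon> \<in> elts \<chi>"
      using Ord_subset_iff[OF Ord_cf[OF oe] od] d Ord_trans[OF Ord_chi d] by blast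
    have chain: "elts (f i) \<subseteq> elts (f j) \<or> elts (f j) \<subseteq> elts (f i)" if ij: "i \<in> elts \<delta>" "j \<in> elts \<delta>" for i j
      using Ord_linear[of i j] Ord_in_Ord[OF od] ij inc unfolding tlt_def by blast
    have u: "?u \<in> funs \<epsilon> (Hset \<kappa>)"
      by (rule union_funs(2)[OF small_elts L_funs[OF e(2)] chain eps])
    have rs_u: "rs ?u (e i) = f i" if "i \<in> elts \<delta>" for i
      by (rule union_funs(3)[OF small_elts L_funs[OF e(2)] chain eps that])
    have "?u \<in> L \<epsilon>"
    proof (rule L_limI[OF u _ le oe])
      fix \<beta> assume "\<beta> \<in> elts \<epsilon>"
      then obtain i where i: "i \<in> elts \<delta>" "\<beta> \<in> elts (e i)" using eps by blast
      then have "rs ?u \<beta> = rs (f i) \<beta>"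
        using rs_rs[of \<beta> "e i" ?u] rs_u[OF i(1)] Ord_elts_subset[OF eO] by simp
      then show "rs ?u \<beta> \<in> L \<beta>" using L_rs[OF e(2)[OF i(1)] i(2)] by simp
    qed (use cf in blast)
    then show ?thesis using ek unfolding T_def by blast
  qed
qed

text \<open>The successors leaving a branch of size \<open>\<kappa>\<close> form an antichain of size \<open>\<kappa>\<close>.\<close>

lemma chain_to_antichain:
  assumes "tchain T b" obtains S where "antichain T S" "|S| =o |b|"
proof -
  have bT: "b \<subseteq> T" and comp: "\<And>s t. s \<in> b \<Longrightarrow> t \<in> b \<Longrightarrow> s = t \<or> tlt s t \<or> tlt t s"
    using assms unfolding tchain_def by auto
  have om: "ozero \<in> elts (omega :: 'k hset)" "osucc ozero \<in> elts (omega :: 'k hset)"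
    unfolding elts_omega by (simp_all add: Ord_ozero one_omega[unfolded elts_omega, simplified] elts_one Ord_one)
  have omH: "i \<in> Hset \<kappa>" if "i \<in> elts omega" for i
    using that finite_Ord_below Ord_Hset unfolding elts_omega by blast
  have ne: "ozero \<noteq> osucc (ozero :: 'k hset)" using elts_one by (metis elts_ozero insert_not_empty)
  have "\<forall>t\<in>b. \<exists>\<alpha> s. \<alpha> \<in> elts \<kappa> \<and> t \<in> L \<alpha> \<and> s \<in> L (osucc \<alpha>) \<and> rs s \<alpha> = t \<and> (\<forall>u\<in>b. \<not> elts s \<subseteq> elts u)"
  proof
    fix t assume "t \<in> b"
    then obtain \<alpha> where \<alpha>: "\<alpha> \<in> elts \<kappa>" "t \<in> L \<alpha>" using bT TE by blast
    \<comment> \<open>Two members of the chain above the successors with values 0 and 1 would be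
      comparable, and the larger would take both values at \<alpha>. So one of the two successors
      leaves the chain.\<close>
    have ex: "\<exists>i\<in>elts omega. \<forall>u\<in>b. \<not> elts (append1 t i) \<subseteq> elts u"
    proof (rule ccontr)
      assume n: "\<not> ?thesis"
      then obtain u v where uv: "u \<in> b" "elts (append1 t ozero) \<subseteq> elts u"
        "v \<in> b" "elts (append1 t (osucc ozero)) \<subseteq> elts v" using om by blast
      have m: "opair \<alpha> ozero \<in> elts u" "opair \<alpha> (osucc ozero) \<in> elts v"
        using uv elts_append1[OF L_funs[OF \<alpha>(2)] omH] om by auto
      have "elts u \<subseteq> elts v \<or> elts v \<subseteq> elts u" using comp[OF uv(1,3)] unfolding tlt_def by auto
      then obtain w where w: "w \<in> b" "opair \<alpha> ozero \<in> elts w" "opair \<alpha> (osucc ozero) \<in> elts w"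
        using m uv by blast
      obtain \<beta> where "w \<in> L \<beta>" using w(1) bT TE by blast
      then have "is_fun w" using funsD(1) L_funs by blast
      then show False using w(2,3) ne unfolding is_fun_def by blast
    qed
    then obtain i where i: "i \<in> elts omega" "\<forall>u\<in>b. \<not> elts (append1 t i) \<subseteq> elts u" by blast
    have "append1 t i \<in> L (osucc \<alpha>)" using L_osuccI[OF \<alpha>(2) _ \<alpha>(1)] i(1) by blast
    moreover have "rs (append1 t i) \<alpha> = t" by (rule rs_append1[OF L_funs[OF \<alpha>(2)] omH[OF i(1)]])
    ultimately show "\<exists>\<alpha> s. \<alpha> \<in> elts \<kappa> \<and> t \<in> L \<alpha> \<and> s \<in> L (osucc \<alpha>) \<and> rs s \<alpha> = t \<and> (\<forall>u\<in>b. \<not> elts s \<subseteq> elts u)"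
      using \<alpha> i(2) by blast
  qed
  from bchoice[OF this] obtain d where
    "\<forall>t\<in>b. \<exists>s. d t \<in> elts \<kappa> \<and> t \<in> L (d t) \<and> s \<in> L (osucc (d t)) \<and> rs s (d t) = t \<and> (\<forall>u\<in>b. \<not> elts s \<subseteq> elts u)"
    by (elim exE)
  from bchoice[OF this] obtain s where s0:
    "\<forall>t\<in>b. d t \<in> elts \<kappa> \<and> t \<in> L (d t) \<and> s t \<in> L (osucc (d t)) \<and> rs (s t) (d t) = t \<and> (\<forall>u\<in>b. \<not> elts (s t) \<subseteq> elts u)"
    by (elim exE)
  then have d: "\<And>t. t \<in> b \<Longrightarrow> d t \<in> elts \<kappa>" "\<And>t. t \<in> b \<Longrightarrow> t \<in> L (d t)"
    and s: "\<And>t. t \<in> b \<Longrightarrow> s t \<in> L (osucc (d t))" "\<And>t. t \<in> b \<Longrightarrow> rs (s t) (d t) = t"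
    and out: "\<And>t u. t \<in> b \<Longrightarrow> u \<in> b \<Longrightarrow> \<not> elts (s t) \<subseteq> elts u"
    by simp_all
  have O: "Ord (d t)" "Ord (osucc (d t))" if "t \<in> b" for t
    using d(1)[OF that] Ord_below Ord_osucc by blast+
  have "antichain T (s ` b)"
    unfolding antichain_def
  proof (intro conjI ballI subsetI)
    fix x assume "x \<in> s ` b"
    then show "x \<in> T" using s(1) osucc_below d(1) unfolding T_def by blast
  next
    fix x y assume "x \<in> s ` b" "y \<in> s ` b"
    then obtain t t' where t: "t \<in> b" "x = s t" "t' \<in> b" "y = s t'" by blast
    show "\<not> tlt x y"
    proof
      assume "tlt x y"
      then have lt: "osucc (d t) \<in> elts (osucc (d t'))" "s t = rs (s t') (osucc (d t))"
        using tlt_iff[OF s(1)[OF t(1)] s(1)[OF t(3)] O(2)[OF t(1)] O(2)[OF t(3)]] t by auto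
      \<comment> \<open>A node strictly below \<open>s t'\<close> is already included in its
        immediate predecessor t', which is in the chain; but \<open>s t\<close> was chosen to leave
        the chain.\<close>
      then have le: "elts (osucc (d t)) \<subseteq> elts (d t')"
        using elts_osucc[of "d t'"] Ord_elts_subset[OF O(1)[OF t(3)]] by auto
      have "s t = rs (rs (s t') (d t')) (osucc (d t))" using lt(2) rs_rs[OF le] by simp
      then have "elts (s t) \<subseteq> elts t'" using s(2)[OF t(3)] rs_subset by metis
      then show False using out t by blast
    qed
  qed
  moreover have "inj_on s b"
  proof (rule inj_onI)
    fix t t' assume t: "t \<in> b" "t' \<in> b" "s t = s t'"
    then have "osucc (d t) = osucc (d t')" using funs_unique L_funs s(1) by metis
    then have "d t = d t'" using osucc_inject by simp
    then show "t = t'" using s(2)[OF t(1)] s(2)[OF t(2)] t(3) by metis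
  qed
  then have "|b| =o |s ` b|" using card_of_ordIsoI[of s b "s ` b"] by (simp add: bij_betw_def)
  then have "|s ` b| =o |b|" by (rule ordIso_symmetric)
  ultimately show ?thesis using that by blast
qed

text \<open>\<chi> is infinite, while 0 and the successor ordinals have cofinality at most
  1.\<close>

lemma E_ge_lim:
  assumes "\<alpha> \<in> E_ge \<kappa> \<chi>" shows "\<alpha> \<in> elts \<kappa>" "limit_ord \<alpha>" "cf \<alpha> \<notin> elts \<chi>"
proof -
  show ak: "\<alpha> \<in> elts \<kappa>" using assms unfolding E_ge_def by auto
  have sub: "elts \<chi> \<subseteq> elts (cf \<alpha>)" using assms unfolding E_ge_def by auto
  note oa = Ord_below[OF ak]
  show "cf \<alpha> \<notin> elts \<chi>" using sub mem_irrefl by blast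
  have inf: "infinite (elts \<chi>)" using chi_regular unfolding regular_cardinal_def by blast
  from oa show "limit_ord \<alpha>"
  proof (cases rule: Ord_cases)
    case 1
    have "cofinal_length \<alpha> ozero" unfolding cofinal_length_def 1 by simp
    then have "elts (cf \<alpha>) \<subseteq> {}" using cf_le[OF oa Ord_ozero] by simp
    then show ?thesis using inf sub by auto
  next
    case (2 \<beta>)
    have "cofinal_length \<alpha> (osucc ozero)"
      unfolding cofinal_length_def elts_one
      using 2 elts_osucc[of \<beta>] Ord_elts_subset[OF Ord_in_Ord[OF oa 2(1)]] by (intro exI[of _ "\<lambda>_. \<beta>"]) auto
    then have "elts (cf \<alpha>) \<subseteq> {ozero}" using cf_le[OF oa Ord_one] elts_one by simp
    then show ?thesis using inf sub by (meson finite.emptyI finite.insertI finite_subset order_trans)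
  qed
qed

end

section \<open>Sealing antichains by the guessing principle\<close>

locale souslin_guess = souslin_setup \<kappa> \<chi> \<sigma> CC
  for \<kappa> \<chi> \<sigma> :: "'k hset" and CC :: "'k hset \<Rightarrow> 'k hset set" +
  fixes B :: "'k hset set"
  assumes guessing: "\<And>\<Omega> p. \<Omega> \<subseteq> Hset \<kappa> \<Longrightarrow> p \<in> Hset_plus \<kappa> \<Longrightarrow> \<exists>\<alpha>\<in>E_ge \<kappa> \<chi>. \<forall>C\<in>CC \<alpha>.
      osup {\<gamma>\<in>fdom C. succ_set (osucc ozero) (fdom C - elts \<gamma>) \<subseteq> guess \<kappa> B \<Omega> p C} = \<alpha>"
begin

lemma T_subset_Hset: "T \<subseteq> Hset \<kappa>"
  using funs_Hset L_funs by (blast elim: TE)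

lemma T_card: "|T| \<le>o |elts \<kappa>|"
  unfolding T_def
proof (rule card_of_UNION_ordLeq_infinite[OF infinite_kappa])
  show "|elts \<kappa>| \<le>o |elts \<kappa>|" using ordIso_refl ordIso_imp_ordLeq card_of_Card_order by blast
  show "\<forall>i\<in>elts \<kappa>. |L i| \<le>o |elts \<kappa>|" using L_card ordLess_imp_ordLeq by blast
qed

text \<open>The one place where guesses act. At level \<alpha> every node has followed some ladder
  through a point \<beta> where the guess is M \<inter> D, and the closure of M makes sealing
  possible there, so the chosen extension went above an element of D.\<close>

lemma dense_meets_level:
  assumes D: "D \<subseteq> T" and dense: "\<And>t. t \<in> T \<Longrightarrow> \<exists>d\<in>D. elts t \<subseteq> elts d"
  obtains \<alpha> where "\<alpha> \<in> elts \<kappa>" "\<And>t. t \<in> L \<alpha> \<Longrightarrow> \<exists>d\<in>D. elts d \<subseteq> elts t"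
proof -
  have "T \<noteq> {}" using L_nonempty[OF ozero_below] ozero_below unfolding T_def by blast
  then obtain g where g: "g ` elts \<kappa> = T" using card_of_ordLeq2[of T "elts \<kappa>"] T_card by auto
  define idx where "idx = inv_into (elts \<kappa>) g"
  have idx: "idx t \<in> elts \<kappa>" "g (idx t) = t" if "t \<in> T" for t
  proof -
    have "t \<in> g ` elts \<kappa>" using that g by simp
    then show "idx t \<in> elts \<kappa>" "g (idx t) = t" unfolding idx_def by (rule inv_into_into, rule f_inv_into_f)
  qed
  have "\<forall>\<xi>\<in>elts \<kappa>. \<exists>z. z \<in> D \<and> elts (g \<xi>) \<subseteq> elts z"
  proof
    fix \<xi> assume "\<xi> \<in> elts \<kappa>"
    then have "g \<xi> \<in> g ` elts \<kappa>" by (rule imageI)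
    then have "g \<xi> \<in> T" using g by simp
    then show "\<exists>z. z \<in> D \<and> elts (g \<xi>) \<subseteq> elts z" using dense by blast
  qed
  from bchoice[OF this] obtain d where d0: "\<forall>\<xi>\<in>elts \<kappa>. d \<xi> \<in> D \<and> elts (g \<xi>) \<subseteq> elts (d \<xi>)" by (elim exE)
  have "\<forall>\<xi>\<in>elts \<kappa>. \<exists>\<beta>. \<beta> \<in> elts \<kappa> \<and> d \<xi> \<in> L \<beta>" using d0 D unfolding T_def by blast
  from bchoice[OF this] obtain h where h: "\<forall>\<xi>\<in>elts \<kappa>. h \<xi> \<in> elts \<kappa> \<and> d \<xi> \<in> L (h \<xi>)" by (elim exE)
  \<comment> \<open>The same bound serves \<xi> in two roles: as a level, it bounds the indices of
    the nodes there; as an index, it bounds the level of the chosen extension of that node.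
    Regularity and the small levels provide it.\<close>
  have "\<forall>\<xi>\<in>elts \<kappa>. \<exists>\<beta>. \<beta> \<in> elts \<kappa> \<and> idx ` L \<xi> \<union> {h \<xi>} \<subseteq> elts \<beta>"
  proof
    fix \<xi> assume x: "\<xi> \<in> elts \<kappa>"
    have "idx ` L \<xi> \<subseteq> elts \<kappa>" using idx(1) x unfolding T_def by blast
    then have "idx ` L \<xi> \<union> {h \<xi>} \<subseteq> elts \<kappa>" using h x by blast
    moreover have "|idx ` L \<xi> \<union> {h \<xi>}| <o |elts \<kappa>|"
      by (intro card_Un_less card_image_less L_card x card_finite_less) simp
    ultimately show "\<exists>\<beta>. \<beta> \<in> elts \<kappa> \<and> idx ` L \<xi> \<union> {h \<xi>} \<subseteq> elts \<beta>" using bounded_kappa by metis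
  qed
  from bchoice[OF this] obtain b where b: "\<forall>\<xi>\<in>elts \<kappa>. b \<xi> \<in> elts \<kappa> \<and> idx ` L \<xi> \<union> {h \<xi>} \<subseteq> elts (b \<xi>)"
    by (elim exE)
  define p where "p = hfun \<kappa> (\<lambda>\<xi>. opair (d \<xi>) (b \<xi>))"
  have DH: "D \<subseteq> Hset \<kappa>" using D T_subset_Hset by blast
  have pH: "p \<in> Hset_plus \<kappa>"
  proof (rule Hset_plus_I)
    show "|elts p| \<le>o |elts \<kappa>|" unfolding p_def elts_hfun by (rule card_of_image)
    have "opair \<xi> (opair (d \<xi>) (b \<xi>)) \<in> Hset \<kappa>" if "\<xi> \<in> elts \<kappa>" for \<xi>
    proof -
      have "d \<xi> \<in> Hset \<kappa>" using that d0 DH by blast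
      moreover have "b \<xi> \<in> Hset \<kappa>" using that b Ord_Hset by blast
      ultimately show ?thesis using opair_Hset Ord_Hset[OF that] by blast
    qed
    then show "elts p \<subseteq> Hset_plus \<kappa>" unfolding p_def elts_hfun using Hset_subset_plus by blast
  qed
  \<comment> \<open>The guess holds for all ladders at \<alpha> at once, so it is available for
    whichever ladder a node of level \<alpha> follows.\<close>
  obtain \<alpha> where E: "\<alpha> \<in> E_ge \<kappa> \<chi>" and gs: "\<forall>C\<in>CC \<alpha>.
      osup {\<gamma>\<in>fdom C. succ_set (osucc ozero) (fdom C - elts \<gamma>) \<subseteq> guess \<kappa> B D p C} = \<alpha>"
    using guessing[OF DH pH] by blast
  note \<alpha> = E_ge_lim[OF E]
  have "\<exists>d\<in>D. elts d \<subseteq> elts t" if t: "t \<in> L \<alpha>" for t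
  proof -
    obtain C \<gamma> where C: "C \<in> CC \<alpha>" "\<gamma> \<in> fdom C" and st: "\<And>\<beta>. \<beta> \<in> fdom C \<Longrightarrow> \<gamma> \<in> elts \<beta> \<Longrightarrow> step C t \<beta>"
      using L_lim[OF t \<alpha>(2,3,1)] by blast
    note l = \<alpha>(1,2) C(1)
    let ?G = "{\<gamma>\<in>fdom C. succ_set (osucc ozero) (fdom C - elts \<gamma>) \<subseteq> guess \<kappa> B D p C}"
    have "?G \<subseteq> elts \<alpha>" using ladder_subset[OF l] by blast
    then have "elts (osup ?G) = (\<Union>x\<in>?G. elts x)" by (rule elts_osup)
    then have "elts \<alpha> = (\<Union>x\<in>?G. elts x)" using gs C(1) by simp
    moreover have "\<gamma> \<in> elts \<alpha>" using ladder_subset[OF l] C(2) by blast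
    \<comment> \<open>Points whose successor in \<partial>C guesses correctly are unbounded in
      \<alpha>, so one lies above the point \<gamma> from which t obeys the rule.\<close>
    ultimately have "\<gamma> \<in> (\<Union>x\<in>?G. elts x)" by simp
    then obtain \<gamma>' where g': "\<gamma>' \<in> fdom C" "\<gamma> \<in> elts \<gamma>'"
      and succ: "succ_set (osucc ozero) (fdom C - elts \<gamma>') \<subseteq> guess \<kappa> B D p C" by blast
    have g'a: "\<gamma>' \<in> elts \<alpha>" using ladder_subset[OF l] g'(1) by blast
    obtain \<beta>0 where "\<beta>0 \<in> fdom C" "\<gamma>' \<in> elts \<beta>0" using ladder_unbounded[OF l g'a] by blast
    \<comment> \<open>The successor of \<gamma>' in \<partial>C. Having \<gamma>' < \<beta> = M
      \<inter> \<kappa> puts the starting level of the move inside M.\<close>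
    then obtain \<beta> where \<beta>: "\<beta> \<in> fdom C" "\<gamma>' \<in> elts \<beta>"
      and least: "\<And>c. c \<in> elts \<beta> \<Longrightarrow> \<not> (c \<in> fdom C \<and> \<gamma>' \<in> elts c)"
      using Ord_least[of "\<lambda>c. c \<in> fdom C \<and> \<gamma>' \<in> elts c" \<beta>0] ladder_Ord[OF l] by metis
    have og: "Ord \<gamma>'" and ob: "Ord \<beta>" and bk: "\<beta> \<in> elts \<kappa>"
      using ladder_Ord[OF l] ladder_below[OF l] g'(1) \<beta>(1) by auto
    have below: "x \<in> elts \<gamma>' \<or> x = \<gamma>'" if "x \<in> fdom C" "x \<in> elts \<beta>" for x
      using that least Ord_linear[OF ladder_Ord[OF l that(1)] og] by blast
    have "\<beta> \<in> succ_set (osucc ozero) (fdom C - elts \<gamma>')"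
    proof (rule succ_set_one)
      show "fdom C - elts \<gamma>' \<subseteq> elts \<kappa>" using ladder_below[OF l] by blast
      show "\<gamma>' \<in> fdom C - elts \<gamma>'" using g'(1) mem_irrefl by blast
      show "\<beta> \<in> fdom C - elts \<gamma>'" using \<beta> mem_asym by blast
      show "(fdom C - elts \<gamma>') \<inter> elts \<gamma>' = {}" by blast
      show "(fdom C - elts \<gamma>') \<inter> elts \<beta> = {\<gamma>'}"
        using below g'(1) \<beta>(2) mem_irrefl by blast
    qed
    then obtain M where M: "elem_sub M (Hset_plus \<kappa>)" and pM: "p \<in> M"
      and Mk: "M \<inter> elts \<kappa> = elts \<beta>" and MD: "M \<inter> D = elts (fapp C \<beta>)"
      using succ unfolding guess_def by blast
    have tr: "\<forall>x\<in>Hset_plus \<kappa>. elts x \<subseteq> Hset_plus \<kappa>" using Hset_plus_trans by blast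
    have clos: "d \<xi> \<in> M" "b \<xi> \<in> elts \<beta>" if x: "\<xi> \<in> elts \<beta>" for \<xi>
    proof -
      have "\<xi> \<in> M \<inter> elts \<kappa>" using x Mk by simp
      then have xk: "\<xi> \<in> M" "\<xi> \<in> elts \<kappa>" by auto
      have "opair \<xi> (opair (d \<xi>) (b \<xi>)) \<in> elts p" unfolding p_def elts_hfun using xk(2) by blast
      then have "opair (d \<xi>) (b \<xi>) \<in> M"
        using elem_sub_fapp[OF M tr pM _ xk(1)] hfun_is_fun unfolding p_def by blast
      then have m: "d \<xi> \<in> M" "b \<xi> \<in> M" using elem_sub_opair[OF M tr] by blast+
      then show "d \<xi> \<in> M" by blast
      have "b \<xi> \<in> M \<inter> elts \<kappa>" using m(2) b xk(2) by blast
      then show "b \<xi> \<in> elts \<beta>" using Mk by simp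
    qed
    have u: "rs t \<gamma>' \<in> L \<gamma>'" using L_rs[OF t g'a] .
    have g'k: "\<gamma>' \<in> elts \<kappa>" using ladder_below[OF l g'(1)] .
    define \<xi> where "\<xi> = idx (rs t \<gamma>')"
    \<comment> \<open>First use of the bound, with \<gamma>' as a level: it places the index of the
      node at \<gamma>' below \<beta>, hence in M. The second use, with \<xi> as an index, places
      the level of \<open>d \<xi>\<close> below \<beta>.\<close>
    have "\<xi> \<in> elts (b \<gamma>')" using b g'k u unfolding \<xi>_def by blast
    then have xb: "\<xi> \<in> elts \<beta>" using Ord_trans[OF ob clos(2)[OF \<beta>(2)]] by blast
    then have xk: "\<xi> \<in> elts \<kappa>" using below_trans[OF bk] by blast
    have "rs t \<gamma>' \<in> T" using u g'k unfolding T_def by blast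
    then have gx: "g \<xi> = rs t \<gamma>'" using idx(2) unfolding \<xi>_def by simp
    have "h \<xi> \<in> elts (b \<xi>)" using b xk by blast
    then have hb: "h \<xi> \<in> elts \<beta>" using Ord_trans[OF ob clos(2)[OF xb]] by blast
    have dL: "d \<xi> \<in> L (h \<xi>)" "d \<xi> \<in> D" using h d0 xk by auto
    have dt: "elts (rs t \<gamma>') \<subseteq> elts (d \<xi>)" using bspec[OF d0 xk] unfolding gx by blast
    have "d \<xi> \<in> M \<inter> D" using clos(1)[OF xb] dL(2) by blast
    then have dC: "d \<xi> \<in> elts (fapp C \<beta>)" using MD by simp
    \<comment> \<open>Normality lifts \<open>d \<xi>\<close> to level \<beta>. This witness puts
      \<open>extension\<close> in its first case, so the node actually chosen, possibly another one,
      lies above some element of the guess.\<close>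
    obtain y where y: "y \<in> L \<beta>" "elts (d \<xi>) \<subseteq> elts y" using L_normal[OF bk hb dL(1)] by blast
    have sup: "osup (fdom C \<inter> elts \<beta>) = \<gamma>'"
    proof (rule elts_ext)
      show "elts (osup (fdom C \<inter> elts \<beta>)) = elts \<gamma>'"
        unfolding ladder_osup[OF l] using below g'(1) \<beta>(2) Ord_elts_subset[OF og] by blast
    qed
    have "\<gamma> \<in> elts \<beta>" using Ord_trans[OF ob \<beta>(2) g'(2)] .
    then have eq: "rs t \<beta> = extension (L \<beta>) (rs t \<gamma>') (fapp C \<beta>)"
      using st[OF \<beta>(1)] sup unfolding step_def by simp
    have "\<exists>y\<in>L \<beta>. elts (rs t \<gamma>') \<subseteq> elts y \<and> (\<exists>a\<in>elts (fapp C \<beta>). elts a \<subseteq> elts y)"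
      using y dC dt by blast
    then obtain a where a: "a \<in> elts (fapp C \<beta>)" "elts a \<subseteq> elts (rs t \<beta>)"
      using extension_sealed(1) unfolding eq by blast
    have "a \<in> M \<inter> D" using a(1) MD by simp
    then show ?thesis using a(2) rs_subset by blast
  qed
  then show ?thesis using that \<alpha>(1) by blast
qed

lemma antichain_card:
  assumes "antichain T A" shows "|A| <o |elts \<kappa>|"
proof -
  have AT: "A \<subseteq> T" and anti: "\<And>s t. s \<in> A \<Longrightarrow> t \<in> A \<Longrightarrow> \<not> tlt s t"
    using assms unfolding antichain_def by auto
  \<comment> \<open>Dense because a node below some element of A is extended by that element, and
    any other node is in D already.\<close>
  define D where "D = {t \<in> T. (\<exists>a\<in>A. elts a \<subseteq> elts t) \<or> (\<forall>a\<in>A. \<not> elts t \<subseteq> elts a)}"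
  have "D \<subseteq> T" unfolding D_def by blast
  moreover have "\<exists>d\<in>D. elts t \<subseteq> elts d" if "t \<in> T" for t
    using that AT unfolding D_def by blast
  ultimately obtain \<alpha> where \<alpha>: "\<alpha> \<in> elts \<kappa>" "\<And>t. t \<in> L \<alpha> \<Longrightarrow> \<exists>d\<in>D. elts d \<subseteq> elts t"
    using dense_meets_level by blast
  have "A \<subseteq> (\<Union>\<beta>\<in>elts (osucc \<alpha>). L \<beta>)"
  proof
    fix a assume a: "a \<in> A"
    then obtain \<beta> where b: "\<beta> \<in> elts \<kappa>" "a \<in> L \<beta>" using AT TE by blast
    have "\<beta> \<in> elts (osucc \<alpha>)"
    proof (rule ccontr)
      assume "\<beta> \<notin> elts (osucc \<alpha>)"
      then have ab: "\<alpha> \<in> elts \<beta>"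
        using elts_osucc[of \<alpha>] Ord_linear[OF Ord_below[OF b(1)] Ord_below[OF \<alpha>(1)]] by auto
      note r = L_rs[OF b(2) ab]
      obtain d where d: "d \<in> D" "elts d \<subseteq> elts (rs a \<alpha>)" using \<alpha>(2)[OF r] by blast
      have lt: "tlt (rs a \<alpha>) a"
        using tlt_iff[OF r b(2)] Ord_below \<alpha>(1) b(1) ab by blast
      then have "elts d \<subset> elts a" using d(2) unfolding tlt_def by blast
      \<comment> \<open>As \<open>d\<close> lies below \<open>a\<close>, it is in D only by
        extending some element of A; that element is then strictly below \<open>a\<close>.\<close>
      moreover from this obtain a' where "a' \<in> A" "elts a' \<subseteq> elts d"
        using d(1) a unfolding D_def by blast
      ultimately show False using anti[of a' a] a unfolding tlt_def by blast
    qed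
    then show "a \<in> (\<Union>\<beta>\<in>elts (osucc \<alpha>). L \<beta>)" using b(2) by blast
  qed
  moreover have "|\<Union>\<beta>\<in>elts (osucc \<alpha>). L \<beta>| <o |elts \<kappa>|"
    using osucc_below[OF \<alpha>(1)] by (intro card_UN_less card_less_kappa L_card) (auto dest: below_trans)
  ultimately show ?thesis using card_subset_less by blast
qed

lemma T_souslin: "streamlined_souslin \<kappa> T"
proof -
  have anti: "\<not> |A| =o |elts \<kappa>|" if "antichain T A" for A
    using antichain_card[OF that] not_ordLess_ordIso by blast
  moreover have "\<not> |b| =o |elts \<kappa>|" if b: "branch T b" for b
  proof
    assume k: "|b| =o |elts \<kappa>|"
    have "tchain T b" using b unfolding branch_def by blast
    then obtain S where S: "antichain T S" "|S| =o |b|" using chain_to_antichain by blast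
    then show False using anti k ordIso_transitive by blast
  qed
  ultimately show ?thesis
    unfolding streamlined_souslin_def using T_streamlined T_height L_card level_T by auto
qed

end

theorem theorem6p8:
  fixes \<kappa> \<chi> \<sigma> :: "'k hset"
  assumes "regular_cardinal \<kappa>" and "uncountable (elts \<kappa>)"
    and "regular_cardinal \<chi>" and "\<chi> \<in> elts \<kappa>" and "lt_closed \<chi> \<kappa>"
    and "\<sigma> \<in> elts \<kappa>"
    and "P_bullet \<kappa> \<kappa> (chi_sq_star \<chi>) (osucc ozero) {E_ge \<kappa> \<chi>} \<kappa>"
  shows "\<exists>T. streamlined_souslin \<kappa> T \<and> normal_tree \<kappa> T \<and> prolific \<kappa> T \<and>
             splitting \<sigma> T \<and> complete_tree \<chi> T"
proof -
  obtain CC B where CC: "\<forall>\<alpha>\<in>acc (elts \<kappa>).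
        CC \<alpha> \<subseteq> {C\<in>F_class \<kappa>. alpha_of C = \<alpha>} \<and> CC \<alpha> \<noteq> {} \<and> |CC \<alpha>| <o |elts \<kappa>| \<and>
        (\<forall>C\<in>CC \<alpha>. \<forall>\<beta>\<in>acc (fdom C). \<exists>D\<in>CC \<beta>. chi_sq_star \<chi> D C)"
    and P: "\<forall>\<Omega> p \<iota>. (\<forall>i\<in>elts (osucc ozero). \<Omega> i \<subseteq> Hset \<kappa> \<and> p i \<in> Hset_plus \<kappa> \<and> \<iota> i \<in> elts \<kappa>) \<longrightarrow>
        (\<forall>S\<in>{E_ge \<kappa> \<chi>}. \<forall>n\<in>elts omega.
           stationary_in \<kappa> {\<alpha>\<in>S. |CC \<alpha>| <o |elts \<kappa>| \<and>
             (\<forall>C\<in>CC \<alpha>. \<forall>i\<in>elts \<alpha> \<inter> elts (osucc ozero).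
                osup {\<gamma>\<in>fdom C. succ_set n (fdom C - elts \<gamma>) \<subseteq>
                                guess \<kappa> (B (\<iota> i)) (\<Omega> i) (p i) C} = \<alpha>)})"
    using assms(7) unfolding P_bullet_def by (elim exE conjE)
  interpret souslin_setup \<kappa> \<chi> \<sigma> CC
    by unfold_locales (use assms CC in auto)
  \<comment> \<open>A single guessing task is posed, constantly, in the cell of index 0, with n = 1
    to reach the point directly after \<gamma>'.\<close>
  interpret souslin_guess \<kappa> \<chi> \<sigma> CC "B ozero"
  proof unfold_locales
    fix \<Omega> p assume H: "\<Omega> \<subseteq> Hset \<kappa>" "p \<in> Hset_plus \<kappa>"
    let ?S = "{\<alpha>\<in>E_ge \<kappa> \<chi>. |CC \<alpha>| <o |elts \<kappa>| \<and>
             (\<forall>C\<in>CC \<alpha>. \<forall>i\<in>elts \<alpha> \<inter> elts (osucc ozero).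
                osup {\<gamma>\<in>fdom C. succ_set (osucc ozero) (fdom C - elts \<gamma>) \<subseteq>
                                guess \<kappa> (B ozero) \<Omega> p C} = \<alpha>)}"
    have "stationary_in \<kappa> ?S"
      using P[rule_format, of "\<lambda>_. \<Omega>" "\<lambda>_. p" "\<lambda>_. ozero" "E_ge \<kappa> \<chi>" "osucc ozero"]
        H ozero_below one_omega by simp
    \<comment> \<open>\<kappa> is a club in itself, so the stationary set has a member.\<close>
    moreover have "club_in \<kappa> (elts \<kappa>)"
      unfolding club_in_def using elts_osup[of "elts \<kappa>" \<kappa>] lim_kappa unfolding limit_ord_def
      by (auto intro: elts_ext)
    ultimately obtain \<alpha> where a: "\<alpha> \<in> ?S" unfolding stationary_in_def by blast
    then have E: "\<alpha> \<in> E_ge \<kappa> \<chi>" by blast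
    \<comment> \<open>The principle speaks of indices below both \<alpha> and \<theta> = 1; as
      \<alpha> is not 0, the index 0 is among them.\<close>
    have "ozero \<in> elts \<alpha>"
      using E_ge_lim[OF E] ozero_mem Ord_below unfolding limit_ord_def by blast
    then have "\<forall>C\<in>CC \<alpha>. osup {\<gamma>\<in>fdom C. succ_set (osucc ozero) (fdom C - elts \<gamma>) \<subseteq>
        guess \<kappa> (B ozero) \<Omega> p C} = \<alpha>"
      using a elts_one by blast
    then show "\<exists>\<alpha>\<in>E_ge \<kappa> \<chi>. \<forall>C\<in>CC \<alpha>. osup {\<gamma>\<in>fdom C. succ_set (osucc ozero) (fdom C - elts \<gamma>) \<subseteq>
        guess \<kappa> (B ozero) \<Omega> p C} = \<alpha>"
      using E by blast
  qed
  show ?thesis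
    using T_souslin T_normal T_prolific T_splitting T_complete by blast
qed

end
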